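(* Let $E$ be a separable complex Hilbert space and let $\Phi \in L^\infty_{\mathcal{B}(E)}(\mathbb{T})$. Then the operator $$M^{S_E^*}_{S_E^*}(H_\Phi) = \begin{bmatrix} S_E^* & H_\Phi \\ 0 & S_E^* \end{bmatrix}$$ on $H^2_E(\mathbb{D}) \oplus H^2_E(\mathbb{D})$ is similar to a contraction if and only if $$\widetilde{\Phi}^* \in (z-\bar z)\, L^\infty_{\mathcal{B}(E)}(\mathbb{T}) + \overline{zH^\infty_{\mathcal{B}(E)}(\mathbb{D})},$$ or, equivalently, if and only if $$\Phi \in (z-\bar z)\, L^\infty_{\mathcal{B}(E)}(\mathbb{T}) + \overline{zH^\infty_{\mathcal{B}(E)}(\mathbb{D})}.$$ In other words, $M^{S_E}_{S_E}(H_\Phi) = \begin{bmatrix} S_E & H_\Phi \\ 0 & S_E \end{bmatrix}$ is similar to a contraction if and only if $M^{S_E^*}_{S_E^*}(H_\Phi)$ is similar to a contraction.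
   Context: $\mathcal{B}(H)$ denotes the bounded linear operators on a Hilbert space $H$. An operator $T \in \mathcal{B}(H)$ is a contraction if $\|T\| \le 1$, and is similar to a contraction if there is an invertible $W \in \mathcal{B}(H)$ such that $W^{-1} T W$ is a contraction. $\mathbb{D}$ is the open unit disc in $\mathbb{C}$, $\mathbb{T} = \partial\mathbb{D}$. $L^2_E(\mathbb{T})$ is the $E$-valued $L^2$-space on $\mathbb{T}$ (normalized Lebesgue measure), and $H^2_E(\mathbb{D})$ is the $E$-valued Hardy space, viewed via boundary values as a closed subspace of $L^2_E(\mathbb{T})$. $S_E$ is the shift on $H^2_E(\mathbb{D})$, $(S_E f)(z) = z f(z)$. $L^\infty_{\mathcal{B}(E)}(\mathbb{T})$ is the space of $\mathcal{B}(E)$-valued essentially bounded (weak-operator) measurable functions on $\mathbb{T}$, with functions equal a.e. identified. $\overline{zH^\infty_{\mathcal{B}(E)}(\mathbb{D})}$ denotes the set of $\Phi \in L^\infty_{\mathcal{B}(E)}(\mathbb{T})$ with Fourier expansion $\Phi = \sum_{n=1}^\infty \bar z^n \Phi_n$, $\Phi_n \in \mathcal{B}(E)$ (i.e. all Fourier coefficients of index $\ge 0$ vanish). $(z-\bar z) L^\infty_{\mathcal{B}(E)}(\mathbb{T}) = \{(z-\bar z)\Theta : \Theta \in L^\infty_{\mathcal{B}(E)}(\mathbb{T})\}$. $\widetilde\Phi(z) = \Phi(\bar z)$ and $\widetilde{\Phi}^*(z) = \Phi(\bar z)^*$ for a.e. $z \in \mathbb{T}$. For $\Phi \in L^\infty_{\mathcal{B}(E)}(\mathbb{T})$,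 the Hankel operator is $H_\Phi = P_{H^2_E(\mathbb{D})} M_\Phi J|_{H^2_E(\mathbb{D})}$, where $M_\Phi f = \Phi f$ on $L^2_E(\mathbb{T})$, $J$ is the flip $(Jf)(z) = f(\bar z)$ on $L^2_E(\mathbb{T})$, and $P_{H^2_E(\mathbb{D})}$ is the orthogonal projection of $L^2_E(\mathbb{T})$ onto $H^2_E(\mathbb{D})$. *)

theory Defs
  imports "HOL-Analysis.Analysis"
begin

section \<open>Complex inner product spaces\<close>

text \<open>
  The complex inner product is linear in its first argument. The underlying real structure, and
  hence norm and topology, are inherited from \<^class>\<open>real_inner\<close>.
\<close>

class complex_inner = real_inner +
  fixes scaleC :: "complex \<Rightarrow> 'a \<Rightarrow> 'a"  (infixr \<open>*\<^sub>C\<close> 75)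
    and cinner :: "'a \<Rightarrow> 'a \<Rightarrow> complex"
  assumes scaleC_add_right: "a *\<^sub>C (x + y) = a *\<^sub>C x + a *\<^sub>C y"
    and scaleC_add_left: "(a + b) *\<^sub>C x = a *\<^sub>C x + b *\<^sub>C x"
    and scaleC_scaleC: "a *\<^sub>C b *\<^sub>C x = (a * b) *\<^sub>C x"
    and scaleC_of_real: "complex_of_real r *\<^sub>C x = r *\<^sub>R x"
    and cinner_commute: "cinner x y = cnj (cinner y x)"
    and cinner_add_left: "cinner (x + y) z = cinner x z + cinner y z"
    and cinner_scaleC_left: "cinner (a *\<^sub>C x) y = a * cinner x y"
    and inner_eq_Re_cinner: "inner x y = Re (cinner x y)"

class chilbert_space = complex_inner + complete_space
begin
subclass banach ..
end

lemma cinner_add_right: "cinner x (y + z) = cinner x y + cinner (x::'a::complex_inner) z"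
  by (metis cinner_add_left cinner_commute complex_cnj_add)

lemma cinner_scaleC_right: "cinner x (a *\<^sub>C y) = cnj a * cinner (x::'a::complex_inner) y"
  by (metis cinner_commute cinner_scaleC_left complex_cnj_mult)

lemma cinner_self: "cinner x x = complex_of_real ((norm (x::'a::complex_inner))\<^sup>2)"
proof -
  have "Im (cinner x x) = 0"
    using arg_cong[OF cinner_commute[of x x], of Im] by simp
  moreover have "Re (cinner x x) = (norm x)\<^sup>2"
    by (metis inner_eq_Re_cinner power2_norm_eq_inner)
  ultimately show ?thesis
    by (simp add: complex_eq_iff)
qed

lemma norm_scaleC: "norm (a *\<^sub>C x) = cmod a * norm (x::'a::complex_inner)"
proof -
  have "complex_of_real ((norm (a *\<^sub>C x))\<^sup>2) = complex_of_real ((cmod a * norm x)\<^sup>2)"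
    unfolding cinner_self[symmetric] cinner_scaleC_left cinner_scaleC_right
    by (simp add: cinner_self power_mult_distrib complex_norm_square del: of_real_power)
  then show ?thesis
    by (metis norm_ge_zero mult_nonneg_nonneg of_real_eq_iff power2_eq_imp_eq)
qed

lemma norm_cinner_le: "cmod (cinner x y) \<le> norm x * norm (y::'a::complex_inner)"
proof (cases "cinner x y = 0")
  case False
  define a where "a = cnj (cinner x y) / cmod (cinner x y)"
  have "cmod a = 1"
    using False by (simp add: a_def norm_divide)
  have "a * cinner x y = cmod (cinner x y)"
    using False by (simp add: a_def complex_norm_square[symmetric] power2_eq_square mult.commute)
  then have "cmod (cinner x y) = inner (a *\<^sub>C x) y"
    by (simp add: inner_eq_Re_cinner cinner_scaleC_left)
  also have "\<dots> \<le> norm (a *\<^sub>C x) * norm y"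
    by (rule norm_cauchy_schwarz)
  finally show ?thesis
    by (simp add: norm_scaleC \<open>cmod a = 1\<close>)
qed auto

lemma bounded_bilinear_scaleC:
  "bounded_bilinear (scaleC :: complex \<Rightarrow> 'a \<Rightarrow> 'a::complex_inner)"
proof
  fix a a' :: complex and b b' :: 'a and r :: real
  show "(a + a') *\<^sub>C b = a *\<^sub>C b + a' *\<^sub>C b" by (rule scaleC_add_left)
  show "a *\<^sub>C (b + b') = a *\<^sub>C b + a *\<^sub>C b'" by (rule scaleC_add_right)
  show "(r *\<^sub>R a) *\<^sub>C b = r *\<^sub>R a *\<^sub>C b"
    by (simp add: scaleR_conv_of_real scaleC_scaleC flip: scaleC_of_real)
  show "a *\<^sub>C r *\<^sub>R b = r *\<^sub>R a *\<^sub>C b"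
    by (simp add: scaleC_scaleC mult.commute flip: scaleC_of_real)
  show "\<exists>K. \<forall>a b. norm (a *\<^sub>C (b::'a)) \<le> norm a * norm b * K"
    by (rule exI[of _ 1]) (simp add: norm_scaleC)
qed

lemma bounded_bilinear_cinner:
  "bounded_bilinear (cinner :: 'a::complex_inner \<Rightarrow> 'a \<Rightarrow> complex)"
proof
  fix a a' b b' :: 'a and r :: real
  show "cinner (a + a') b = cinner a b + cinner a' b" by (rule cinner_add_left)
  show "cinner a (b + b') = cinner a b + cinner a b'" by (rule cinner_add_right)
  show "cinner (r *\<^sub>R a) b = r *\<^sub>R cinner a b"
    by (simp add: scaleR_conv_of_real cinner_scaleC_left flip: scaleC_of_real)
  show "cinner a (r *\<^sub>R b) = r *\<^sub>R cinner a b"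
    by (simp add: scaleR_conv_of_real cinner_scaleC_right flip: scaleC_of_real)
  show "\<exists>K. \<forall>a b. norm (cinner a (b::'a)) \<le> norm a * norm b * K"
    by (rule exI[of _ 1]) (simp add: norm_cinner_le)
qed

instantiation prod :: (complex_inner, complex_inner) complex_inner
begin

definition scaleC_prod_def: "a *\<^sub>C p = (a *\<^sub>C fst p, a *\<^sub>C snd p)"
definition cinner_prod_def: "cinner p q = cinner (fst p) (fst q) + cinner (snd p) (snd q)"

instance
proof
  fix a b :: complex and x y z :: "'a \<times> 'b" and r :: real
  show "a *\<^sub>C (x + y) = a *\<^sub>C x + a *\<^sub>C y" "(a + b) *\<^sub>C x = a *\<^sub>C x + b *\<^sub>C x"
    "a *\<^sub>C b *\<^sub>C x = (a * b) *\<^sub>C x" "complex_of_real r *\<^sub>C x = r *\<^sub>R x"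
    by (simp_all add: scaleC_prod_def prod_eq_iff scaleC_add_right scaleC_add_left scaleC_scaleC
        scaleC_of_real)
  show "cinner x y = cnj (cinner y x)"
    unfolding cinner_prod_def by (metis cinner_commute complex_cnj_add)
  show "cinner (x + y) z = cinner x z + cinner y z" "cinner (a *\<^sub>C x) y = a * cinner x y"
    "inner x y = Re (cinner x y)"
    by (simp_all add: cinner_prod_def scaleC_prod_def cinner_add_left cinner_scaleC_left
        inner_prod_def inner_eq_Re_cinner algebra_simps)
qed

end


section \<open>Operators\<close>

definition bounded_clinear :: "('h::complex_inner \<Rightarrow> 'k::complex_inner) \<Rightarrow> bool" where
  "bounded_clinear T \<longleftrightarrow> bounded_linear T \<and> (\<forall>a x. T (a *\<^sub>C x) = a *\<^sub>C T x)"

definition contraction :: "('h::complex_inner \<Rightarrow> 'h) \<Rightarrow> bool" where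
  "contraction T \<longleftrightarrow> bounded_clinear T \<and> onorm T \<le> 1"

text \<open>\<open>V\<close> is the inverse of \<open>W\<close>.\<close>

definition similar_to_contraction :: "('h::complex_inner \<Rightarrow> 'h) \<Rightarrow> bool" where
  "similar_to_contraction T \<longleftrightarrow>
    (\<exists>(W :: 'h \<Rightarrow> 'h) (V :: 'h \<Rightarrow> 'h). bounded_clinear W \<and> bounded_clinear V \<and> W \<circ> V = id \<and> V \<circ> W = id \<and>
      contraction (V \<circ> T \<circ> W))"

definition cadjoint :: "('h::complex_inner \<Rightarrow> 'k::complex_inner) \<Rightarrow> 'k \<Rightarrow> 'h" where
  "cadjoint T = (THE A. \<forall>x y. cinner (T x) y = cinner x (A y))"

definition orth_proj :: "'h::complex_inner set \<Rightarrow> 'h \<Rightarrow> 'h" where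
  "orth_proj S x = (THE p. p \<in> S \<and> (\<forall>s\<in>S. cinner (x - p) s = 0))"

definition upper_block :: "('h \<Rightarrow> 'h) \<Rightarrow> ('k \<Rightarrow> 'h) \<Rightarrow> ('k \<Rightarrow> 'k) \<Rightarrow> 'h \<times> 'k \<Rightarrow> 'h::complex_inner \<times> 'k" where
  "upper_block A X B = (\<lambda>(x, y). (A x + X y, B y))"


section \<open>The space of square integrable functions on the circle\<close>

definition circle :: "complex measure" where
  "circle = distr (uniform_measure lborel {0..<2 * pi}) (restrict_space borel (sphere 0 1)) cis"

lemma space_circle [simp]: "space circle = sphere 0 1"
  by (simp add: circle_def space_restrict_space)

lemma sets_circle [measurable_cong]: "sets circle = sets (restrict_space borel (sphere 0 1))"
  by (simp add: circle_def)

lemma prob_space_circle: "emeasure circle (space circle) = 1"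
proof -
  have "cis \<in> borel_measurable borel"
    by (intro borel_measurable_continuous_onI continuous_intros)
  then have "cis \<in> measurable (uniform_measure lborel {0..<2 * pi}) (restrict_space borel (sphere 0 1))"
    by (intro measurable_restrict_space2) auto
  then show ?thesis
    unfolding space_circle unfolding circle_def
    by (subst emeasure_distr)
       (auto simp: sets_restrict_space_iff divide_ennreal vimage_def emeasure_uniform_measure)
qed

interpretation circle: finite_measure circle
  by standard (simp add: prob_space_circle del: space_circle)

definition l2_fun :: "(complex \<Rightarrow> 'e::{complex_inner, second_countable_topology}) set" where
  "l2_fun = {f \<in> borel_measurable circle. integrable circle (\<lambda>z. (norm (f z))\<^sup>2)}"

definition l2_eq ::
    "(complex \<Rightarrow> 'e::{complex_inner, second_countable_topology}) \<Rightarrow> (complex \<Rightarrow> 'e) \<Rightarrow> bool" where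
  "l2_eq f g \<longleftrightarrow> f \<in> l2_fun \<and> g \<in> l2_fun \<and> (AE z in circle. f z = g z)"

lemma measurable_scaleC [measurable (raw)]:
  fixes f :: "'b \<Rightarrow> 'e::{complex_inner, second_countable_topology}"
  assumes "c \<in> borel_measurable M" "f \<in> borel_measurable M"
  shows "(\<lambda>z. c z *\<^sub>C f z) \<in> borel_measurable M"
  using assms by (rule borel_measurable_continuous_Pair)
    (intro bounded_bilinear.continuous_on[OF bounded_bilinear_scaleC] continuous_intros)

lemma measurable_cinner [measurable (raw)]:
  fixes f g :: "'b \<Rightarrow> 'e::{complex_inner, second_countable_topology}"
  assumes "f \<in> borel_measurable M" "g \<in> borel_measurable M"
  shows "(\<lambda>z. cinner (f z) (g z)) \<in> borel_measurable M"
  using assms by (rule borel_measurable_continuous_Pair)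
    (intro bounded_bilinear.continuous_on[OF bounded_bilinear_cinner] continuous_intros)

lemma l2_fun_zero: "(\<lambda>_. 0) \<in> l2_fun"
  by (simp add: l2_fun_def)

lemma l2_fun_add:
  assumes "f \<in> l2_fun" "g \<in> l2_fun"
  shows "(\<lambda>z. f z + g z) \<in> l2_fun"
proof -
  have [measurable]: "f \<in> borel_measurable circle" "g \<in> borel_measurable circle"
    and int: "integrable circle (\<lambda>z. (norm (f z))\<^sup>2)" "integrable circle (\<lambda>z. (norm (g z))\<^sup>2)"
    using assms by (auto simp: l2_fun_def)
  have bound: "(norm (x + y))\<^sup>2 \<le> 2 * (norm x)\<^sup>2 + 2 * (norm y)\<^sup>2" for x y :: 'a
  proof -
    have "(norm (x + y))\<^sup>2 \<le> (norm x + norm y)\<^sup>2"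
      by (intro power_mono norm_triangle_ineq) auto
    also have "\<dots> \<le> 2 * (norm x)\<^sup>2 + 2 * (norm y)\<^sup>2"
      using sum_squares_bound[of "norm x" "norm y"] by (simp add: power2_sum)
    finally show ?thesis .
  qed
  have "integrable circle (\<lambda>z. (norm (f z + g z))\<^sup>2)"
    by (rule Bochner_Integration.integrable_bound[where f = "\<lambda>z. 2 * (norm (f z))\<^sup>2 + 2 * (norm (g z))\<^sup>2"])
       (use int bound in \<open>auto intro!: AE_I2\<close>)
  then show ?thesis by (simp add: l2_fun_def)
qed

lemma l2_fun_scaleC:
  assumes "f \<in> l2_fun"
  shows "(\<lambda>z. a *\<^sub>C f z) \<in> l2_fun"
proof -
  have [measurable]: "f \<in> borel_measurable circle"
    using assms by (auto simp: l2_fun_def)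
  show ?thesis
    using assms by (auto simp: l2_fun_def norm_scaleC power_mult_distrib)
qed

lemma l2_fun_scaleR:
  assumes "f \<in> l2_fun"
  shows "(\<lambda>z. r *\<^sub>R f z) \<in> l2_fun"
  using l2_fun_scaleC[OF assms, of "of_real r"] by (simp add: scaleC_of_real)

lemma l2_fun_uminus: "f \<in> l2_fun \<Longrightarrow> (\<lambda>z. - f z) \<in> l2_fun"
  using l2_fun_scaleR[of f "-1"] by simp

lemma l2_fun_diff: "f \<in> l2_fun \<Longrightarrow> g \<in> l2_fun \<Longrightarrow> (\<lambda>z. f z - g z) \<in> l2_fun"
  using l2_fun_add[OF _ l2_fun_uminus[of g], of f] by simp

lemma integrable_cinner:
  assumes "f \<in> l2_fun" "g \<in> l2_fun"
  shows "integrable circle (\<lambda>z. cinner (f z) (g z))"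
proof -
  have [measurable]: "f \<in> borel_measurable circle" "g \<in> borel_measurable circle"
    and int: "integrable circle (\<lambda>z. (norm (f z))\<^sup>2)" "integrable circle (\<lambda>z. (norm (g z))\<^sup>2)"
    using assms by (auto simp: l2_fun_def)
  have bound: "cmod (cinner x y) \<le> (norm x)\<^sup>2 + (norm y)\<^sup>2" for x y :: 'a
  proof -
    have "0 \<le> norm x * norm y" by simp
    then show ?thesis
      using norm_cinner_le[of x y] sum_squares_bound[of "norm x" "norm y"] by linarith
  qed
  show ?thesis
    by (rule Bochner_Integration.integrable_bound[where f = "\<lambda>z. (norm (f z))\<^sup>2 + (norm (g z))\<^sup>2"])
       (use int bound in \<open>auto intro!: AE_I2\<close>)
qed

quotient_type (overloaded) 'e L2 =
  "complex \<Rightarrow> 'e::{complex_inner, second_countable_topology}" / partial: l2_eq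
proof (rule part_equivpI)
  show "\<exists>x. l2_eq x x"
    using l2_fun_zero by (auto simp: l2_eq_def)
  show "symp l2_eq"
    by (rule sympI) (auto simp: l2_eq_def)
  show "transp l2_eq"
    by (rule transpI) (auto simp: l2_eq_def)
qed

instantiation L2 :: ("{complex_inner, second_countable_topology}") complex_inner
begin

lift_definition zero_L2 :: "'a L2" is "\<lambda>_. 0"
  by (simp add: l2_eq_def l2_fun_zero)

lift_definition plus_L2 :: "'a L2 \<Rightarrow> 'a L2 \<Rightarrow> 'a L2" is "\<lambda>f g z. f z + g z"
  by (auto simp: l2_eq_def l2_fun_add)

lift_definition uminus_L2 :: "'a L2 \<Rightarrow> 'a L2" is "\<lambda>f z. - f z"
  by (auto simp: l2_eq_def l2_fun_uminus)

lift_definition minus_L2 :: "'a L2 \<Rightarrow> 'a L2 \<Rightarrow> 'a L2" is "\<lambda>f g z. f z - g z"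
  by (auto simp: l2_eq_def l2_fun_diff)

lift_definition scaleR_L2 :: "real \<Rightarrow> 'a L2 \<Rightarrow> 'a L2" is "\<lambda>r f z. r *\<^sub>R f z"
  by (auto simp: l2_eq_def l2_fun_scaleR)

lift_definition scaleC_L2 :: "complex \<Rightarrow> 'a L2 \<Rightarrow> 'a L2" is "\<lambda>a f z. a *\<^sub>C f z"
  by (auto simp: l2_eq_def l2_fun_scaleC)

lift_definition cinner_L2 :: "'a L2 \<Rightarrow> 'a L2 \<Rightarrow> complex"
  is "\<lambda>f g. LINT z|circle. cinner (f z) (g z)"
proof -
  fix f f' g g' :: "complex \<Rightarrow> 'a"
  assume a: "l2_eq f f'" "l2_eq g g'"
  then have [measurable]: "f \<in> borel_measurable circle" "f' \<in> borel_measurable circle"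
    "g \<in> borel_measurable circle" "g' \<in> borel_measurable circle"
    by (auto simp: l2_eq_def l2_fun_def)
  show "(LINT z|circle. cinner (f z) (g z)) = (LINT z|circle. cinner (f' z) (g' z))"
    by (rule integral_cong_AE) (use a in \<open>auto simp: l2_eq_def\<close>)
qed

definition inner_L2_def: "inner (f::'a L2) g = Re (cinner f g)"
definition norm_L2_def: "norm (f::'a L2) = sqrt (inner f f)"
definition sgn_L2_def: "sgn (f::'a L2) = scaleR (inverse (norm f)) f"
definition dist_L2_def: "dist (f::'a L2) g = norm (f - g)"
definition uniformity_L2_def:
  "(uniformity :: ('a L2 \<times> 'a L2) filter) = (INF e\<in>{0<..}. principal {(x, y). dist x y < e})"
definition open_L2_def:
  "open (U :: 'a L2 set) \<longleftrightarrow> (\<forall>x\<in>U. eventually (\<lambda>(x', y). x' = x \<longrightarrow> y \<in> U) uniformity)"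

instance
proof
  fix x y z :: "'a L2" and a b :: real and c d :: complex
  show "x + y + z = x + (y + z)"
    by transfer (auto simp: l2_eq_def add.assoc intro!: l2_fun_add)
  show "x + y = y + x"
    by transfer (auto simp: l2_eq_def add.commute intro!: l2_fun_add)
  show zero_add: "0 + x = x" for x :: "'a L2"
    by transfer (auto simp: l2_eq_def)
  show "- x + x = 0"
    by transfer (auto simp: l2_eq_def l2_fun_zero)
  show "x - y = x + - y"
    by transfer (auto simp: l2_eq_def intro: l2_fun_diff)
  show "a *\<^sub>R (x + y) = a *\<^sub>R x + a *\<^sub>R y"
    by transfer (auto simp: l2_eq_def scaleR_add_right intro!: l2_fun_add l2_fun_scaleR)
  show "(a + b) *\<^sub>R x = a *\<^sub>R x + b *\<^sub>R x"
    by transfer (auto simp: l2_eq_def scaleR_add_left intro!: l2_fun_add l2_fun_scaleR)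
  show "a *\<^sub>R b *\<^sub>R x = (a * b) *\<^sub>R x"
    by transfer (auto simp: l2_eq_def intro!: l2_fun_scaleR)
  show "1 *\<^sub>R x = x"
    by transfer (auto simp: l2_eq_def)
  show "sgn x = scaleR (inverse (norm x)) x" by (rule sgn_L2_def)
  show "dist x y = norm (x - y)" by (rule dist_L2_def)
  show "uniformity = (INF e\<in>{0<..}. principal {(x :: 'a L2, y). dist x y < e})"
    by (rule uniformity_L2_def)
  show "open U \<longleftrightarrow> (\<forall>x\<in>U. eventually (\<lambda>(x', y). x' = x \<longrightarrow> y \<in> U) uniformity)" for U :: "'a L2 set"
    by (rule open_L2_def)
  show scaleC_of_real: "complex_of_real r *\<^sub>C x = r *\<^sub>R x" for r and x :: "'a L2"
    by transfer (auto simp: l2_eq_def scaleC_of_real intro!: l2_fun_scaleR)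
  show commute: "cinner x y = cnj (cinner y x)" for x y :: "'a L2"
  proof transfer
    fix f g :: "complex \<Rightarrow> 'a"
    have "(LINT z|circle. cinner (f z) (g z)) = (LINT z|circle. cnj (cinner (g z) (f z)))"
      by (metis cinner_commute)
    then show "(LINT z|circle. cinner (f z) (g z)) = cnj (LINT z|circle. cinner (g z) (f z))"
      by simp
  qed
  show add: "cinner (x + y) z = cinner x z + cinner y z" for x y z :: "'a L2"
    by transfer (simp add: l2_eq_def cinner_add_left integrable_cinner)
  show scale: "cinner (c *\<^sub>C x) y = c * cinner x y" for c and x y :: "'a L2"
    by transfer (simp add: l2_eq_def cinner_scaleC_left)
  show inner: "inner x y = Re (cinner x y)" for x y :: "'a L2"
    by (rule inner_L2_def)
  show "inner x y = inner y x"
    unfolding inner using arg_cong[OF commute[of x y], of Re] by simp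
  show "inner (x + y) z = inner x z + inner y z"
    by (simp add: inner add)
  show "inner (a *\<^sub>R x) y = a * inner x y"
    by (simp add: inner scale flip: scaleC_of_real)
  have self: "inner x x = (LINT z|circle. (norm (rep_L2 x z))\<^sup>2)" for x :: "'a L2"
    unfolding inner cinner_L2.rep_eq cinner_self by (subst integral_complex_of_real) simp
  show "0 \<le> inner x x"
    unfolding self by simp
  have rep: "rep_L2 x \<in> l2_fun"
    using Quotient_rep_reflp[OF Quotient_L2, of x] by (simp add: l2_eq_def)
  show "inner x x = 0 \<longleftrightarrow> x = 0"
  proof
    assume "inner x x = 0"
    then have "AE z in circle. (norm (rep_L2 x z))\<^sup>2 = 0"
      using rep unfolding self
      by (subst integral_nonneg_eq_0_iff_AE[symmetric]) (auto simp: l2_fun_def)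
    then have "l2_eq (rep_L2 x) (\<lambda>_. 0)"
      using rep l2_fun_zero by (auto simp: l2_eq_def)
    then have "abs_L2 (rep_L2 x) = 0"
      unfolding zero_L2_def by (rule Quotient_rel_abs[OF Quotient_L2])
    then show "x = 0"
      by (simp add: Quotient_abs_rep[OF Quotient_L2])
  next
    assume "x = 0"
    then show "inner x x = 0"
      using add[of 0 0 0] by (simp add: inner zero_add)
  qed
  show "norm x = sqrt (inner x x)" by (rule norm_L2_def)
  show "c *\<^sub>C (x + y) = c *\<^sub>C x + c *\<^sub>C y"
    by transfer (auto simp: l2_eq_def scaleC_add_right intro!: l2_fun_add l2_fun_scaleC)
  show "(c + d) *\<^sub>C x = c *\<^sub>C x + d *\<^sub>C x"
    by transfer (auto simp: l2_eq_def scaleC_add_left intro!: l2_fun_add l2_fun_scaleC)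
  show "c *\<^sub>C d *\<^sub>C x = (c * d) *\<^sub>C x"
    by transfer (auto simp: l2_eq_def scaleC_scaleC intro!: l2_fun_scaleC)
qed

end


section \<open>The Hardy space\<close>

definition hardy_disc :: "(complex \<Rightarrow> 'e::complex_inner) set" where
  "hardy_disc = {F. \<exists>a :: nat \<Rightarrow> 'e. summable (\<lambda>n. (norm (a n))\<^sup>2) \<and>
    (\<forall>w\<in>ball 0 1. (\<lambda>n. w ^ n *\<^sub>C a n) sums F w)}"

definition dilate :: "(complex \<Rightarrow> 'e) \<Rightarrow> real \<Rightarrow> 'e::{complex_inner, second_countable_topology} L2" where
  "dilate F r = abs_L2 (\<lambda>z. F (of_real r * z))"

text \<open>
  Boundary values are limits in \<open>L\<^sup>2\<close> of the dilates \<open>z \<mapsto> F (r z)\<close> as \<open>r\<close> increases to 1; they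
  identify the Hardy space of the disc with a closed subspace of \<open>L\<^sup>2\<close>. Under this identification
  the shift is multiplication by \<open>z\<close> on the circle.
\<close>

definition boundary_value ::
    "(complex \<Rightarrow> 'e) \<Rightarrow> 'e::{complex_inner, second_countable_topology} L2 \<Rightarrow> bool" where
  "boundary_value F f \<longleftrightarrow> (dilate F \<longlongrightarrow> f) (at_left 1)"

definition hardy_space :: "'e::{complex_inner, second_countable_topology} L2 set" where
  "hardy_space = {f. \<exists>F\<in>hardy_disc. boundary_value F f}"

lemma hardy_disc_zero: "(\<lambda>_. 0) \<in> hardy_disc"
proof -
  have "a *\<^sub>C (0::'a) = 0" for a
    using scaleC_add_right[of a "0::'a" 0] by simp
  then show ?thesis
    unfolding hardy_disc_def by (auto intro!: exI[of _ "\<lambda>_. 0"])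
qed

lemma hardy_disc_add:
  assumes "F \<in> hardy_disc" "G \<in> hardy_disc"
  shows "(\<lambda>w. F w + G w) \<in> hardy_disc"
proof -
  obtain a b where a: "summable (\<lambda>n. (norm (a n))\<^sup>2)" "\<forall>w\<in>ball 0 1. (\<lambda>n. w ^ n *\<^sub>C a n) sums F w"
    and b: "summable (\<lambda>n. (norm (b n))\<^sup>2)" "\<forall>w\<in>ball 0 1. (\<lambda>n. w ^ n *\<^sub>C b n) sums G w"
    using assms by (auto simp: hardy_disc_def)
  have bound: "(norm (x + y))\<^sup>2 \<le> 2 * (norm x)\<^sup>2 + 2 * (norm y)\<^sup>2" for x y :: 'a
  proof -
    have "(norm (x + y))\<^sup>2 \<le> (norm x + norm y)\<^sup>2"
      by (intro power_mono norm_triangle_ineq) auto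
    also have "\<dots> \<le> 2 * (norm x)\<^sup>2 + 2 * (norm y)\<^sup>2"
      using sum_squares_bound[of "norm x" "norm y"] by (simp add: power2_sum)
    finally show ?thesis .
  qed
  have "summable (\<lambda>n. 2 * (norm (a n))\<^sup>2 + 2 * (norm (b n))\<^sup>2)"
    using a b by (intro summable_add summable_mult)
  then have "summable (\<lambda>n. (norm (a n + b n))\<^sup>2)"
    by (rule summable_comparison_test'[where N = 0]) (use bound in auto)
  then show ?thesis
    using a b unfolding hardy_disc_def
    by (auto intro!: exI[of _ "\<lambda>n. a n + b n"] sums_add simp: scaleC_add_right)
qed

lemma hardy_disc_scaleC:
  assumes "F \<in> hardy_disc"
  shows "(\<lambda>w. c *\<^sub>C F w) \<in> hardy_disc"
proof -
  obtain a where a: "summable (\<lambda>n. (norm (a n))\<^sup>2)" "\<forall>w\<in>ball 0 1. (\<lambda>n. w ^ n *\<^sub>C a n) sums F w"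
    using assms by (auto simp: hardy_disc_def)
  have "(\<lambda>n. w ^ n *\<^sub>C c *\<^sub>C a n) sums (c *\<^sub>C F w)" if "w \<in> ball 0 1" for w
    using bounded_linear.sums[OF bounded_bilinear.bounded_linear_right[OF bounded_bilinear_scaleC], of _ _ c]
      a(2) that by (fastforce simp: scaleC_scaleC mult.commute)
  moreover have "summable (\<lambda>n. (norm (c *\<^sub>C a n))\<^sup>2)"
    using a(1) by (auto simp: norm_scaleC power_mult_distrib intro: summable_mult)
  ultimately show ?thesis
    unfolding hardy_disc_def by (auto intro!: exI[of _ "\<lambda>n. c *\<^sub>C a n"])
qed

lemma hardy_disc_dilate:
  fixes F :: "complex \<Rightarrow> 'e::{complex_inner, second_countable_topology}"
  assumes "F \<in> hardy_disc" "0 \<le> r" "r < 1"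
  shows "(\<lambda>z. F (of_real r * z)) \<in> l2_fun"
proof -
  obtain a where a: "summable (\<lambda>n. (norm (a n))\<^sup>2)" "\<forall>w\<in>ball 0 1. (\<lambda>n. w ^ n *\<^sub>C a n) sums F w"
    using assms by (auto simp: hardy_disc_def)
  have "(\<lambda>n. norm (a n)) \<longlonglongrightarrow> 0"
    using tendsto_real_sqrt[OF summable_LIMSEQ_zero[OF a(1)]] by simp
  then have "Bseq (\<lambda>n. norm (a n))"
    by (intro convergent_imp_Bseq convergentI)
  then obtain C where C: "\<And>n. norm (a n) \<le> C"
    by (auto simp: Bseq_def)
  have "0 \<le> C"
    using C[of 0] norm_ge_zero order_trans by blast
  have sums: "(\<lambda>n. (of_real r * z) ^ n *\<^sub>C a n) sums F (of_real r * z)" if "z \<in> space circle" for z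
    using a(2) that assms by (auto simp: norm_mult)
  have meas: "(\<lambda>z. F (of_real r * z)) \<in> borel_measurable circle"
  proof (rule borel_measurable_LIMSEQ_metric)
    have "(\<lambda>z. z) \<in> borel_measurable circle"
      by (simp add: measurable_restrict_space1 cong: measurable_cong_sets[OF sets_circle refl])
    then show "(\<lambda>z. \<Sum>n<k. (of_real r * z) ^ n *\<^sub>C a n) \<in> borel_measurable circle" for k
      by measurable
    show "(\<lambda>k. \<Sum>n<k. (of_real r * z) ^ n *\<^sub>C a n) \<longlonglongrightarrow> F (of_real r * z)" if "z \<in> space circle" for z
      using sums[OF that] by (simp add: sums_def)
  qed
  have "norm (F (of_real r * z)) \<le> C / (1 - r)" if z: "z \<in> space circle" for z
  proof (rule Lim_bounded[where M = 0])
    show "(\<lambda>k. norm (\<Sum>n<k. (of_real r * z) ^ n *\<^sub>C a n)) \<longlonglongrightarrow> norm (F (of_real r * z))"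
      using sums[OF that] by (intro tendsto_norm) (simp add: sums_def)
    show "\<forall>k\<ge>0. norm (\<Sum>n<k. (of_real r * z) ^ n *\<^sub>C a n) \<le> C / (1 - r)"
    proof (intro allI impI)
      fix k
      have "norm (\<Sum>n<k. (of_real r * z) ^ n *\<^sub>C a n) \<le> (\<Sum>n<k. r ^ n * C)"
        using z assms C by (intro sum_norm_le) (auto simp: norm_scaleC norm_mult norm_power intro!: mult_left_mono)
      also have "\<dots> \<le> (\<Sum>n. r ^ n * C)"
        using assms \<open>0 \<le> C\<close> by (intro sum_le_suminf summable_mult2 summable_geometric) auto
      also have "\<dots> = C / (1 - r)"
        using assms by (subst suminf_mult2[symmetric]) (auto simp: suminf_geometric summable_geometric)
      finally show "norm (\<Sum>n<k. (of_real r * z) ^ n *\<^sub>C a n) \<le> C / (1 - r)" .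
    qed
  qed
  then have "integrable circle (\<lambda>z. (norm (F (of_real r * z)))\<^sup>2)"
    using meas by (intro circle.integrable_const_bound[where B = "(C / (1 - r))\<^sup>2"])
      (auto intro!: AE_I2 power_mono)
  then show ?thesis
    using meas by (simp add: l2_fun_def)
qed

lemma eventually_at_left_1: "\<forall>\<^sub>F r in at_left (1::real). 0 \<le> r \<and> r < 1"
  unfolding eventually_at_left_field by (intro exI[of _ 0]) auto

lemma hardy_space_zero: "0 \<in> hardy_space"
proof -
  have "dilate (\<lambda>_. 0) = (\<lambda>_. 0 :: 'a L2)"
    by (simp add: dilate_def zero_L2_def fun_eq_iff)
  then show ?thesis
    unfolding hardy_space_def boundary_value_def using hardy_disc_zero by (auto intro!: bexI[of _ "\<lambda>_. 0"])
qed

lemma hardy_space_add: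
  assumes "f \<in> hardy_space" "g \<in> hardy_space"
  shows "f + g \<in> hardy_space"
proof -
  obtain F G where F: "F \<in> hardy_disc" "(dilate F \<longlongrightarrow> f) (at_left 1)"
    and G: "G \<in> hardy_disc" "(dilate G \<longlongrightarrow> g) (at_left 1)"
    using assms by (auto simp: hardy_space_def boundary_value_def)
  have "\<forall>\<^sub>F r in at_left 1. dilate F r + dilate G r = dilate (\<lambda>w. F w + G w) r"
    using eventually_at_left_1
  proof eventually_elim
    case (elim r)
    then have "l2_eq (\<lambda>z. F (of_real r * z)) (\<lambda>z. F (of_real r * z))"
      "l2_eq (\<lambda>z. G (of_real r * z)) (\<lambda>z. G (of_real r * z))"
      using F G by (auto simp: l2_eq_def hardy_disc_dilate)
    then show ?case
      unfolding dilate_def by (rule plus_L2.abs_eq)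
  qed
  then have "(dilate (\<lambda>w. F w + G w) \<longlongrightarrow> f + g) (at_left 1)"
    using tendsto_add[OF F(2) G(2)] by (simp cong: tendsto_cong)
  then show ?thesis
    using hardy_disc_add[OF F(1) G(1)] by (auto simp: hardy_space_def boundary_value_def)
qed

lemma hardy_space_scaleC:
  assumes "f \<in> hardy_space"
  shows "c *\<^sub>C f \<in> hardy_space"
proof -
  obtain F where F: "F \<in> hardy_disc" "(dilate F \<longlongrightarrow> f) (at_left 1)"
    using assms by (auto simp: hardy_space_def boundary_value_def)
  have "\<forall>\<^sub>F r in at_left 1. c *\<^sub>C dilate F r = dilate (\<lambda>w. c *\<^sub>C F w) r"
    using eventually_at_left_1
  proof eventually_elim
    case (elim r)
    then have "l2_eq (\<lambda>z. F (of_real r * z)) (\<lambda>z. F (of_real r * z))"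
      using F by (auto simp: l2_eq_def hardy_disc_dilate)
    then show ?case
      unfolding dilate_def by (rule scaleC_L2.abs_eq)
  qed
  moreover have "((\<lambda>r. c *\<^sub>C dilate F r) \<longlongrightarrow> c *\<^sub>C f) (at_left 1)"
    by (intro bounded_bilinear.tendsto[OF bounded_bilinear_scaleC] tendsto_const F)
  ultimately have "(dilate (\<lambda>w. c *\<^sub>C F w) \<longlongrightarrow> c *\<^sub>C f) (at_left 1)"
    by (simp cong: tendsto_cong)
  then show ?thesis
    using hardy_disc_scaleC[OF F(1)] by (auto simp: hardy_space_def boundary_value_def)
qed

lemma hardy_space_scaleR: "f \<in> hardy_space \<Longrightarrow> r *\<^sub>R f \<in> hardy_space"
  by (metis hardy_space_scaleC scaleC_of_real)

lemma hardy_space_uminus: "f \<in> hardy_space \<Longrightarrow> - f \<in> hardy_space"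
  using hardy_space_scaleR[of f "-1"] by simp

lemma hardy_space_diff: "f \<in> hardy_space \<Longrightarrow> g \<in> hardy_space \<Longrightarrow> f - g \<in> hardy_space"
  using hardy_space_add[OF _ hardy_space_uminus[of g], of f] by simp

typedef (overloaded) 'e H2 = "hardy_space :: 'e::{complex_inner, second_countable_topology} L2 set"
  using hardy_space_zero by blast

setup_lifting type_definition_H2

instantiation H2 :: ("{complex_inner, second_countable_topology}") complex_inner
begin

lift_definition zero_H2 :: "'a H2" is 0 by (rule hardy_space_zero)
lift_definition plus_H2 :: "'a H2 \<Rightarrow> 'a H2 \<Rightarrow> 'a H2" is "(+)" by (rule hardy_space_add)
lift_definition uminus_H2 :: "'a H2 \<Rightarrow> 'a H2" is uminus by (rule hardy_space_uminus)
lift_definition minus_H2 :: "'a H2 \<Rightarrow> 'a H2 \<Rightarrow> 'a H2" is "(-)" by (rule hardy_space_diff)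
lift_definition scaleR_H2 :: "real \<Rightarrow> 'a H2 \<Rightarrow> 'a H2" is scaleR by (rule hardy_space_scaleR)
lift_definition scaleC_H2 :: "complex \<Rightarrow> 'a H2 \<Rightarrow> 'a H2" is scaleC by (rule hardy_space_scaleC)
lift_definition cinner_H2 :: "'a H2 \<Rightarrow> 'a H2 \<Rightarrow> complex" is cinner .
lift_definition inner_H2 :: "'a H2 \<Rightarrow> 'a H2 \<Rightarrow> real" is inner .
lift_definition norm_H2 :: "'a H2 \<Rightarrow> real" is norm .
lift_definition dist_H2 :: "'a H2 \<Rightarrow> 'a H2 \<Rightarrow> real" is dist .
definition sgn_H2_def: "sgn (f::'a H2) = scaleR (inverse (norm f)) f"
definition uniformity_H2_def:
  "(uniformity :: ('a H2 \<times> 'a H2) filter) = (INF e\<in>{0<..}. principal {(x, y). dist x y < e})"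
definition open_H2_def:
  "open (U :: 'a H2 set) \<longleftrightarrow> (\<forall>x\<in>U. eventually (\<lambda>(x', y). x' = x \<longrightarrow> y \<in> U) uniformity)"

instance
proof
  fix x y z :: "'a H2" and a b :: real and c d :: complex
  show "x + y + z = x + (y + z)" by transfer (rule add.assoc)
  show "x + y = y + x" by transfer (rule add.commute)
  show "0 + x = x" by transfer simp
  show "- x + x = 0" by transfer simp
  show "x - y = x + - y" by transfer simp
  show "a *\<^sub>R (x + y) = a *\<^sub>R x + a *\<^sub>R y" by transfer (rule scaleR_add_right)
  show "(a + b) *\<^sub>R x = a *\<^sub>R x + b *\<^sub>R x" by transfer (rule scaleR_add_left)
  show "a *\<^sub>R b *\<^sub>R x = (a * b) *\<^sub>R x" by transfer simp
  show "1 *\<^sub>R x = x" by transfer simp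
  show "sgn x = scaleR (inverse (norm x)) x" by (rule sgn_H2_def)
  show "dist x y = norm (x - y)" by transfer (rule dist_norm)
  show "uniformity = (INF e\<in>{0<..}. principal {(x :: 'a H2, y). dist x y < e})"
    by (rule uniformity_H2_def)
  show "open U \<longleftrightarrow> (\<forall>x\<in>U. eventually (\<lambda>(x', y). x' = x \<longrightarrow> y \<in> U) uniformity)" for U :: "'a H2 set"
    by (rule open_H2_def)
  show "inner x y = inner y x" by transfer (rule inner_commute)
  show "inner (x + y) z = inner x z + inner y z" by transfer (rule inner_add_left)
  show "inner (a *\<^sub>R x) y = a * inner x y" by transfer simp
  show "0 \<le> inner x x" by transfer simp
  show "inner x x = 0 \<longleftrightarrow> x = 0" by transfer simp
  show "norm x = sqrt (inner x x)" by transfer (rule norm_eq_sqrt_inner)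
  show "c *\<^sub>C (x + y) = c *\<^sub>C x + c *\<^sub>C y" by transfer (rule scaleC_add_right)
  show "(c + d) *\<^sub>C x = c *\<^sub>C x + d *\<^sub>C x" by transfer (rule scaleC_add_left)
  show "c *\<^sub>C d *\<^sub>C x = (c * d) *\<^sub>C x" by transfer (rule scaleC_scaleC)
  show "complex_of_real a *\<^sub>C x = a *\<^sub>R x" by transfer (rule scaleC_of_real)
  show "cinner x y = cnj (cinner y x)" by transfer (rule cinner_commute)
  show "cinner (x + y) z = cinner x z + cinner y z" by transfer (rule cinner_add_left)
  show "cinner (c *\<^sub>C x) y = c * cinner x y" by transfer (rule cinner_scaleC_left)
  show "inner x y = Re (cinner x y)" by transfer (rule inner_eq_Re_cinner)
qed

end


section \<open>Operator-valued symbols, shift and Hankel operators\<close>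

text \<open>
  Elements of \<open>L\<^sup>\<infinity>\<close> are represented by functions; equality almost everywhere is made explicit
  wherever two symbols are compared, so within \<open>Linf\<close> the classes below are closed under it. Values off the circle are irrelevant.
\<close>

definition Linf :: "(complex \<Rightarrow> 'e::chilbert_space \<Rightarrow> 'e) set" where
  "Linf = {\<Phi>. (\<forall>z\<in>sphere 0 1. bounded_clinear (\<Phi> z)) \<and>
    (\<forall>x y. (\<lambda>z. cinner (\<Phi> z x) y) \<in> borel_measurable circle) \<and>
    (\<exists>C. AE z in circle. onorm (\<Phi> z) \<le> C)}"

text \<open>
  \<open>fourier_coeff \<Phi> n x\<close> is the \<open>n\<close>-th Fourier coefficient of \<open>\<Phi>\<close>, an operator, applied to \<open>x\<close>. The
  Bochner integral exists because \<open>z \<mapsto> \<Phi> z x\<close> is weakly measurable into a separable space.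
\<close>

definition fourier_coeff ::
    "(complex \<Rightarrow> 'e \<Rightarrow> 'e) \<Rightarrow> int \<Rightarrow> 'e \<Rightarrow> 'e::{chilbert_space, second_countable_topology}" where
  "fourier_coeff \<Phi> n x = (LINT z|circle. (z powi (- n)) *\<^sub>C \<Phi> z x)"

definition zHinf_conj :: "(complex \<Rightarrow> 'e::{chilbert_space, second_countable_topology} \<Rightarrow> 'e) set" where
  "zHinf_conj = {\<Phi> \<in> Linf. \<forall>n\<ge>0. \<forall>x. fourier_coeff \<Phi> n x = 0}"

definition zdiff_Linf :: "(complex \<Rightarrow> 'e::chilbert_space \<Rightarrow> 'e) set" where
  "zdiff_Linf = {\<Phi> \<in> Linf. \<exists>\<Theta>\<in>Linf. AE z in circle. \<forall>x. \<Phi> z x = (z - cnj z) *\<^sub>C \<Theta> z x}"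

definition symbol_sum ::
    "(complex \<Rightarrow> 'e::chilbert_space \<Rightarrow> 'e) set \<Rightarrow> (complex \<Rightarrow> 'e \<Rightarrow> 'e) set \<Rightarrow> (complex \<Rightarrow> 'e \<Rightarrow> 'e) set" where
  "symbol_sum A B = {\<Phi> \<in> Linf. \<exists>\<Psi>\<in>A. \<exists>\<Omega>\<in>B. AE z in circle. \<forall>x. \<Phi> z x = \<Psi> z x + \<Omega> z x}"

definition symbol_tilde_adj :: "(complex \<Rightarrow> 'e::chilbert_space \<Rightarrow> 'e) \<Rightarrow> complex \<Rightarrow> 'e \<Rightarrow> 'e" where
  "symbol_tilde_adj \<Phi> z = cadjoint (\<Phi> (cnj z))"

definition mult_op ::
    "(complex \<Rightarrow> 'e \<Rightarrow> 'e) \<Rightarrow> 'e L2 \<Rightarrow> 'e::{chilbert_space, second_countable_topology} L2" where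
  "mult_op \<Phi> f = abs_L2 (\<lambda>z. \<Phi> z (rep_L2 f z))"

definition flip :: "'e L2 \<Rightarrow> 'e::{chilbert_space, second_countable_topology} L2" where
  "flip f = abs_L2 (\<lambda>z. rep_L2 f (cnj z))"

definition shift :: "'e H2 \<Rightarrow> 'e::{chilbert_space, second_countable_topology} H2" where
  "shift f = Abs_H2 (mult_op (\<lambda>z x. z *\<^sub>C x) (Rep_H2 f))"

definition hankel ::
    "(complex \<Rightarrow> 'e \<Rightarrow> 'e) \<Rightarrow> 'e H2 \<Rightarrow> 'e::{chilbert_space, second_countable_topology} H2" where
  "hankel \<Phi> f = Abs_H2 (orth_proj hardy_space (mult_op \<Phi> (flip (Rep_H2 f))))"

end

(*
A similarity to a contraction bounds the powers of the block operator T, and in both cases an entry of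
T^n yields the partial sums of G = H + S*^2 H + S*^4 H + ..., where H is the Hankel operator and S the
shift. They converge weakly because range (1 - S^2) is dense; G is again a Hankel operator, and
G - S*^2 G = H. A bounded Hankel operator has a bounded symbol Theta (Nehari, Page), and H = G - S*^2 G
says that Phi and (1 - cnj z ^ 2) Theta = (z - cnj z) cnj z Theta have the same Fourier coefficients of
index >= 0. Conversely, if Phi = (z - cnj z) Theta + Omega, an explicit sum Z of a Hankel and a Toeplitz
operator solves the commutator equation that makes T similar to the direct sum of two copies of S or S*.

The bounded symbol is obtained without dilation theory: off-diagonal blocks of the powers of a contraction
extend the coefficients of G to negative indices, a telescoping sum bounds the Fejer means, and these
converge almost everywhere along a subsequence.
*)

theory Submission
  imports Defs
begin

section \<open>Hilbert spaces\<close>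

text \<open>Similarity to a contraction enters only as power boundedness, and the cancellation
  happens on the left of the off-diagonal entry for \<open>shift\<close> and on the right for its
  adjoint. Both leave the same sum of odd powers, so the two similarity problems share one
  criterion. The adjoint form of the criterion is settled on symbols alone: passing to
  \<open>symbol_tilde_adj\<close> keeps the index of each Fourier coefficient and fixes the factor
  \<open>z - cnj z\<close>. The obstacle is that a bounded solution \<open>G\<close> is only an
  operator; it prescribes no coefficients of negative index. Scaling its norm to at most 1/2 makes
  the sesquilinear form built from it positive and turns the projection onto the domain of the
  partial isometry into a fixed point problem on the given space, without completions or quotients.
  Fejer weights are forced by the telescoping sum and serve twice: the means are bounded at every
  point of the circle, and the weights increase with \<open>N\<close>, so the means are Cauchy in
  L2. Separability of the coefficient space lets one subsequence serve all vectors.\<close>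

lemmas scaleC_zero_left [simp] = bounded_bilinear.zero_left[OF bounded_bilinear_scaleC]
lemmas scaleC_zero_right [simp] = bounded_bilinear.zero_right[OF bounded_bilinear_scaleC]
lemmas scaleC_diff_left = bounded_bilinear.diff_left[OF bounded_bilinear_scaleC]
lemmas scaleC_diff_right = bounded_bilinear.diff_right[OF bounded_bilinear_scaleC]
lemmas scaleC_sum_right = bounded_bilinear.sum_right[OF bounded_bilinear_scaleC]
lemmas tendsto_scaleC = bounded_bilinear.tendsto[OF bounded_bilinear_scaleC]
lemmas cinner_zero_left [simp] = bounded_bilinear.zero_left[OF bounded_bilinear_cinner]
lemmas cinner_zero_right [simp] = bounded_bilinear.zero_right[OF bounded_bilinear_cinner]
lemmas cinner_minus_left [simp] = bounded_bilinear.minus_left[OF bounded_bilinear_cinner]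
lemmas cinner_minus_right [simp] = bounded_bilinear.minus_right[OF bounded_bilinear_cinner]
lemmas cinner_diff_left = bounded_bilinear.diff_left[OF bounded_bilinear_cinner]
lemmas cinner_diff_right = bounded_bilinear.diff_right[OF bounded_bilinear_cinner]
lemmas cinner_sum_left = bounded_bilinear.sum_left[OF bounded_bilinear_cinner]
lemmas cinner_sum_right = bounded_bilinear.sum_right[OF bounded_bilinear_cinner]
lemmas tendsto_cinner = bounded_bilinear.tendsto[OF bounded_bilinear_cinner]

lemma scaleC_one [simp]: "1 *\<^sub>C x = (x::'a::complex_inner)"
  using scaleC_of_real[of 1 x] by simp

lemma cinner_eqI:
  assumes "\<And>z. cinner x z = cinner y (z::'a::complex_inner)"
  shows "x = y"
proof -
  have "cinner (x - y) (x - y) = 0"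
    using assms by (simp add: cinner_diff_left)
  then show ?thesis
    by (simp add: cinner_self)
qed

lemma cinner_self_eq_0_iff [simp]: "cinner x x = 0 \<longleftrightarrow> x = (0::'a::complex_inner)"
  by (simp add: cinner_self)

lemma Re_cinner_self [simp]: "Re (cinner x x) = (norm (x::'a::complex_inner))\<^sup>2"
  by (simp add: cinner_self)

lemma norm_le_if_cinner_le:
  fixes x :: "'a::complex_inner"
  assumes "\<And>y. cmod (cinner x y) \<le> K * norm y" "0 \<le> K"
  shows "norm x \<le> K"
proof (cases "x = 0")
  case False
  have "cmod (cinner x x) = norm x * norm x"
    by (simp add: cinner_self power2_eq_square norm_mult)
  then show ?thesis
    using assms(1)[of x] False by simp
qed (use assms in simp)

section \<open>Bounded complex linear operators\<close>

lemma bounded_clinearI: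
  assumes "\<And>x y. T (x + y) = T x + T y" "\<And>a x. T (a *\<^sub>C x) = a *\<^sub>C T x"
    "\<And>x. norm (T x) \<le> K * norm x"
  shows "bounded_clinear T"
  unfolding bounded_clinear_def
proof (intro conjI bounded_linear_intro[where K = K])
  show "T (r *\<^sub>R x) = r *\<^sub>R T x" for r x
    using assms(2)[of "of_real r" x] by (simp add: scaleC_of_real)
qed (use assms in \<open>auto simp: mult.commute\<close>)

lemma
  assumes "bounded_clinear T"
  shows bounded_clinear_add: "T (x + y) = T x + T y"
    and bounded_clinear_diff: "T (x - y) = T x - T y"
    and bounded_clinear_zero: "T 0 = 0"
    and bounded_clinear_scaleC: "T (a *\<^sub>C x) = a *\<^sub>C T x"
    and bounded_clinear_sum: "T (sum f A) = (\<Sum>i\<in>A. T (f i))"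
    and bounded_clinear_norm_le: "norm (T x) \<le> onorm T * norm x"
    and bounded_clinear_tendsto: "(g \<longlongrightarrow> l) F \<Longrightarrow> ((\<lambda>i. T (g i)) \<longlongrightarrow> T l) F"
proof -
  have b: "bounded_linear T" using assms by (simp add: bounded_clinear_def)
  show "T (x + y) = T x + T y" "T (x - y) = T x - T y" "T 0 = 0"
    "T (sum f A) = (\<Sum>i\<in>A. T (f i))"
    "norm (T x) \<le> onorm T * norm x" "(g \<longlongrightarrow> l) F \<Longrightarrow> ((\<lambda>i. T (g i)) \<longlongrightarrow> T l) F"
    using b by (simp_all add: linear_simps linear_sum bounded_linear.linear onorm
        bounded_linear.tendsto)
  show "T (a *\<^sub>C x) = a *\<^sub>C T x"
    using assms by (simp add: bounded_clinear_def)
qed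

lemma bounded_clinear_compose:
  assumes "bounded_clinear T" "bounded_clinear R"
  shows "bounded_clinear (\<lambda>x. T (R x))"
  using assms bounded_linear_compose[of T R] by (auto simp: bounded_clinear_def)

lemma bounded_clinear_id: "bounded_clinear (\<lambda>x. x)"
  by (simp add: bounded_clinear_def)

lemma bounded_clinear_const_zero: "bounded_clinear (\<lambda>x. 0)"
  by (simp add: bounded_clinear_def)

lemma bounded_clinear_plus:
  assumes "bounded_clinear T" "bounded_clinear R"
  shows "bounded_clinear (\<lambda>x. T x + R x)"
  using assms bounded_linear_add[of T R] by (auto simp: bounded_clinear_def scaleC_add_right)

lemma bounded_clinear_sub:
  assumes "bounded_clinear T" "bounded_clinear R"
  shows "bounded_clinear (\<lambda>x. T x - R x)"
  using assms bounded_linear_sub[of T R] by (auto simp: bounded_clinear_def scaleC_diff_right)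

lemma bounded_clinear_scaleC_left:
  assumes "bounded_clinear T"
  shows "bounded_clinear (\<lambda>x. a *\<^sub>C T x)"
proof (rule bounded_clinearI)
  show "norm (a *\<^sub>C T x) \<le> (cmod a * onorm T) * norm x" for x
    using bounded_clinear_norm_le[OF assms, of x]
    by (simp add: norm_scaleC mult.assoc mult_left_mono)
qed (simp_all add: bounded_clinear_add[OF assms] bounded_clinear_scaleC[OF assms] scaleC_add_right
    scaleC_scaleC mult.commute)

lemma bounded_clinear_setsum:
  assumes "\<And>i. i \<in> I \<Longrightarrow> bounded_clinear (T i)"
  shows "bounded_clinear (\<lambda>x. \<Sum>i\<in>I. T i x)"
  using assms
  by (induction I rule: infinite_finite_induct)
    (auto intro: bounded_clinear_const_zero bounded_clinear_plus)

lemma bounded_clinear_funpow: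
  fixes T :: "'h::complex_inner \<Rightarrow> 'h"
  assumes "bounded_clinear T"
  shows "bounded_clinear (T ^^ n)"
proof (induction n)
  case 0
  then show ?case by (simp add: bounded_clinear_def bounded_linear_ident id_def)
next
  case (Suc n)
  then show ?case using bounded_clinear_compose[OF assms Suc] by (simp add: comp_def)
qed

lemma bounded_clinear_fst: "bounded_clinear fst"
  by (simp add: bounded_clinear_def bounded_linear_fst scaleC_prod_def)

lemma bounded_clinear_snd: "bounded_clinear snd"
  by (simp add: bounded_clinear_def bounded_linear_snd scaleC_prod_def)

lemma bounded_clinear_Pair:
  assumes "bounded_clinear T" "bounded_clinear R"
  shows "bounded_clinear (\<lambda>x. (T x, R x))"
  using assms bounded_linear_Pair[of T R] by (simp add: bounded_clinear_def scaleC_prod_def)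

text \<open>First-order condition at the minimum \<open>t = 0\<close>: for small \<open>t\<close> of
  sign opposite to \<open>b\<close> the linear term would win. This is the variational step of the
  Riesz representation below.\<close>

lemma real_quadratic_nonneg_imp_zero:
  fixes a b :: real
  assumes "\<And>t. 0 \<le> t\<^sup>2 * a + 2 * t * b"
  shows "b = 0"
proof -
  have "0 \<le> a"
    using assms[of 1] assms[of "-1"] by simp
  \<comment> \<open>The summand 1 keeps the denominator positive when \<open>a = 0\<close>. For this
    \<open>t\<close> the quadratic equals \<open>- t^2 * (a + 2)\<close>.\<close>
  define t where "t = - b / (a + 1)"
  have "b = - t * (a + 1)"
    using \<open>0 \<le> a\<close> by (simp add: t_def)
  then have "t\<^sup>2 * (a + 2) \<le> 0"
    using assms[of t] by (simp only: power2_eq_square) (simp add: algebra_simps)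
  then have "t = 0"
    using \<open>0 \<le> a\<close> by (simp add: mult_le_0_iff)
  with \<open>b = - t * (a + 1)\<close> show ?thesis by simp
qed

text \<open>The representing vector minimises \<open>\<parallel>x\<parallel>\<^sup>2 - 2 Re (f x)\<close> over \<open>M\<close>; by the parallelogram law
  minimising sequences are Cauchy.\<close>

lemma riesz_closed_subspace:
  fixes M :: "'h::chilbert_space set"
  assumes M: "closed M" "0 \<in> M" "\<And>x y. x \<in> M \<Longrightarrow> y \<in> M \<Longrightarrow> x + y \<in> M"
      "\<And>a x. x \<in> M \<Longrightarrow> a *\<^sub>C x \<in> M"
    and f: "\<And>x y. f (x + y) = f x + f y" "\<And>a x. f (a *\<^sub>C x) = a * f x" "\<And>x. cmod (f x) \<le> K * norm x"
  shows "\<exists>y\<in>M. \<forall>h\<in>M. f h = cinner h y"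
proof -
  have scaleR: "r *\<^sub>R x \<in> M" if "x \<in> M" for r x
    using M(4)[OF that, of "of_real r"] by (simp add: scaleC_of_real)
  have fR: "f (r *\<^sub>R x) = of_real r * f x" for r x
    using f(2)[of "of_real r" x] by (simp add: scaleC_of_real)
  define Q where "Q x = (norm x)\<^sup>2 - 2 * Re (f x)" for x
  have lower: "- K\<^sup>2 \<le> Q x" for x
  proof -
    have "Re (f x) \<le> K * norm x"
      using complex_Re_le_cmod[of "f x"] f(3)[of x] by linarith
    moreover have "0 \<le> (norm x - K)\<^sup>2" by simp
    ultimately show ?thesis
      by (simp add: Q_def power2_diff algebra_simps)
  qed
  define m where "m = (INF x\<in>M. Q x)"
  have bdd: "bdd_below (Q ` M)"
    using lower by (intro bdd_belowI2)
  have m_le: "m \<le> Q x" if "x \<in> M" for x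
    unfolding m_def by (rule cINF_lower[OF bdd that])
  have "\<exists>x\<in>M. Q x < m + inverse (real (Suc n))" for n
  proof -
    have "m < m + inverse (real (Suc n))" by simp
    then show ?thesis
      unfolding m_def using bdd M(2) by (subst (asm) cINF_less_iff) auto
  qed
  then obtain X where X: "\<And>n. X n \<in> M" "\<And>n. Q (X n) < m + inverse (real (Suc n))"
    by metis
  have para: "(norm (x - y))\<^sup>2 \<le> 2 * (Q x - m) + 2 * (Q y - m)" if "x \<in> M" "y \<in> M" for x y
  proof -
    have "m \<le> Q ((1/2) *\<^sub>R (x + y))"
      using that by (intro m_le scaleR M)
    moreover have "Q ((1/2) *\<^sub>R (x + y)) = (norm (x + y))\<^sup>2 / 4 - Re (f x) - Re (f y)"
      by (simp add: Q_def fR f(1) power_divide add_divide_distrib del: scaleR_add_right)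
    moreover have "(norm (x + y))\<^sup>2 + (norm (x - y))\<^sup>2 = 2 * (norm x)\<^sup>2 + 2 * (norm y)\<^sup>2"
      by (simp only: power2_norm_eq_inner inner_add_left inner_add_right inner_diff_left
          inner_diff_right)
    ultimately show ?thesis
      by (simp add: Q_def)
  qed
  have "Cauchy X"
  proof (rule metric_CauchyI)
    fix e :: real assume "0 < e"
    then obtain N where N: "inverse (real (Suc N)) < e\<^sup>2 / 4"
      using reals_Archimedean[of "e\<^sup>2 / 4"] by auto
    show "\<exists>N. \<forall>i\<ge>N. \<forall>j\<ge>N. dist (X i) (X j) < e"
    proof (intro exI allI impI)
      fix i j assume "N \<le> i" "N \<le> j"
      then have "inverse (real (Suc i)) \<le> inverse (real (Suc N))"
        "inverse (real (Suc j)) \<le> inverse (real (Suc N))"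
        by (auto intro!: le_imp_inverse_le)
      then have "Q (X i) < m + e\<^sup>2 / 4" "Q (X j) < m + e\<^sup>2 / 4"
        using X(2)[of i] X(2)[of j] N by linarith+
      then have "(norm (X i - X j))\<^sup>2 < e\<^sup>2"
        using para[OF X(1)[of i] X(1)[of j]] by (simp add: field_simps)
      then show "dist (X i) (X j) < e"
        unfolding dist_norm by (rule power2_less_imp_less) (use \<open>0 < e\<close> in simp)
    qed
  qed
  then obtain y where y: "X \<longlonglongrightarrow> y"
    using Cauchy_convergent convergent_def by blast
  have "y \<in> M"
    using closed_sequentially[OF M(1)] X(1) y by blast
  have "bounded_linear f"
    by (rule bounded_linear_intro[where K = K])
      (use f fR in \<open>auto simp: mult.commute scaleR_conv_of_real\<close>)
  then have "(\<lambda>n. Q (X n)) \<longlonglongrightarrow> Q y"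
    unfolding Q_def using y by (intro tendsto_intros bounded_linear.tendsto[of f])
  moreover have "(\<lambda>n. m + inverse (real (Suc n))) \<longlonglongrightarrow> m + 0"
    by (intro tendsto_intros LIMSEQ_inverse_real_of_nat)
  ultimately have "Q y \<le> m + 0"
    by (rule LIMSEQ_le) (use X(2) less_imp_le in blast)
  have Re: "Re (f h) = inner h y" if "h \<in> M" for h
  proof -
    have "0 \<le> t\<^sup>2 * (norm h)\<^sup>2 + 2 * t * (inner h y - Re (f h))" for t
    proof -
      have "m \<le> Q (y + t *\<^sub>R h)"
        by (intro m_le M(3) scaleR \<open>y \<in> M\<close> that)
      then have "Q y \<le> Q (y + t *\<^sub>R h)"
        using \<open>Q y \<le> m + 0\<close> by simp
      moreover have "(norm (y + t *\<^sub>R h))\<^sup>2 = (norm y)\<^sup>2 + 2 * t * inner h y + t\<^sup>2 * (norm h)\<^sup>2"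
        by (simp only: power2_norm_eq_inner inner_add_left inner_add_right inner_scaleR_left
            inner_scaleR_right inner_commute[of y h] power2_eq_square[of t])
          (simp only: algebra_simps mult_2)
      ultimately show ?thesis
        by (simp add: Q_def f(1) fR algebra_simps)
    qed
    then show ?thesis
      using real_quadratic_nonneg_imp_zero[of "(norm h)\<^sup>2" "inner h y - Re (f h)"] by simp
  qed
  have "f h = cinner h y" if "h \<in> M" for h
  proof (rule complex_eqI)
    show "Re (f h) = Re (cinner h y)"
      using Re[OF that] by (simp add: inner_eq_Re_cinner)
    \<comment> \<open>The imaginary part is the real identity at the imaginary unit times
      \<open>h\<close>, which again lies in \<open>M\<close>.\<close>
    show "Im (f h) = Im (cinner h y)"
      using Re[OF M(4)[OF that, of \<i>]] by (simp add: inner_eq_Re_cinner f(2) cinner_scaleC_left)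
  qed
  with \<open>y \<in> M\<close> show ?thesis by blast
qed

lemma riesz:
  fixes f :: "'h::chilbert_space \<Rightarrow> complex"
  assumes "\<And>x y. f (x + y) = f x + f y" "\<And>a x. f (a *\<^sub>C x) = a * f x" "\<And>x. cmod (f x) \<le> K * norm x"
  shows "\<exists>y. \<forall>h. f h = cinner h y"
  using riesz_closed_subspace[of UNIV f K] assms by auto

text \<open>\<open>p\<close> is the vector that represents the functional \<open>cinner _ x\<close>
  on \<open>M\<close>.\<close>

lemma orthogonal_decomposition:
  fixes M :: "'h::chilbert_space set"
  assumes "closed M" "0 \<in> M" "\<And>x y. x \<in> M \<Longrightarrow> y \<in> M \<Longrightarrow> x + y \<in> M"
      "\<And>a x. x \<in> M \<Longrightarrow> a *\<^sub>C x \<in> M"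
  shows "\<exists>p\<in>M. \<forall>h\<in>M. cinner h (x - p) = 0"
proof -
  have "cmod (cinner h x) \<le> norm x * norm h" for h
    using norm_cinner_le[of h x] by (simp add: mult.commute)
  then have "\<exists>p\<in>M. \<forall>h\<in>M. cinner h x = cinner h p"
    using assms by (intro riesz_closed_subspace[where K = "norm x"])
      (auto simp: cinner_add_left cinner_scaleC_left)
  then show ?thesis
    by (simp add: cinner_diff_right)
qed

section \<open>Adjoints\<close>

lemma cadjointI:
  fixes T :: "'h::complex_inner \<Rightarrow> 'k::complex_inner"
  assumes "\<And>x y. cinner (T x) y = cinner x (A y)"
  shows "cadjoint T = A"
  unfolding cadjoint_def
proof (rule the_equality)
  fix B assume "\<forall>x y. cinner (T x) y = cinner x (B y)"
  then have "cinner (B y) x = cinner (A y) x" for x y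
    using assms by (metis cinner_commute)
  then show "B = A"
    by (intro ext cinner_eqI)
qed (use assms in blast)

text \<open>Testing against all vectors shows that the adjoint relation alone forces linearity and
  the norm bound. An operator known only through such a relation, like \<open>A\<close> in the
  locale below, gets both from here.\<close>

lemma bounded_clinear_if_adjoint:
  fixes T :: "'h::complex_inner \<Rightarrow> 'k::complex_inner"
  assumes "bounded_clinear T" and adj: "\<And>x y. cinner (T x) y = cinner x (A y)"
  shows "bounded_clinear A"
proof (rule bounded_clinearI)
  have adj': "cinner (A y) x = cinner y (T x)" for x y
    by (metis adj cinner_commute)
  show "A (x + y) = A x + A y" "A (a *\<^sub>C x) = a *\<^sub>C A x" for a x y
    by (rule cinner_eqI; simp add: adj' cinner_add_left cinner_scaleC_left)+
  show "norm (A x) \<le> onorm T * norm x" for x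
  proof (rule norm_le_if_cinner_le)
    show "cmod (cinner (A x) y) \<le> onorm T * norm x * norm y" for y
      using norm_cinner_le[of x "T y"]
        mult_left_mono[OF bounded_clinear_norm_le[OF assms(1), of y] norm_ge_zero[of x]]
      by (simp add: adj' mult_ac)
    show "0 \<le> onorm T * norm x"
      using assms(1) by (simp add: bounded_clinear_def onorm_pos_le)
  qed
qed

lemma norm_adjoint_le:
  fixes T :: "'h::complex_inner \<Rightarrow> 'k::complex_inner"
  assumes adj: "\<And>x y. cinner (T x) y = cinner x (A y)"
    and T: "\<And>x. norm (T x) \<le> K * norm x" and "0 \<le> K"
  shows "norm (A y) \<le> K * norm y"
proof (rule norm_le_if_cinner_le)
  show "cmod (cinner (A y) x) \<le> K * norm y * norm x" for x
    using norm_cinner_le[of "T x" y] mult_right_mono[OF T[of x] norm_ge_zero[of y]]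
    by (subst cinner_commute) (simp add: adj mult_ac)
qed (use \<open>0 \<le> K\<close> in simp)

lemma cadjoint_exists:
  fixes T :: "'h::chilbert_space \<Rightarrow> 'k::complex_inner"
  assumes "bounded_clinear T"
  shows "\<exists>A. \<forall>x y. cinner (T x) y = cinner x (A y)"
proof -
  have "\<exists>z. \<forall>h. cinner (T h) y = cinner h z" for y
  proof (rule riesz)
    show "cmod (cinner (T x) y) \<le> onorm T * norm y * norm x" for x
      using norm_cinner_le[of "T x" y]
        mult_right_mono[OF bounded_clinear_norm_le[OF assms, of x] norm_ge_zero[of y]]
      by (simp add: mult_ac)
  qed (simp_all add: bounded_clinear_add[OF assms] bounded_clinear_scaleC[OF assms] cinner_add_left
      cinner_scaleC_left)
  then show ?thesis
    by metis
qed

lemma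
  fixes T :: "'h::chilbert_space \<Rightarrow> 'k::complex_inner"
  assumes "bounded_clinear T"
  shows cinner_cadjoint_right: "cinner (T x) y = cinner x (cadjoint T y)"
    and cinner_cadjoint_left: "cinner (cadjoint T y) x = cinner y (T x)"
    and bounded_clinear_cadjoint: "bounded_clinear (cadjoint T)"
proof -
  obtain A where A: "\<And>x y. cinner (T x) y = cinner x (A y)"
    using cadjoint_exists[OF assms] by blast
  then have "cadjoint T = A" by (rule cadjointI)
  show right: "cinner (T x) y = cinner x (cadjoint T y)" for x y
    unfolding \<open>cadjoint T = A\<close> by (rule A)
  show "cinner (cadjoint T y) x = cinner y (T x)"
    using arg_cong[OF right[of x y], of cnj] by (simp flip: cinner_commute)
  show "bounded_clinear (cadjoint T)"
    using assms right by (rule bounded_clinear_if_adjoint)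
qed

text \<open>The set of \<open>g\<close> for which \<open>\<langle>G\<^sub>n f, g\<rangle>\<close> converges for all \<open>f\<close> is a closed subspace, by uniform
  boundedness.\<close>

lemma weak_limit:
  fixes G :: "nat \<Rightarrow> 'h::chilbert_space \<Rightarrow> 'k::chilbert_space"
  assumes G: "\<And>n. bounded_clinear (G n)" and le: "\<And>n x. norm (G n x) \<le> C * norm x"
    and dense: "\<And>g. (\<And>d. d \<in> D \<Longrightarrow> cinner g d = 0) \<Longrightarrow> g = 0"
    and conv: "\<And>f d. d \<in> D \<Longrightarrow> convergent (\<lambda>n. cinner (G n f) d)"
  obtains L where "bounded_clinear L" "\<And>f g. (\<lambda>n. cinner (G n f) g) \<longlonglongrightarrow> cinner (L f) g"
proof -
  define M where "M = {g. \<forall>f. convergent (\<lambda>n. cinner (G n f) g)}"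
  have "closed M"
    unfolding closed_sequential_limits
  proof (intro allI impI)
    fix X l assume X: "(\<forall>n. X n \<in> M) \<and> X \<longlonglongrightarrow> l"
    have "Cauchy (\<lambda>n. cinner (G n f) l)" for f
    proof (rule metric_CauchyI)
      fix e :: real assume "0 < e"
      have C: "0 \<le> C * norm f"
        using le[of undefined f] norm_ge_zero order_trans by blast
      then have "0 < e / (3 * (C * norm f + 1))"
        using \<open>0 < e\<close> by (intro divide_pos_pos) auto
      then obtain k where k: "dist (X k) l < e / (3 * (C * norm f + 1))"
        using X metric_LIMSEQ_D by blast
      have close: "dist (cinner (G n f) (X k)) (cinner (G n f) l) < e / 3" for n
      proof -
        have "dist (cinner (G n f) (X k)) (cinner (G n f) l) \<le> norm (G n f) * norm (X k - l)"
          using norm_cinner_le by (metis cinner_diff_right dist_norm)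
        also have "\<dots> \<le> (C * norm f) * norm (X k - l)"
          by (intro mult_right_mono le) auto
        also have "\<dots> \<le> (C * norm f + 1) * norm (X k - l)"
          by (intro mult_right_mono) auto
        also have "\<dots> < e / 3"
          using k C by (simp add: dist_norm field_simps)
        finally show ?thesis .
      qed
      have "Cauchy (\<lambda>n. cinner (G n f) (X k))"
        using X by (auto simp: M_def intro: convergent_Cauchy)
      then obtain N where N: "\<And>i j. N \<le> i \<Longrightarrow> N \<le> j \<Longrightarrow>
          dist (cinner (G i f) (X k)) (cinner (G j f) (X k)) < e / 3"
        using metric_CauchyD[of _ "e / 3"] \<open>0 < e\<close> by fastforce
      show "\<exists>N. \<forall>i\<ge>N. \<forall>j\<ge>N. dist (cinner (G i f) l) (cinner (G j f) l) < e"
      proof (intro exI allI impI)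
        fix i j assume "N \<le> i" "N \<le> j"
        then show "dist (cinner (G i f) l) (cinner (G j f) l) < e"
          using N[of i j] close[of i] close[of j]
            dist_triangle[of "cinner (G i f) l" "cinner (G j f) l" "cinner (G i f) (X k)"]
            dist_triangle[of "cinner (G i f) (X k)" "cinner (G j f) l" "cinner (G j f) (X k)"]
          by (simp add: dist_commute)
      qed
    qed
    then show "l \<in> M"
      by (simp add: M_def Cauchy_convergent_iff)
  qed
  have "g \<in> M" for g
  proof -
    obtain p where p: "p \<in> M" "\<And>h. h \<in> M \<Longrightarrow> cinner h (g - p) = 0"
      using orthogonal_decomposition[of M g] \<open>closed M\<close>
      by (fastforce simp: M_def cinner_add_right cinner_scaleC_right
          intro: convergent_add convergent_mult convergent_const)
    have "g - p = 0"
    proof (rule dense)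
      fix d assume "d \<in> D"
      then show "cinner (g - p) d = 0"
        using p(2)[of d] conv by (subst cinner_commute) (simp add: M_def)
    qed
    with p(1) show ?thesis by simp
  qed
  then have conv: "(\<lambda>n. cinner (G n f) g) \<longlonglongrightarrow> lim (\<lambda>n. cinner (G n f) g)" for f g
    by (simp add: M_def convergent_LIMSEQ_iff)
  \<comment> \<open>\<open>riesz\<close> asks for a functional linear in \<open>g\<close>, while
    \<open>cinner\<close> is conjugate linear in its second argument; hence the conjugated
    limits.\<close>
  have conv': "(\<lambda>n. cinner g (G n f)) \<longlonglongrightarrow> cnj (lim (\<lambda>n. cinner (G n f) g))" for f g
    using tendsto_cnj[OF conv[of f g]] by (simp flip: cinner_commute)
  have "\<exists>y. \<forall>g. cnj (lim (\<lambda>n. cinner (G n f) g)) = cinner g y" for f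
  proof (rule riesz)
    fix g g' a
    show "cnj (lim (\<lambda>n. cinner (G n f) (g + g'))) =
        cnj (lim (\<lambda>n. cinner (G n f) g)) + cnj (lim (\<lambda>n. cinner (G n f) g'))"
      using tendsto_add[OF conv'[of g f] conv'[of g' f]] conv'[of "g + g'" f]
      by (intro LIMSEQ_unique) (simp_all add: cinner_add_left)
    show "cnj (lim (\<lambda>n. cinner (G n f) (a *\<^sub>C g))) = a * cnj (lim (\<lambda>n. cinner (G n f) g))"
      using tendsto_mult_left[OF conv'[of g f], of a] conv'[of "a *\<^sub>C g" f]
      by (intro LIMSEQ_unique) (simp_all add: cinner_scaleC_left)
    show "cmod (cnj (lim (\<lambda>n. cinner (G n f) g))) \<le> (C * norm f) * norm g"
    proof (rule Lim_bounded[OF tendsto_norm[OF conv']])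
      show "\<forall>n\<ge>0. cmod (cinner g (G n f)) \<le> C * norm f * norm g"
        using norm_cinner_le[of g] mult_left_mono[OF le norm_ge_zero[of g]]
        by (metis mult.commute order_trans)
    qed
  qed
  then obtain L where L: "\<And>f g. cnj (lim (\<lambda>n. cinner (G n f) g)) = cinner g (L f)"
    by metis
  then have lim: "(\<lambda>n. cinner (G n f) g) \<longlonglongrightarrow> cinner (L f) g" for f g
    using conv[of f g] by (metis cinner_commute complex_cnj_cnj)
  have "bounded_clinear L"
  proof (rule bounded_clinearI)
    fix f f' a
    show "L (f + f') = L f + L f'"
    proof (rule cinner_eqI)
      fix g
      show "cinner (L (f + f')) g = cinner (L f + L f') g"
        using tendsto_add[OF lim[of f g] lim[of f' g]] lim[of "f + f'" g]
        by (intro LIMSEQ_unique) (simp_all add: cinner_add_left bounded_clinear_add[OF G])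
    qed
    show "L (a *\<^sub>C f) = a *\<^sub>C L f"
    proof (rule cinner_eqI)
      fix g
      show "cinner (L (a *\<^sub>C f)) g = cinner (a *\<^sub>C L f) g"
        using tendsto_mult_left[OF lim[of f g], of a] lim[of "a *\<^sub>C f" g]
        by (intro LIMSEQ_unique) (simp_all add: cinner_scaleC_left bounded_clinear_scaleC[OF G])
    qed
    show "norm (L f) \<le> C * norm f"
    proof (rule norm_le_if_cinner_le)
      show "0 \<le> C * norm f"
        using le[of undefined f] norm_ge_zero order_trans by blast
      fix g
      show "cmod (cinner (L f) g) \<le> C * norm f * norm g"
      proof (rule Lim_bounded[OF tendsto_norm[OF lim]])
        show "\<forall>n\<ge>0. cmod (cinner (G n f) g) \<le> C * norm f * norm g"
          using norm_cinner_le[of _ g] mult_right_mono[OF le norm_ge_zero[of g]]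
          by (metis order_trans)
      qed
    qed
  qed
  with lim show ?thesis
    using that by blast
qed


section \<open>Pure isometries and Hankel operators\<close>

text \<open>Writing \<open>T = W C V\<close> with \<open>V\<close> inverse to \<open>W\<close> gives
  \<open>T^n = W C^n V\<close>, so \<open>M = onorm W * onorm V\<close> serves for every
  \<open>n\<close>.\<close>

lemma similar_to_contraction_power_bounded:
  fixes T :: "'h::complex_inner \<Rightarrow> 'h"
  assumes "similar_to_contraction T"
  obtains M where "0 \<le> M" "\<And>n x. norm ((T ^^ n) x) \<le> M * norm x"
proof -
  obtain W V :: "'h \<Rightarrow> 'h" where W: "bounded_clinear W" and V: "bounded_clinear V"
    and WV: "\<forall>x. W (V x) = x" and VW: "\<forall>x. V (W x) = x" and C: "contraction (\<lambda>x. V (T (W x)))"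
    using assms unfolding similar_to_contraction_def fun_eq_iff comp_def id_apply by blast
  define C' where "C' = (\<lambda>x. V (T (W x)))"
  have C'_le: "norm (C' x) \<le> norm x" for x
    using C bounded_clinear_norm_le[of C' x] mult_right_mono[of "onorm C'" 1 "norm x"]
    by (simp add: contraction_def C'_def)
  have C'n_le: "norm ((C' ^^ n) x) \<le> norm x" for n x
    by (induction n) (auto intro: order_trans[OF C'_le])
  have T: "(T ^^ n) x = W ((C' ^^ n) (V x))" for n x
    by (induction n) (simp_all add: WV VW C'_def)
  have pos: "0 \<le> onorm W" "0 \<le> onorm V"
    using W V by (auto simp: bounded_clinear_def onorm_pos_le)
  have "norm ((T ^^ n) x) \<le> (onorm W * onorm V) * norm x" for n x
  proof -
    have "norm ((T ^^ n) x) \<le> onorm W * norm ((C' ^^ n) (V x))"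
      unfolding T by (rule bounded_clinear_norm_le[OF W])
    also have "\<dots> \<le> onorm W * norm (V x)"
      by (intro mult_left_mono C'n_le pos)
    also have "\<dots> \<le> onorm W * (onorm V * norm x)"
      by (intro mult_left_mono bounded_clinear_norm_le[OF V] pos)
    finally show ?thesis by (simp add: mult.assoc)
  qed
  with pos that show ?thesis by (metis mult_nonneg_nonneg)
qed

section \<open>Fejer sums of a contraction\<close>

lemma sum_symmetric_interval:
  fixes g :: "int \<Rightarrow> 'a::comm_monoid_add"
  shows "(\<Sum>k\<in>{- int N..int N}. g k) = g 0 + (\<Sum>i=1..N. g (int i) + g (- int i))"
proof (induction N)
  case (Suc N)
  have "{- int (Suc N)..int (Suc N)} = insert (int (Suc N)) (insert (- int (Suc N)) {- int N..int N})"
    by auto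
  then show ?case
    using Suc by (simp add: ac_simps del: of_nat_Suc)
qed simp

text \<open>The term \<open>t i\<close> is counted once for each \<open>j\<close> with
  \<open>i \<le> j\<close> and \<open>j < N\<close>. This count is the origin of the Fejer weights
  \<open>N - i\<close>.\<close>

lemma sum_partial_sums:
  fixes t :: "nat \<Rightarrow> real"
  shows "(\<Sum>j<N. \<Sum>i\<le>j. t i) = (\<Sum>i<N. real (N - i) * t i)"
proof (induction N)
  case (Suc N)
  have "(\<Sum>i<Suc N. real (Suc N - i) * t i) = (\<Sum>i<N. real (N - i) * t i + t i) + t N"
    by (auto simp: Suc_diff_le algebra_simps intro!: sum.cong)
  also have "\<dots> = (\<Sum>i<N. real (N - i) * t i) + (\<Sum>i\<le>N. t i)"
    by (simp add: sum.distrib lessThan_Suc_atMost[symmetric])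
  finally show ?case
    using Suc by simp
qed simp

text \<open>With \<open>g\<^sub>j = \<Sum>\<^sub>i\<^sub><\<^sub>j w\<^sup>i W\<^sup>i v\<close> one has \<open>g\<^sub>j\<^sub>+\<^sub>1 - v = w W g\<^sub>j\<close>, so the contractivity of \<open>W\<close> makes
  the sum of \<open>2 Re [g\<^sub>j, v] - [v, v]\<close> telescope to something nonnegative.\<close>

lemma fejer_sum_nonneg:
  fixes B :: "'v::complex_inner \<Rightarrow> 'v \<Rightarrow> complex" and W :: "'v \<Rightarrow> 'v"
  assumes B_add: "\<And>u v z. B (u + v) z = B u z + B v z"
    and B_scale: "\<And>a u z. B (a *\<^sub>C u) z = a * B u z"
    and B_commute: "\<And>u v. B u v = cnj (B v u)"
    and B_pos: "\<And>u. 0 \<le> Re (B u u)"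
    and W: "bounded_clinear W" and contr: "\<And>u. Re (B (W u) (W u)) \<le> Re (B u u)"
    and w: "cmod w = 1"
  shows "real N * Re (B v v) \<le> 2 * (\<Sum>i<N. real (N - i) * Re (w ^ i * B ((W ^^ i) v) v))"
proof -
  have B_add': "B z (u + v) = B z u + B z v" for u v z
    by (metis B_add B_commute complex_cnj_add)
  have B_scale': "B z (a *\<^sub>C u) = cnj a * B z u" for a u z
    by (metis B_scale B_commute complex_cnj_mult)
  have B_zero: "B 0 z = 0" for z
    using B_scale[of 0 0 z] by simp
  have B_sum: "B (\<Sum>i\<in>I. f i) z = (\<Sum>i\<in>I. B (f i) z)" for I :: "nat set" and f z
    by (induction I rule: infinite_finite_induct) (auto simp: B_add B_zero)
  define g where "g = rec_nat 0 (\<lambda>_ x. v + w *\<^sub>C W x)"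
  have g_simps: "g 0 = 0" "g (Suc j) = v + w *\<^sub>C W (g j)" for j
    by (simp_all add: g_def)
  have g_sum: "g (Suc j) = (\<Sum>i\<le>j. w ^ i *\<^sub>C (W ^^ i) v)" for j
  proof (induction j)
    case 0
    then show ?case by (simp add: g_simps bounded_clinear_zero[OF W])
  next
    case (Suc j)
    have "g (Suc (Suc j)) = v + w *\<^sub>C W (\<Sum>i\<le>j. w ^ i *\<^sub>C (W ^^ i) v)"
      using Suc by (simp add: g_simps)
    also have "\<dots> = v + (\<Sum>i\<le>j. w ^ Suc i *\<^sub>C (W ^^ Suc i) v)"
      by (simp add: bounded_clinear_sum[OF W] bounded_clinear_scaleC[OF W] scaleC_sum_right
          scaleC_scaleC)
    also have "\<dots> = (\<Sum>i\<le>Suc j. w ^ i *\<^sub>C (W ^^ i) v)"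
      by (subst sum.atMost_Suc_shift) simp
    finally show ?case .
  qed
  have step: "Re (B (g (Suc j)) (g (Suc j))) \<le>
      Re (B (g j) (g j)) + (2 * Re (B (g (Suc j)) v) - Re (B v v))" for j
  proof -
    define h where "h = w *\<^sub>C W (g j)"
    have "w * cnj w = 1"
      using w by (simp add: complex_norm_square[symmetric])
    then have "B h h = B (W (g j)) (W (g j))"
      by (simp add: h_def B_scale B_scale' mult.assoc[symmetric] mult.commute[of "cnj w"])
    moreover have "Re (B (v + h) (v + h)) = Re (B h h) + (2 * Re (B (v + h) v) - Re (B v v))"
      using arg_cong[OF B_commute[of v h], of Re] by (simp add: B_add B_add')
    ultimately show ?thesis
      using contr[of "g j"] by (simp add: g_simps h_def)
  qed
  have "Re (B (g N) (g N)) \<le> (\<Sum>j<N. 2 * Re (B (g (Suc j)) v) - Re (B v v))"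
  proof (induction N)
    case 0
    then show ?case by (simp add: g_simps B_zero)
  next
    case (Suc N)
    then show ?case using step[of N] by simp
  qed
  then have "0 \<le> (\<Sum>j<N. 2 * Re (B (g (Suc j)) v) - Re (B v v))"
    using B_pos[of "g N"] by linarith
  also have "\<dots> = 2 * (\<Sum>j<N. \<Sum>i\<le>j. Re (w ^ i * B ((W ^^ i) v) v)) - real N * Re (B v v)"
    by (simp add: g_sum B_sum B_scale sum_subtractf sum_distrib_left)
  finally show ?thesis
    unfolding sum_partial_sums by simp
qed

text \<open>By the Wold decomposition, \<open>pure\<close> says that the isometry \<open>S\<close>
  has no unitary part: it is a unilateral shift whose multiplicity space is the kernel of
  \<open>A\<close>. The operator-theoretic part of the proof uses nothing else about the Hardy
  space.\<close>

locale pure_isometry =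
  fixes S A :: "'h::chilbert_space \<Rightarrow> 'h"
  assumes clinear_S: "bounded_clinear S"
    and isometry: "cinner (S x) (S y) = cinner x y"
    and adjoint: "cinner (S x) y = cinner x (A y)"
    and pure: "(\<lambda>n. (A ^^ n) x) \<longlonglongrightarrow> 0"
begin

lemma adjoint': "cinner (A x) y = cinner x (S y)"
  by (metis adjoint cinner_commute)

lemma clinear_A: "bounded_clinear A"
  using clinear_S adjoint by (rule bounded_clinear_if_adjoint)

lemma A_S [simp]: "A (S x) = x"
  by (rule cinner_eqI) (simp add: adjoint' isometry)

lemma norm_S [simp]: "norm (S x) = norm x"
proof -
  have "(norm (S x))\<^sup>2 = (norm x)\<^sup>2"
    using arg_cong[OF isometry[of x x], of Re] by simp
  then show ?thesis by simp
qed

lemma norm_A_le: "norm (A x) \<le> norm x"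
  using norm_adjoint_le[of S A 1 x] adjoint by simp

lemma norm_A_funpow_le: "norm ((A ^^ n) x) \<le> norm x"
  by (induction n) (auto intro: order_trans[OF norm_A_le])

lemma adjoint_funpow: "cinner ((A ^^ n) x) y = cinner x ((S ^^ n) y)"
  by (induction n arbitrary: x) (simp_all add: adjoint' funpow_swap1)

lemma norm_S_funpow [simp]: "norm ((S ^^ n) x) = norm x"
  by (induction n) auto

lemma A_funpow_S_funpow [simp]: "(A ^^ n) ((S ^^ n) x) = x"
  by (induction n) (simp_all add: funpow_swap1[of A])

lemma A_diff_S_A [simp]: "A (x - S (A x)) = 0"
  by (simp add: bounded_clinear_diff[OF clinear_A])

text \<open>A constant sequence of norms tends to 0 by \<open>pure\<close>. With
  \<open>m = 2\<close> this excludes nonzero fixed vectors of \<open>A^2\<close>, that is, nonzero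
  vectors orthogonal to the range of \<open>1 - S^2\<close>.\<close>

lemma A_fixed_imp_zero:
  assumes "\<And>n. norm ((A ^^ (m * n)) f) = norm f" "0 < m"
  shows "f = 0"
proof -
  have "(\<lambda>n. (A ^^ (m * n)) f) \<longlonglongrightarrow> 0"
    using LIMSEQ_subseq_LIMSEQ[OF pure[of f], of "\<lambda>n. m * n"] \<open>0 < m\<close>
    by (auto simp: comp_def strict_mono_def)
  then have "(\<lambda>n. norm f) \<longlonglongrightarrow> 0"
    using tendsto_norm_zero assms(1) by fastforce
  then show ?thesis
    by (simp add: LIMSEQ_const_iff)
qed

end

text \<open>The abstract form of a Hankel operator: for the shift, \<open>\<langle>\<Gamma> S\<^sup>k x, S\<^sup>j y\<rangle>\<close> depends only on \<open>j + k\<close>.\<close>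

locale hankel_operator = pure_isometry S A for S A :: "'h::chilbert_space \<Rightarrow> 'h" +
  fixes \<Gamma> :: "'h \<Rightarrow> 'h"
  assumes clinear_\<Gamma>: "bounded_clinear \<Gamma>" and hankel: "A (\<Gamma> x) = \<Gamma> (S x)"
begin

lemma hankel_funpow: "(A ^^ n) (\<Gamma> x) = \<Gamma> ((S ^^ n) x)"
  by (induction n) (simp_all add: hankel)

text \<open>The off-diagonal entry of the \<open>n\<close>-th power is the sum of
  \<open>S^(n-1-i) \<Gamma> S^i\<close> over \<open>i < n\<close>. The Hankel identity turns
  \<open>\<Gamma> S^i\<close> into \<open>A^i \<Gamma>\<close>, and \<open>A^n\<close> on the left
  cancels the powers of \<open>S\<close>, leaving \<open>A^(2i+1) \<Gamma>\<close>.\<close>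

lemma upper_block_power_S:
  "(A ^^ n) (fst ((upper_block S \<Gamma> S ^^ n) (0, y))) = (\<Sum>i<n. (A ^^ (2 * i + 1)) (\<Gamma> y))"
proof -
  have "(A ^^ n) (fst ((upper_block S \<Gamma> S ^^ n) (0, y))) = (\<Sum>i<n. (A ^^ (2 * i + 1)) (\<Gamma> y)) \<and>
      snd ((upper_block S \<Gamma> S ^^ n) (0, y)) = (S ^^ n) y"
  proof (induction n)
    case 0
    then show ?case by simp
  next
    case (Suc n)
    obtain X where X: "(upper_block S \<Gamma> S ^^ n) (0, y) = (X, (S ^^ n) y)"
      using Suc by (metis prod.collapse)
    have "(A ^^ Suc n) (S X + \<Gamma> ((S ^^ n) y)) = (A ^^ n) X + (A ^^ Suc n) ((A ^^ n) (\<Gamma> y))"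
      by (simp add: funpow_swap1 bounded_clinear_add[OF clinear_A] hankel_funpow
          bounded_clinear_add[OF bounded_clinear_funpow[OF clinear_A]])
    also have "(A ^^ Suc n) ((A ^^ n) (\<Gamma> y)) = (A ^^ (2 * n + 1)) (\<Gamma> y)"
      by (simp add: mult_2 funpow_add)
    finally show ?case
      using Suc X by (simp add: upper_block_def)
  qed
  then show ?thesis by simp
qed

text \<open>Here the entry is the sum of \<open>A^(n-1-i) \<Gamma> A^i\<close>. On
  \<open>S^n y\<close> the right factor leaves \<open>S^(n-i) y\<close>, which the Hankel identity
  moves through \<open>\<Gamma>\<close> as \<open>A^(n-i)\<close>; the total exponents are again the
  odd numbers below \<open>2n\<close>.\<close>

lemma upper_block_power_A:
  "(upper_block A \<Gamma> A ^^ n) (f, (S ^^ n) y) = ((A ^^ n) f + (\<Sum>i<n. (A ^^ (2 * i + 1)) (\<Gamma> y)), y)"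
proof (induction n arbitrary: f)
  case 0
  then show ?case by simp
next
  case (Suc n)
  have "(upper_block A \<Gamma> A ^^ Suc n) (f, (S ^^ Suc n) y) =
      (upper_block A \<Gamma> A ^^ n) (A f + \<Gamma> ((S ^^ Suc n) y), (S ^^ n) y)"
    by (simp only: funpow_Suc_right[of n "upper_block A \<Gamma> A"] comp_def)
      (simp add: upper_block_def)
  also have "\<dots> = ((A ^^ n) (A f) + (A ^^ n) (\<Gamma> ((S ^^ Suc n) y)) + (\<Sum>i<n. (A ^^ (2 * i + 1)) (\<Gamma> y)), y)"
    by (simp add: Suc bounded_clinear_add[OF bounded_clinear_funpow[OF clinear_A]])
  also have "(A ^^ n) (\<Gamma> ((S ^^ Suc n) y)) = (A ^^ (2 * n + 1)) (\<Gamma> y)"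
    unfolding hankel_funpow[symmetric] by (simp add: mult_2 funpow_add funpow_swap1)
  finally show ?case
    by (simp add: funpow_swap1 add_ac)
qed

lemma similar_to_contraction_S_imp_bounded:
  assumes "similar_to_contraction (upper_block S \<Gamma> S)"
  shows "\<exists>M\<ge>0. \<forall>n y. norm (\<Sum>i<n. (A ^^ (2 * i + 1)) (\<Gamma> y)) \<le> M * norm y"
proof -
  obtain M where "0 \<le> M" and M: "\<And>n x. norm ((upper_block S \<Gamma> S ^^ n) x) \<le> M * norm x"
    using assms by (rule similar_to_contraction_power_bounded) blast
  have "norm (\<Sum>i<n. (A ^^ (2 * i + 1)) (\<Gamma> y)) \<le> M * norm y" for n y
  proof -
    have "norm (\<Sum>i<n. (A ^^ (2 * i + 1)) (\<Gamma> y)) \<le> norm (fst ((upper_block S \<Gamma> S ^^ n) (0, y)))"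
      unfolding upper_block_power_S[symmetric] by (rule norm_A_funpow_le)
    also have "\<dots> \<le> norm ((upper_block S \<Gamma> S ^^ n) (0, y))"
      by (metis norm_fst_le prod.collapse)
    also have "\<dots> \<le> M * norm y"
      using M[of n "(0, y)"] by (simp add: norm_Pair)
    finally show ?thesis .
  qed
  with \<open>0 \<le> M\<close> show ?thesis by blast
qed

lemma similar_to_contraction_A_imp_bounded:
  assumes "similar_to_contraction (upper_block A \<Gamma> A)"
  shows "\<exists>M\<ge>0. \<forall>n y. norm (\<Sum>i<n. (A ^^ (2 * i + 1)) (\<Gamma> y)) \<le> M * norm y"
proof -
  obtain M where "0 \<le> M" and M: "\<And>n x. norm ((upper_block A \<Gamma> A ^^ n) x) \<le> M * norm x"
    using assms by (rule similar_to_contraction_power_bounded) blast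
  have "norm (\<Sum>i<n. (A ^^ (2 * i + 1)) (\<Gamma> y)) \<le> M * norm y" for n y
  proof -
    have "(upper_block A \<Gamma> A ^^ n) (0, (S ^^ n) y) = (\<Sum>i<n. (A ^^ (2 * i + 1)) (\<Gamma> y), y)"
      by (simp add: upper_block_power_A bounded_clinear_zero[OF bounded_clinear_funpow[OF clinear_A]])
    then have "norm (\<Sum>i<n. (A ^^ (2 * i + 1)) (\<Gamma> y)) \<le> norm ((upper_block A \<Gamma> A ^^ n) (0, (S ^^ n) y))"
      by (metis norm_fst_le)
    also have "\<dots> \<le> M * norm y"
      using M[of n "(0, (S ^^ n) y)"] by (simp add: norm_Pair)
    finally show ?thesis .
  qed
  with \<open>0 \<le> M\<close> show ?thesis by blast
qed

text \<open>\<open>G\<close> is the weak limit of the partial sums \<open>K n\<close> of the Neumann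
  series for \<open>1 - A^2\<close>. Against vectors \<open>(1 - S^2) g\<close> the limit can be
  computed: the adjoint moves \<open>1 - A^2\<close> onto \<open>K n\<close>, the sum telescopes,
  and \<open>pure\<close> removes the remainder. Uniform boundedness extends convergence to all
  vectors.\<close>

lemma hankel_equation_solvable:
  assumes bound: "\<And>n y. norm (\<Sum>i<n. (A ^^ (2 * i + 1)) (\<Gamma> y)) \<le> M * norm y"
  obtains G where "bounded_clinear G" "\<And>x. A (G x) = G (S x)" "\<And>x. G x - A (A (G x)) = \<Gamma> x"
proof -
  define K where "K n x = (\<Sum>i<Suc n. (A ^^ (2 * i)) (\<Gamma> x))" for n x
  have K_clinear: "bounded_clinear (K n)" for n
    unfolding K_def
    by (intro bounded_clinear_setsum bounded_clinear_compose[OF bounded_clinear_funpow clinear_\<Gamma>] clinear_A)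
  have K_bound: "norm (K n x) \<le> (onorm \<Gamma> + M) * norm x" for n x
  proof -
    \<comment> \<open>The hypothesis bounds odd powers; one further \<open>A\<close> makes them
      even, and the term with exponent 0 is split off.\<close>
    have "K n x = \<Gamma> x + A (\<Sum>i<n. (A ^^ (2 * i + 1)) (\<Gamma> x))"
      unfolding K_def by (subst sum.lessThan_Suc_shift) (simp add: bounded_clinear_sum[OF clinear_A])
    also have "norm \<dots> \<le> norm (\<Gamma> x) + norm (\<Sum>i<n. (A ^^ (2 * i + 1)) (\<Gamma> x))"
      using norm_A_le by (intro order_trans[OF norm_triangle_ineq] add_left_mono)
    also have "\<dots> \<le> (onorm \<Gamma> + M) * norm x"
      using bounded_clinear_norm_le[OF clinear_\<Gamma>, of x] bound[where n = n and y = x] by (simp add: distrib_right)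
    finally show ?thesis .
  qed
  have K_telescope: "K n x - A (A (K n x)) = \<Gamma> x - (A ^^ (2 * Suc n)) (\<Gamma> x)" for n x
  proof -
    have "A (A (K n x)) = (\<Sum>i<Suc n. (A ^^ (2 * Suc i)) (\<Gamma> x))"
      by (simp only: K_def bounded_clinear_sum[OF clinear_A]) simp
    then have "K n x - A (A (K n x)) = (\<Sum>i<Suc n. (A ^^ (2 * i)) (\<Gamma> x) - (A ^^ (2 * Suc i)) (\<Gamma> x))"
      by (simp only: K_def sum_subtractf)
    also have "\<dots> = \<Gamma> x - (A ^^ (2 * Suc n)) (\<Gamma> x)"
      by (subst sum_lessThan_telescope') simp
    finally show ?thesis .
  qed
  have K_hankel: "A (K n x) = K n (S x)" for n x
    by (simp only: K_def bounded_clinear_sum[OF clinear_A] funpow_swap1 hankel)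
  have tail: "(\<lambda>n. (A ^^ (2 * Suc n)) h) \<longlonglongrightarrow> 0" for h
    using LIMSEQ_subseq_LIMSEQ[OF pure[of h], of "\<lambda>n. 2 * Suc n"]
    by (auto simp: comp_def strict_mono_def)
  have shift_twice: "cinner u (g - S (S g)) = cinner (u - A (A u)) g" for u g
    by (simp add: cinner_diff_left cinner_diff_right adjoint')
  have K_lim: "(\<lambda>n. cinner (K n f) (g - S (S g))) \<longlonglongrightarrow> cinner (\<Gamma> f) g" for f g
  proof -
    have "(\<lambda>n. cinner (\<Gamma> f - (A ^^ (2 * Suc n)) (\<Gamma> f)) g) \<longlonglongrightarrow> cinner (\<Gamma> f - 0) g"
      by (intro tendsto_cinner tendsto_diff tendsto_const tail)
    then show ?thesis
      by (simp only: shift_twice K_telescope diff_zero)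
  qed
  obtain G where G: "bounded_clinear G" and lim: "\<And>f g. (\<lambda>n. cinner (K n f) g) \<longlonglongrightarrow> cinner (G f) g"
  proof (rule weak_limit[where G = K and C = "onorm \<Gamma> + M" and D = "range (\<lambda>g. g - S (S g))"])
    show "bounded_clinear (K n)" "norm (K n x) \<le> (onorm \<Gamma> + M) * norm x" for n x
      by (rule K_clinear K_bound)+
    show "convergent (\<lambda>n. cinner (K n f) d)" if "d \<in> range (\<lambda>g. g - S (S g))" for f d
      using that K_lim by (auto simp: convergent_def)
    fix g assume "\<And>d. d \<in> range (\<lambda>g. g - S (S g)) \<Longrightarrow> cinner g d = 0"
    then have "cinner (g - A (A g)) x = 0" for x
      by (metis shift_twice rangeI)
    then have "g - A (A g) = 0"
      using cinner_self_eq_0_iff by blast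
    then have "(A ^^ 2) g = g"
      by (simp add: numeral_2_eq_2)
    then have "(A ^^ (2 * n)) g = g" for n
      by (induction n) (simp_all add: funpow_add numeral_2_eq_2)
    then show "g = 0"
      by (intro A_fixed_imp_zero[of 2]) auto
  qed blast
  show ?thesis
  proof (rule that[OF G])
    show "A (G x) = G (S x)" for x
    proof (rule cinner_eqI)
      fix g
      have "(\<lambda>n. cinner (K n (S x)) g) \<longlonglongrightarrow> cinner (A (G x)) g"
        unfolding K_hankel[symmetric] adjoint' by (rule lim)
      then show "cinner (A (G x)) g = cinner (G (S x)) g"
        using lim LIMSEQ_unique by blast
    qed
    show "G x - A (A (G x)) = \<Gamma> x" for x
    proof (rule cinner_eqI)
      fix g
      show "cinner (G x - A (A (G x))) g = cinner (\<Gamma> x) g"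
        unfolding shift_twice[symmetric] by (rule LIMSEQ_unique[OF lim K_lim])
    qed
  qed
qed

end


text \<open>A unimodular factor makes \<open>F x y\<close> real and nonnegative. Scaling
  \<open>x\<close> by \<open>norm y\<close> and \<open>y\<close> by \<open>norm x\<close> then
  equalises the two norms, so that the sum of squares on the right becomes the wanted product.
  \<open>V\<close> only has to be closed under scalars.\<close>

lemma sesquilinear_bound:
  fixes F :: "'h::complex_inner \<Rightarrow> 'h \<Rightarrow> complex"
  assumes V: "\<And>a x. x \<in> V \<Longrightarrow> a *\<^sub>C x \<in> V"
    and left: "\<And>a x y. F (a *\<^sub>C x) y = a * F x y" and right: "\<And>a x y. F x (a *\<^sub>C y) = cnj a * F x y"
    and Re: "\<And>x y. x \<in> V \<Longrightarrow> y \<in> V \<Longrightarrow> 2 * Re (F x y) \<le> c * ((norm x)\<^sup>2 + (norm y)\<^sup>2)"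
    and "x \<in> V" "y \<in> V"
  shows "cmod (F x y) \<le> c * norm x * norm y"
proof -
  have "0 \<le> c" if "x \<noteq> 0" "F x y = 0"
  proof -
    have "0 < (norm x)\<^sup>2 + (norm y)\<^sup>2"
      using that by (simp add: add_pos_nonneg)
    then show ?thesis
      using Re[OF \<open>x \<in> V\<close> \<open>y \<in> V\<close>] that by (simp add: zero_le_mult_iff)
  qed
  then consider "F x y = 0" "0 \<le> c * norm x * norm y" | "F x y \<noteq> 0" "x \<noteq> 0" "y \<noteq> 0"
    using left[of 0 0 y] right[of x 0 0] by fastforce
  then show ?thesis
  proof cases
    case 1
    then show ?thesis by simp
  next
    case 2
    define u where "u = cnj (sgn (F x y))"
    have "cmod u = 1"
      using 2 by (simp add: u_def norm_sgn)
    have "u * F x y = cmod (F x y)"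
      using 2 by (simp add: u_def sgn_eq complex_norm_square[symmetric] power2_eq_square mult.commute)
    then have "F ((u * of_real (norm y)) *\<^sub>C x) (of_real (norm x) *\<^sub>C y) =
        of_real (norm x * norm y * cmod (F x y))"
      unfolding left right by (simp add: mult_ac)
    then have "2 * (norm x * norm y * cmod (F x y)) \<le> c * ((norm y * norm x)\<^sup>2 + (norm x * norm y)\<^sup>2)"
      using Re[OF V[OF \<open>x \<in> V\<close>] V[OF \<open>y \<in> V\<close>], of "u * of_real (norm y)" "of_real (norm x)"]
      by (simp add: norm_scaleC norm_mult \<open>cmod u = 1\<close> del: of_real_mult)
    then have "(norm x * norm y) * cmod (F x y) \<le> (norm x * norm y) * (c * norm x * norm y)"
      by (simp add: power2_eq_square mult_ac)
    then show ?thesis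
      using 2 by (simp add: mult_le_cancel_left_pos)
  qed
qed

context hankel_operator
begin

text \<open>Nehari's theorem in the form of a bound on Fejer means. On pairs \<open>(f, g)\<close>, think of
  \<open>f \<oplus> g\<close> with \<open>g\<close> coanalytic: for the inner product \<open>form\<close> that has \<open>\<Gamma>\<close> as its off-diagonal part,
  \<open>(f, S g) \<mapsto> (S f, g)\<close> is isometric because \<open>\<Gamma>\<close> is Hankel. Composing it with the \<open>form\<close>-orthogonal
  projection onto its domain gives the contraction \<open>W\<close>, whose powers supply the missing
  coefficients.\<close>

lemma nehari:
  assumes half: "\<And>x. norm (\<Gamma> x) \<le> norm x / 2"
  obtains C :: "int \<Rightarrow> 'h \<Rightarrow> 'h" where "\<And>k. bounded_clinear (C k)"
    "\<And>n x. C (int n) x = \<Gamma> ((S ^^ n) x)"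
    "\<And>N w x y. cmod w = 1 \<Longrightarrow> A x = 0 \<Longrightarrow> A y = 0 \<Longrightarrow>
      cmod (\<Sum>k\<in>{- int N..int N}. of_int (int N - \<bar>k\<bar>) * (w powi k * cinner (C k x) y)) \<le>
        real N * norm x * norm y"
proof -
  define \<Gamma>' where "\<Gamma>' = cadjoint \<Gamma>"
  have \<Gamma>': "cinner (\<Gamma> x) y = cinner x (\<Gamma>' y)" "cinner (\<Gamma>' x) y = cinner x (\<Gamma> y)" for x y
    unfolding \<Gamma>'_def by (rule cinner_cadjoint_right[OF clinear_\<Gamma>] cinner_cadjoint_left[OF clinear_\<Gamma>])+
  have clinear_\<Gamma>': "bounded_clinear \<Gamma>'"
    unfolding \<Gamma>'_def by (rule bounded_clinear_cadjoint[OF clinear_\<Gamma>])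
  have half': "norm (\<Gamma>' x) \<le> norm x / 2" for x
    using norm_adjoint_le[of \<Gamma> \<Gamma>' "1/2"] \<Gamma>' half by simp
  \<comment> \<open>The projection of \<open>(f, g)\<close> onto the pairs \<open>(f', S g')\<close>
    is sought as \<open>(f + p, S q)\<close>. Orthogonality to \<open>(0, S g')\<close> gives
    \<open>q = A g - A (\<Gamma> p)\<close>; inserted into orthogonality to \<open>(f', 0)\<close>,
    this leaves \<open>p = R p + \<Gamma>' (g - S (A g))\<close>.\<close>
  define R where "R x = \<Gamma>' (S (A (\<Gamma> x)))" for x
  have R: "bounded_clinear R"
    unfolding R_def
    by (intro bounded_clinear_compose[OF clinear_\<Gamma>'] bounded_clinear_compose[OF clinear_S]
        bounded_clinear_compose[OF clinear_A] clinear_\<Gamma>)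
  have R_le: "norm (R x) \<le> norm x / 2" for x
    using half'[of "S (A (\<Gamma> x))"] norm_A_le[of "\<Gamma> x"] half[of x] norm_ge_zero[of x]
    unfolding R_def norm_S by linarith
  \<comment> \<open>The factor 1/2 in \<open>half\<close> makes \<open>R\<close> a strict
    contraction, so Banach's fixed point theorem solves the equation for \<open>p\<close>.\<close>
  have unique: "\<exists>!x. R x + v = x" for v
  proof (rule banach_fix_type[where c = "1/2"])
    show "\<forall>x y. dist (R x + v) (R y + v) \<le> 1 / 2 * dist x y"
      using R_le by (simp add: dist_norm flip: bounded_clinear_diff[OF R])
  qed auto
  define L where "L f = (THE x. R x + \<Gamma>' (f - S (A f)) = x)" for f
  have L: "R (L f) + \<Gamma>' (f - S (A f)) = L f" for f
    unfolding L_def by (rule theI'[OF unique])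
  have L_unique: "x = L f" if "R x + \<Gamma>' (f - S (A f)) = x" for x f
    using unique L that by metis
  have clinear_rest: "bounded_clinear (\<lambda>f. \<Gamma>' (f - S (A f)))"
    by (intro bounded_clinear_compose[OF clinear_\<Gamma>'] bounded_clinear_sub bounded_clinear_id
        bounded_clinear_compose[OF clinear_S] clinear_A)
  have clinear_L: "bounded_clinear L"
  proof (rule bounded_clinearI)
    show "L (f + g) = L f + L g" for f g
      by (rule L_unique[symmetric], subst bounded_clinear_add[OF R], subst bounded_clinear_add[OF clinear_rest])
        (use L[of f] L[of g] in \<open>simp add: algebra_simps\<close>)
    show "L (a *\<^sub>C f) = a *\<^sub>C L f" for a f
      by (rule L_unique[symmetric], subst bounded_clinear_scaleC[OF R], subst bounded_clinear_scaleC[OF clinear_rest])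
        (use L[of f] in \<open>simp flip: scaleC_add_right\<close>)
    show "norm (L f) \<le> 2 * norm f" for f
    proof -
      have "norm (L f) \<le> norm (R (L f)) + norm (\<Gamma>' (f - S (A f)))"
        by (subst L[of f, symmetric]) (rule norm_triangle_ineq)
      also have "\<dots> \<le> norm (L f) / 2 + norm f"
      proof (rule add_mono[OF R_le])
        have "norm (f - S (A f)) \<le> 2 * norm f"
          using norm_triangle_ineq4[of f "S (A f)"] norm_A_le[of f] by simp
        then show "norm (\<Gamma>' (f - S (A f))) \<le> norm f"
          using half'[of "f - S (A f)"] by simp
      qed
      finally show ?thesis by simp
    qed
  qed
  have L_zero: "L 0 = 0"
    by (rule bounded_clinear_zero[OF clinear_L])
  define form where "form u v = cinner (fst u) (fst v) + cinner (snd u) (snd v) +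
      cinner (\<Gamma> (fst u)) (snd v) + cinner (snd u) (\<Gamma> (fst v))" for u v :: "'h \<times> 'h"
  \<comment> \<open>\<open>L (snd u)\<close> is the correction \<open>p\<close> and the second
    component is \<open>q\<close>: the projected pair \<open>(f + p, S q)\<close> is sent to
    \<open>(S (f + p), q)\<close>.\<close>
  define W where "W u = (S (fst u + L (snd u)), A (snd u) - A (\<Gamma> (L (snd u))))" for u :: "'h \<times> 'h"
  have clinear_W: "bounded_clinear W"
    unfolding W_def
    by (intro bounded_clinear_Pair bounded_clinear_compose[OF clinear_S] bounded_clinear_plus
        bounded_clinear_sub bounded_clinear_compose[OF clinear_A] bounded_clinear_compose[OF clinear_\<Gamma>]
        bounded_clinear_compose[OF clinear_L] bounded_clinear_fst bounded_clinear_snd)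
  have form_add: "form (u + v) z = form u z + form v z" for u v z
    by (simp add: form_def cinner_add_left bounded_clinear_add[OF clinear_\<Gamma>])
  have form_scale: "form (a *\<^sub>C u) z = a * form u z" for a u z
    by (simp add: form_def cinner_scaleC_left bounded_clinear_scaleC[OF clinear_\<Gamma>] scaleC_prod_def
        algebra_simps)
  have form_commute: "form u v = cnj (form v u)" for u v
    by (simp add: form_def flip: cinner_commute)
  have form_diff_left: "form (u - v) z = form u z - form v z" for u v z
    using form_add[of "u - v" v z] by simp
  have form_diff_right: "form z (u - v) = form z u - form z v" for u v z
    by (metis form_diff_left form_commute complex_cnj_diff)
  have form_pos: "0 \<le> Re (form u u)" for u
  proof -
    have "- Re (cinner (\<Gamma> (fst u)) (snd u)) \<le> norm (\<Gamma> (fst u)) * norm (snd u)"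
      using norm_cinner_le abs_Re_le_cmod order_trans abs_le_D2 by metis
    also have "\<dots> \<le> norm (fst u) / 2 * norm (snd u)"
      by (intro mult_right_mono half) auto
    finally have "- Re (cinner (\<Gamma> (fst u)) (snd u)) \<le> norm (fst u) / 2 * norm (snd u)" .
    moreover have "Re (cinner (snd u) (\<Gamma> (fst u))) = Re (cinner (\<Gamma> (fst u)) (snd u))"
      by (subst cinner_commute) simp
    moreover have "2 * (norm (fst u) * norm (snd u)) \<le> (norm (fst u))\<^sup>2 + (norm (snd u))\<^sup>2"
      using sum_squares_bound[of "norm (fst u)" "norm (snd u)"] by simp
    moreover have "0 \<le> norm (fst u) * norm (snd u)"
      by simp
    ultimately show ?thesis
      unfolding form_def plus_complex.sel Re_cinner_self by linarith
  qed
  have form_V: "form (S f, g) (S f', g') = form (f, S g) (f', S g')" for f g f' g'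
    by (simp add: form_def isometry adjoint' flip: hankel) (simp add: adjoint)
  \<comment> \<open>By \<open>form_V\<close>, the left side pairs the projection of \<open>u\<close>
    with \<open>(f, S g)\<close>. That vector lies in the range of the projection, so
    \<open>u\<close> itself may be restored.\<close>
  have form_W: "form (W u) (S f, g) = form u (f, S g)" for u f g
  proof -
    have "cinner (L (snd u)) f = cinner (R (L (snd u)) + \<Gamma>' (snd u - S (A (snd u)))) f"
      by (simp add: L)
    then show ?thesis
      by (simp add: form_def W_def isometry adjoint' R_def \<Gamma>' cinner_add_left cinner_diff_left
          bounded_clinear_add[OF clinear_\<Gamma>] bounded_clinear_add[OF clinear_S] adjoint flip: hankel)
  qed
  have contr: "Re (form (W u) (W u)) \<le> Re (form u u)" for u
  proof -
    define p q where "p = fst u + L (snd u)" and "q = A (snd u) - A (\<Gamma> (L (snd u)))"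
    have W_eq: "W u = (S p, q)"
      by (simp add: W_def p_def q_def)
    have "form (W u) (W u) = form u (p, S q)"
      using form_W[of u p q] by (simp add: W_eq)
    moreover have "form (W u) (W u) = form (p, S q) (p, S q)"
      unfolding W_eq by (rule form_V)
    moreover have "0 \<le> Re (form (u - (p, S q)) (u - (p, S q)))"
      by (rule form_pos)
    moreover have "form (u - v) (u - v) = form u u - form u v - cnj (form u v) + form v v" for v
      using form_commute[of v u] by (simp add: form_diff_left form_diff_right)
    ultimately show ?thesis by simp
  qed
  \<comment> \<open>Pairs \<open>(x, 0)\<close> already lie in the domain of the isometry, so
    \<open>W\<close> acts on them as \<open>S\<close>.\<close>
  have W_left: "(W ^^ n) (x, 0) = ((S ^^ n) x, 0)" for n x
    by (induction n) (simp_all add: W_def L_zero bounded_clinear_zero[OF clinear_A]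
        bounded_clinear_zero[OF clinear_\<Gamma>])
  have W_right: "form ((W ^^ n) u) (0, g) = form u (0, (S ^^ n) g)" for n u g
  proof (induction n arbitrary: g)
    case (Suc n)
    have "form ((W ^^ Suc n) u) (0, g) = form ((W ^^ n) u) (0, S g)"
      using form_W[of "(W ^^ n) u" 0 g] by (simp add: bounded_clinear_zero[OF clinear_S])
    then show ?case
      using Suc by (simp add: funpow_swap1)
  qed simp
  \<comment> \<open>\<open>D n y\<close> represents the functional sending \<open>x\<close> to the
    conjugate of \<open>form ((W ^^ n) (0, y)) (x, 0)\<close>. This is the off-diagonal block
    opposite to the one that reproduces \<open>\<Gamma> S^n\<close>; its adjoint supplies the
    coefficient of index \<open>- n\<close>.\<close>
  define D where "D n y = fst ((W ^^ n) (0, y)) + \<Gamma>' (snd ((W ^^ n) (0, y)))" for n y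
  have clinear_D: "bounded_clinear (D n)" for n
  proof -
    have "bounded_clinear (\<lambda>y. (W ^^ n) (0, y))"
      by (intro bounded_clinear_compose[OF bounded_clinear_funpow[OF clinear_W]]
          bounded_clinear_Pair bounded_clinear_const_zero bounded_clinear_id)
    then show ?thesis
      unfolding D_def
      by (intro bounded_clinear_plus bounded_clinear_compose[OF bounded_clinear_fst]
          bounded_clinear_compose[OF clinear_\<Gamma>'] bounded_clinear_compose[OF bounded_clinear_snd])
  qed
  define C where "C k = (if 0 \<le> k then (\<lambda>x. \<Gamma> ((S ^^ nat k) x)) else cadjoint (D (nat (- k))))" for k :: int
  show ?thesis
  proof (rule that)
    show clinear_C: "bounded_clinear (C k)" for k
      unfolding C_def
      by (auto intro: bounded_clinear_cadjoint clinear_D bounded_clinear_compose[OF clinear_\<Gamma>]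
          bounded_clinear_funpow clinear_S)
    show "C (int n) x = \<Gamma> ((S ^^ n) x)" for n x
      by (simp add: C_def)
    fix N :: nat and w :: complex and x y
    assume w: "cmod w = 1" and x: "A x = 0" and y: "A y = 0"
    define F where "F x y = (\<Sum>k\<in>{- int N..int N}. of_int (int N - \<bar>k\<bar>) * (w powi k * cinner (C k x) y))" for x y
    have Re: "2 * Re (F x y) \<le> real N * ((norm x)\<^sup>2 + (norm y)\<^sup>2)" if x: "A x = 0" and y: "A y = 0" for x y
    proof -
      \<comment> \<open>The minus sign makes positivity of the form an upper bound for
        \<open>Re (F x y)\<close>.\<close>
      define v where "v = (x, - y)"
      define t where "t i = Re (w ^ i * form ((W ^^ i) v) v)" for i
      have pair: "(W ^^ i) v = (W ^^ i) (x, 0) - (W ^^ i) (0, y)" for i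
        using bounded_clinear_diff[OF bounded_clinear_funpow[OF clinear_W], of i "(x, 0)" "(0, y)"]
        by (simp add: v_def)
      have wpow: "cnj (w ^ i) = w powi (- int i)" for i
      proof -
        have "w * cnj w = 1"
          using w by (simp add: complex_norm_square[symmetric])
        then have "w ^ i * cnj (w ^ i) = 1"
          by (simp flip: power_mult_distrib)
        then show ?thesis
          by (simp add: power_int_minus inverse_unique)
      qed
      have t_pos: "t i = - Re (w powi int i * cinner (C (int i) x) y) - Re (w powi (- int i) * cinner (C (- int i) x) y)"
        if i: "1 \<le> i" for i
      proof -
        obtain j where j: "i = Suc j"
          using i by (cases i) auto
        \<comment> \<open>For \<open>i \<ge> 1\<close> the diagonal blocks contribute nothing, since
          the kernel of \<open>A\<close> is orthogonal to the range of \<open>S\<close>; only the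
          two off-diagonal coefficients survive.\<close>
        have orth: "cinner ((S ^^ i) a) b = 0" "cinner b ((S ^^ i) a) = 0" if "A b = 0" for a b
          using that by (simp_all add: j adjoint flip: adjoint')
        have "form ((W ^^ i) (0, y)) (x, 0) = cinner (D i y) x"
          by (simp add: form_def D_def \<Gamma>' cinner_add_left)
        also have "\<dots> = cnj (cinner (C (- int i) x) y)"
          using i by (simp add: C_def cinner_cadjoint_left[OF clinear_D] flip: cinner_commute)
        finally have "form ((W ^^ i) (0, y)) (x, 0) = cnj (cinner (C (- int i) x) y)" .
        moreover have "form ((W ^^ i) (0, y)) (0, y) = 0"
          using W_right[of i "(0, y)" y] by (simp add: form_def orth y bounded_clinear_zero[OF clinear_\<Gamma>])
        moreover have "form ((W ^^ i) (x, 0)) (x, 0) = 0"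
          by (simp add: W_left form_def orth x)
        moreover have "form ((W ^^ i) (x, 0)) (0, y) = cinner (C (int i) x) y"
          by (simp add: W_left form_def C_def)
        moreover have "form ((W ^^ i) v) v = form ((W ^^ i) (x, 0)) (x, 0) - form ((W ^^ i) (x, 0)) (0, y) -
            (form ((W ^^ i) (0, y)) (x, 0) - form ((W ^^ i) (0, y)) (0, y))"
          unfolding pair form_diff_left form_diff_right[symmetric] by (simp add: v_def)
        ultimately have "form ((W ^^ i) v) v = - cinner (C (int i) x) y - cnj (cinner (C (- int i) x) y)"
          by simp
        moreover have "Re (w ^ i * cnj z) = Re (w powi (- int i) * z)" for z
          unfolding wpow[symmetric] by (simp del: complex_cnj_power)
        ultimately show ?thesis
          by (simp add: t_def right_diff_distrib)
      qed
      have vv: "Re (form v v) = (norm x)\<^sup>2 + (norm y)\<^sup>2 - 2 * Re (cinner (C 0 x) y)"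
        using arg_cong[OF cinner_commute[of y "\<Gamma> x"], of Re]
        by (simp add: form_def v_def C_def)
      \<comment> \<open>The term \<open>i = 0\<close> on the right is twice the left side, so one
        copy of \<open>N * Re (form v v)\<close> is left over. Its \<open>\<Gamma>\<close> part
        cancels the correction that includes index 0 in \<open>F\<close>, and its diagonal part
        gives the squared norms.\<close>
      have "real N * Re (form v v) \<le> 2 * (\<Sum>i<N. real (N - i) * t i)"
        unfolding t_def
        by (rule fejer_sum_nonneg[OF form_add form_scale form_commute form_pos clinear_W contr w])
      also have "(\<Sum>i<N. real (N - i) * t i) = (\<Sum>i\<le>N. real (N - i) * t i)"
        by (simp add: lessThan_Suc_atMost[symmetric])
      also have "\<dots> = real N * Re (form v v) + (\<Sum>i=1..N. real (N - i) * t i)"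
        by (simp add: t_def atMost_atLeast0 sum.atLeast_Suc_atMost)
      also have "(\<Sum>i=1..N. real (N - i) * t i) = Re (of_nat N * cinner (C 0 x) y) - Re (F x y)"
      proof -
        have "Re (F x y) = Re (of_nat N * cinner (C 0 x) y) +
            (\<Sum>i=1..N. real (N - i) * Re (w powi int i * cinner (C (int i) x) y) +
              real (N - i) * Re (w powi (- int i) * cinner (C (- int i) x) y))"
          by (simp add: F_def sum_symmetric_interval of_nat_diff algebra_simps)
        also have "(\<Sum>i=1..N. real (N - i) * Re (w powi int i * cinner (C (int i) x) y) +
              real (N - i) * Re (w powi (- int i) * cinner (C (- int i) x) y)) =
            - (\<Sum>i=1..N. real (N - i) * t i)"
          unfolding sum_negf[symmetric] by (intro sum.cong refl) (simp add: t_pos algebra_simps)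
        finally show ?thesis by simp
      qed
      finally show ?thesis
        by (simp add: vv algebra_simps)
    qed
    have "cmod (F x y) \<le> real N * norm x * norm y"
    proof (rule sesquilinear_bound[where V = "{x. A x = 0}"])
      show "F (a *\<^sub>C x) y = a * F x y" "F x (a *\<^sub>C y) = cnj a * F x y" for a x y
        by (simp_all add: F_def sum_distrib_left bounded_clinear_scaleC[OF clinear_C]
            cinner_scaleC_left cinner_scaleC_right mult_ac)
    qed (use Re x y in \<open>auto simp: bounded_clinear_scaleC[OF clinear_A]\<close>)
    then show "cmod (\<Sum>k\<in>{- int N..int N}. of_int (int N - \<bar>k\<bar>) * (w powi k * cinner (C k x) y)) \<le>
        real N * norm x * norm y"
      by (simp add: F_def)
  qed
qed

end


section \<open>The circle\<close>

lemma measurable_circle_continuous: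
  fixes f :: "complex \<Rightarrow> 'b::topological_space"
  assumes "continuous_on (sphere 0 1) f"
  shows "f \<in> borel_measurable circle"
  using borel_measurable_continuous_on_restrict[OF assms]
  by (simp cong: measurable_cong_sets[OF sets_circle refl])

lemma measurable_circle_id [measurable]: "(\<lambda>z. z) \<in> borel_measurable circle"
  by (rule measurable_circle_continuous) (intro continuous_intros)

lemma measurable_circle_powi [measurable]: "(\<lambda>z. z powi k) \<in> borel_measurable circle"
  by (rule measurable_circle_continuous) (auto intro!: continuous_intros)

lemma measurable_cis: "cis \<in> measurable (uniform_measure lborel {0..<2 * pi}) circle"
proof -
  have "cis \<in> borel_measurable borel"
    by (intro borel_measurable_continuous_onI continuous_intros)
  then have "cis \<in> measurable (uniform_measure lborel {0..<2 * pi}) (restrict_space borel (sphere 0 1))"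
    by (intro measurable_restrict_space2) auto
  then show ?thesis
    by (simp cong: measurable_cong_sets[OF refl sets_circle])
qed

lemma circle_eq_distr: "circle = distr (uniform_measure lborel {0..<2 * pi}) circle cis"
  by (simp add: circle_def cong: distr_cong)

lemma borel_measurable_uniform_measure:
  "borel_measurable (uniform_measure lborel A) = borel_measurable lborel"
  by (intro measurable_cong_sets) simp_all

lemma nn_integral_circle:
  assumes "f \<in> borel_measurable circle"
  shows "(\<integral>\<^sup>+z. f z \<partial>circle) =
    (\<integral>\<^sup>+t. f (cis t) * indicator {0..<2 * pi} t \<partial>lborel) / ennreal (2 * pi)"
proof -
  have [measurable]: "(\<lambda>t. f (cis t)) \<in> borel_measurable lborel"
    using measurable_compose[OF measurable_cis assms] unfolding borel_measurable_uniform_measure .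
  have "(\<integral>\<^sup>+z. f z \<partial>circle) = (\<integral>\<^sup>+t. f (cis t) \<partial>uniform_measure lborel {0..<2 * pi})"
    by (subst circle_eq_distr) (rule nn_integral_distr[OF measurable_cis], use assms in simp)
  then show ?thesis
    by (simp add: nn_integral_uniform_measure)
qed

lemma measurable_circle_cnj [measurable]: "cnj \<in> measurable circle circle"
proof -
  have "cnj \<in> borel_measurable circle"
    by (rule measurable_circle_continuous) (intro continuous_intros)
  then have "cnj \<in> measurable circle (restrict_space borel (sphere 0 1))"
    by (intro measurable_restrict_space2) auto
  then show ?thesis
    by (simp cong: measurable_cong_sets[OF refl sets_circle])
qed

text \<open>Conjugation is the reflection of the angle \<open>t\<close> to
  \<open>2 * pi - t\<close>, which preserves Lebesgue measure.\<close>

lemma distr_circle_cnj: "distr circle circle cnj = circle"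
proof (rule measure_eqI)
  fix X assume "X \<in> sets (distr circle circle cnj)"
  then have X [measurable]: "X \<in> sets circle" by simp
  define g :: "real \<Rightarrow> ennreal" where "g t = indicator X (cis t)" for t
  have g [measurable]: "g \<in> borel_measurable lborel"
    unfolding g_def
    using measurable_compose[OF measurable_cis borel_measurable_indicator[OF X]]
    unfolding borel_measurable_uniform_measure .
  have "(\<integral>\<^sup>+t. g t * indicator {0..<2 * pi} t \<partial>lborel) =
      (\<integral>\<^sup>+t. g (2 * pi + (-1) * t) * indicator {0..<2 * pi} (2 * pi + (-1) * t) \<partial>lborel)"
    by (subst nn_integral_real_affine[where t = "2 * pi" and c = "-1"]) simp_all
  also have "\<dots> = (\<integral>\<^sup>+t. indicator X (cnj (cis t)) * indicator {0..<2 * pi} t \<partial>lborel)"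
  proof (rule nn_integral_cong_AE)
    \<comment> \<open>The reflected interval is half open at the other end; the two endpoints form a
      null set.\<close>
    have "AE t in lborel. t \<noteq> (0::real)" "AE t in lborel. t \<noteq> (2 * pi::real)"
      by (rule AE_lborel_singleton)+
    then show "AE t in lborel. g (2 * pi + (-1) * t) * indicator {0..<2 * pi} (2 * pi + (-1) * t) =
        indicator X (cnj (cis t)) * indicator {0..<2 * pi} t"
    proof eventually_elim
      case (elim t)
      have "cis (2 * pi + (-1) * t) = cnj (cis t)"
        by (simp add: complex_eq_iff)
      then show ?case
        using elim by (auto simp: g_def indicator_def)
    qed
  qed
  finally have "(\<integral>\<^sup>+z. indicator X (cnj z) \<partial>circle) = (\<integral>\<^sup>+z. indicator X z \<partial>circle)"
    by (subst (1 2) nn_integral_circle) (simp_all add: g_def)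
  then have "(\<integral>\<^sup>+z. indicator X z \<partial>distr circle circle cnj) = (\<integral>\<^sup>+z. indicator X z \<partial>circle)"
    by (subst nn_integral_distr) auto
  then show "emeasure (distr circle circle cnj) X = emeasure circle X"
    by simp
qed simp

lemma integral_circle_cnj:
  fixes f :: "complex \<Rightarrow> 'b::{banach, second_countable_topology}"
  assumes "f \<in> borel_measurable circle"
  shows "(LINT z|circle. f (cnj z)) = (LINT z|circle. f z)"
  using integral_distr[OF measurable_circle_cnj assms] by (simp add: distr_circle_cnj)

lemma integrable_circle_cnj:
  fixes f :: "complex \<Rightarrow> 'b::{banach, second_countable_topology}"
  assumes "integrable circle f"
  shows "integrable circle (\<lambda>z. f (cnj z))"
  using integrable_distr[OF measurable_circle_cnj, of f] assms by (simp add: distr_circle_cnj)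

lemma AE_circle_cnj:
  assumes "AE z in circle. P z"
  shows "AE z in circle. P (cnj z)"
proof -
  obtain N where N: "{z \<in> space circle. \<not> P z} \<subseteq> N" "N \<in> null_sets circle"
    using AE_E[OF assms] by (metis null_setsI)
  then have "AE z in distr circle circle cnj. z \<notin> N"
    by (simp add: distr_circle_cnj AE_not_in)
  then have "AE z in circle. cnj z \<notin> N"
    using N(2) by (subst (asm) AE_distr_iff) (auto simp: Collect_conj_eq Diff_eq[symmetric] simp del: space_circle)
  then show ?thesis
    using AE_space
  proof eventually_elim
    case (elim z)
    then have "cnj z \<in> space circle" by simp
    then show ?case using N(1) elim(1) by blast
  qed
qed

lemma integral_circle_powi: "(LINT z|circle. z powi k) = (if k = 0 then 1 else 0)"
proof (cases "k = 0")
  case True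
  have "measure circle (space circle) = 1"
    using prob_space_circle by (simp add: measure_def)
  then show ?thesis
    using True by simp
next
  case False
  define F where "F t = cis (of_int k * t) / (\<i> * of_int k)" for t :: real
  have deriv: "(F has_vector_derivative cis (of_int k * t)) (at t within X)" for t X
  proof -
    have "((\<lambda>t. exp (\<i> * of_int k * of_real t)) has_vector_derivative
        (\<i> * of_int k) * exp (\<i> * of_int k * of_real t)) (at t within X)"
      by (auto intro!: derivative_eq_intros has_vector_derivative_real_field)
    then have "((\<lambda>t. exp (\<i> * of_int k * of_real t) / (\<i> * of_int k)) has_vector_derivative
        (\<i> * of_int k) * exp (\<i> * of_int k * of_real t) / (\<i> * of_int k)) (at t within X)"
      by (rule has_vector_derivative_divide)
    moreover have "exp (\<i> * of_int k * of_real t) = cis (of_int k * t)" for t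
      by (simp add: cis_conv_exp mult_ac)
    ultimately show ?thesis
      using False by (simp add: F_def[abs_def])
  qed
  have cis_powi: "cis t powi k = cis (of_int k * t)" for t
    by (simp add: cis_power_int mult.commute)
  have "(LINT z|circle. z powi k) = (LINT t|uniform_measure lborel {0..<2 * pi}. cis (of_int k * t))"
    by (subst circle_eq_distr, subst integral_distr[OF measurable_cis]) (simp_all add: cis_powi)
  also have "\<dots> = (LINT t|lborel. (indicator {0..<2 * pi} t / (2 * pi)) *\<^sub>R cis (of_int k * t))"
  proof -
    have eq: "uniform_measure lborel {0..<2 * pi} =
        density lborel (\<lambda>t. ennreal (indicator {0..<2 * pi} t / (2 * pi)))"
      unfolding uniform_measure_def
      by (intro density_cong) (auto simp: indicator_def divide_ennreal ennreal_1[symmetric] simp del: ennreal_1)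
    have "(\<lambda>t. cis (of_int k * t)) \<in> borel_measurable lborel"
      by (simp, intro borel_measurable_continuous_onI continuous_intros)
    then show ?thesis
      unfolding eq by (subst integral_density) auto
  qed
  \<comment> \<open>Adding the null point \<open>2 * pi\<close> gives a compact interval, on which
    the fundamental theorem of calculus applies with the primitive \<open>F\<close>.\<close>
  also have "\<dots> = (1 / (2 * pi)) *\<^sub>R (LINT t|lborel. indicator {0..2 * pi} t *\<^sub>R cis (of_int k * t))"
  proof -
    have "(LINT t|lborel. (indicator {0..<2 * pi} t / (2 * pi)) *\<^sub>R cis (of_int k * t)) =
        (LINT t|lborel. (1 / (2 * pi)) *\<^sub>R (indicator {0..2 * pi} t *\<^sub>R cis (of_int k * t)))"
    proof (rule integral_cong_AE)
      have "AE t in lborel. t \<noteq> (2 * pi::real)"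
        by (rule AE_lborel_singleton)
      then show "AE t in lborel. (indicator {0..<2 * pi} t / (2 * pi)) *\<^sub>R cis (of_int k * t) =
          (1 / (2 * pi)) *\<^sub>R (indicator {0..2 * pi} t *\<^sub>R cis (of_int k * t))"
        by eventually_elim (auto simp: indicator_def)
      have [measurable]: "(\<lambda>t. cis (of_int k * t)) \<in> borel_measurable borel"
        by (intro borel_measurable_continuous_onI continuous_intros)
      show "(\<lambda>t. (indicator {0..<2 * pi} t / (2 * pi)) *\<^sub>R cis (of_int k * t)) \<in> borel_measurable lborel"
        "(\<lambda>t. (1 / (2 * pi)) *\<^sub>R (indicator {0..2 * pi} t *\<^sub>R cis (of_int k * t))) \<in> borel_measurable lborel"
        by simp_all
    qed
    then show ?thesis by (simp only: integral_scaleR_right)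
  qed
  also have "(LINT t|lborel. indicator {0..2 * pi} t *\<^sub>R cis (of_int k * t)) = F (2 * pi) - F 0"
    by (rule integral_FTC_Icc) (auto intro!: deriv continuous_intros)
  also have "F (2 * pi) - F 0 = 0"
    using cis_multiple_2pi[of "of_int k"] by (simp add: F_def mult_ac)
  finally show ?thesis
    using False by simp
qed

section \<open>Square integrable functions\<close>

lemma rep_L2_in_l2_fun: "rep_L2 F \<in> l2_fun"
  using Quotient_rep_reflp[OF Quotient_L2, of F] by (simp add: l2_eq_def)

lemma abs_rep_L2 [simp]: "abs_L2 (rep_L2 F) = F"
  by (rule Quotient_abs_rep[OF Quotient_L2])

lemma abs_L2_eqI:
  assumes "f \<in> l2_fun" "g \<in> l2_fun" "AE z in circle. f z = g z"
  shows "abs_L2 f = abs_L2 g"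
  using assms by (intro Quotient_rel_abs[OF Quotient_L2]) (simp add: l2_eq_def)

lemma rep_abs_L2:
  assumes "f \<in> l2_fun"
  shows "AE z in circle. rep_L2 (abs_L2 f) z = f z"
proof -
  have "l2_eq (rep_L2 (abs_L2 f)) f"
    using assms by (intro Quotient_rep_abs[OF Quotient_L2]) (simp add: l2_eq_def)
  then show ?thesis by (simp add: l2_eq_def)
qed

lemma L2_cases:
  obtains f where "f \<in> l2_fun" "F = abs_L2 f"
  using rep_L2_in_l2_fun abs_rep_L2 by metis

lemma l2_fun_measurable: "f \<in> l2_fun \<Longrightarrow> f \<in> borel_measurable circle"
  by (simp add: l2_fun_def)

lemma l2_fun_refl: "f \<in> l2_fun \<Longrightarrow> l2_eq f f"
  by (simp add: l2_eq_def)

lemma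
  assumes "f \<in> l2_fun" "g \<in> l2_fun"
  shows abs_L2_add: "abs_L2 (\<lambda>z. f z + g z) = abs_L2 f + abs_L2 g"
    and abs_L2_diff: "abs_L2 (\<lambda>z. f z - g z) = abs_L2 f - abs_L2 g"
    and cinner_abs_L2: "cinner (abs_L2 f) (abs_L2 g) = (LINT z|circle. cinner (f z) (g z))"
  using assms by (simp_all add: l2_fun_refl plus_L2.abs_eq minus_L2.abs_eq cinner_L2.abs_eq)

lemma abs_L2_scaleC: "f \<in> l2_fun \<Longrightarrow> abs_L2 (\<lambda>z. a *\<^sub>C f z) = a *\<^sub>C abs_L2 f"
  by (simp add: l2_fun_refl scaleC_L2.abs_eq)

lemma norm_abs_L2_power2:
  assumes "f \<in> l2_fun"
  shows "(norm (abs_L2 f))\<^sup>2 = (LINT z|circle. (norm (f z))\<^sup>2)"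
proof -
  have "(norm (abs_L2 f))\<^sup>2 = Re (cinner (abs_L2 f) (abs_L2 f))"
    by simp
  also have "cinner (abs_L2 f) (abs_L2 f) = (LINT z|circle. cinner (f z) (f z))"
    by (rule cinner_abs_L2[OF assms assms])
  also have "\<dots> = (LINT z|circle. complex_of_real ((norm (f z))\<^sup>2))"
    unfolding cinner_self ..
  also have "\<dots> = complex_of_real (LINT z|circle. (norm (f z))\<^sup>2)"
    by (rule integral_complex_of_real)
  finally show ?thesis
    by simp
qed

lemma nn_integral_norm_L2:
  assumes "f \<in> l2_fun"
  shows "(\<integral>\<^sup>+z. ennreal ((norm (f z))\<^sup>2) \<partial>circle) = ennreal ((norm (abs_L2 f))\<^sup>2)"
  unfolding norm_abs_L2_power2[OF assms]
  using assms by (intro nn_integral_eq_integral) (auto simp: l2_fun_def)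

text \<open>Cauchy-Schwarz against the constant 1, the circle having total measure 1.\<close>

lemma nn_integral_norm_le_norm_L2:
  assumes "f \<in> l2_fun"
  shows "(\<integral>\<^sup>+z. ennreal (norm (f z)) \<partial>circle) \<le> ennreal (norm (abs_L2 f))"
proof -
  have [measurable]: "f \<in> borel_measurable circle"
    using assms by (rule l2_fun_measurable)
  have "(\<integral>\<^sup>+z. ennreal (norm (f z)) * 1 \<partial>circle)\<^sup>2 \<le>
      (\<integral>\<^sup>+z. (ennreal (norm (f z)))\<^sup>2 \<partial>circle) * (\<integral>\<^sup>+z. 1\<^sup>2 \<partial>circle)"
    by (rule Cauchy_Schwarz_nn_integral) measurable
  also have "\<dots> = (ennreal (norm (abs_L2 f)))\<^sup>2"
    using nn_integral_norm_L2[OF assms] prob_space_circle by (simp add: ennreal_power)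
  finally show ?thesis
    by (cases "\<integral>\<^sup>+z. ennreal (norm (f z)) \<partial>circle" rule: ennreal_cases)
      (auto simp: ennreal_power power2_le_iff_abs_le top_unique)
qed

lemma l2_funI_bounded:
  assumes "f \<in> borel_measurable circle" "AE z in circle. norm (f z) \<le> B"
  shows "f \<in> l2_fun"
proof -
  have "AE z in circle. norm ((norm (f z))\<^sup>2) \<le> B\<^sup>2"
    using assms(2) by eventually_elim (simp add: power_mono)
  then show ?thesis
    using assms(1) by (auto simp: l2_fun_def intro!: circle.integrable_const_bound)
qed

lemma norm_abs_L2_le:
  assumes f: "f \<in> l2_fun" and g: "g \<in> l2_fun" and "AE z in circle. norm (f z) \<le> C * norm (g z)" "0 \<le> C"
  shows "norm (abs_L2 f) \<le> C * norm (abs_L2 g)"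
proof -
  have "(LINT z|circle. (norm (f z))\<^sup>2) \<le> (LINT z|circle. C\<^sup>2 * (norm (g z))\<^sup>2)"
  proof (rule integral_mono_AE)
    show "AE z in circle. (norm (f z))\<^sup>2 \<le> C\<^sup>2 * (norm (g z))\<^sup>2"
      using assms(3) by eventually_elim (metis norm_ge_zero power_mono power_mult_distrib)
  qed (use f g in \<open>auto simp: l2_fun_def\<close>)
  then have "(norm (abs_L2 f))\<^sup>2 \<le> (C * norm (abs_L2 g))\<^sup>2"
    by (simp add: norm_abs_L2_power2 f g power_mult_distrib)
  then show ?thesis
    by (rule power2_le_imp_le) (use \<open>0 \<le> C\<close> in simp)
qed

lemma norm_abs_L2_le_const:
  assumes f: "f \<in> l2_fun" and "AE z in circle. norm (f z) \<le> B" "0 \<le> B"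
  shows "norm (abs_L2 f) \<le> B"
proof -
  have "(LINT z|circle. (norm (f z))\<^sup>2) \<le> (LINT z|circle. B\<^sup>2)"
  proof (rule integral_mono_AE)
    show "AE z in circle. (norm (f z))\<^sup>2 \<le> B\<^sup>2"
      using assms(2) by eventually_elim (simp add: power_mono)
  qed (use f in \<open>auto simp: l2_fun_def\<close>)
  also have "(LINT z|circle. B\<^sup>2) = B\<^sup>2"
    using prob_space_circle by (simp add: measure_def)
  finally show ?thesis
    unfolding norm_abs_L2_power2[OF f, symmetric] using \<open>0 \<le> B\<close> by (rule power2_le_imp_le)
qed

text \<open>The increments have summable L1 norms, so by monotone convergence they are absolutely
  summable at almost every point. The offset \<open>N\<close> is there because the diagonal choice
  below controls the \<open>i\<close>-th sequence only from index \<open>i\<close> on.\<close>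

lemma AE_convergent_L2:
  fixes f :: "nat \<Rightarrow> complex \<Rightarrow> 'e::{chilbert_space, second_countable_topology}"
  assumes f: "\<And>n. f n \<in> l2_fun"
    and le: "\<And>n. N \<le> n \<Longrightarrow> norm (abs_L2 (f (Suc n)) - abs_L2 (f n)) \<le> (1 / 2) ^ n"
  shows "AE z in circle. convergent (\<lambda>n. f n z)"
proof -
  have [measurable]: "f n \<in> borel_measurable circle" for n
    by (rule l2_fun_measurable[OF f])
  define d where "d n z = norm (f (Suc (n + N)) z - f (n + N) z)" for n z
  have [measurable]: "d n \<in> borel_measurable circle" for n
    unfolding d_def by measurable
  have "(\<integral>\<^sup>+z. (\<Sum>n. ennreal (d n z)) \<partial>circle) = (\<Sum>n. \<integral>\<^sup>+z. ennreal (d n z) \<partial>circle)"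
    by (rule nn_integral_suminf) measurable
  also have "\<dots> \<le> (\<Sum>n. ennreal ((1 / 2) ^ n))"
  proof (rule suminf_le)
    show "(\<integral>\<^sup>+z. ennreal (d n z) \<partial>circle) \<le> ennreal ((1 / 2) ^ n)" for n
    proof -
      have "(\<integral>\<^sup>+z. ennreal (d n z) \<partial>circle) \<le> ennreal (norm (abs_L2 (f (Suc (n + N))) - abs_L2 (f (n + N))))"
        unfolding d_def abs_L2_diff[OF f f, symmetric]
        by (intro nn_integral_norm_le_norm_L2 l2_fun_diff f)
      also have "\<dots> \<le> ennreal ((1 / 2) ^ (n + N))"
        by (intro ennreal_leI le) simp
      also have "\<dots> \<le> ennreal ((1 / 2) ^ n)"
        by (intro ennreal_leI power_decreasing) auto
      finally show ?thesis .
    qed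
  qed auto
  also have "\<dots> = ennreal (\<Sum>n. (1 / 2) ^ n)"
    by (intro suminf_ennreal2) (auto simp: summable_geometric)
  finally have "(\<integral>\<^sup>+z. (\<Sum>n. ennreal (d n z)) \<partial>circle) \<noteq> \<infinity>"
    by (auto simp: top_unique)
  then have "AE z in circle. (\<Sum>n. ennreal (d n z)) \<noteq> \<infinity>"
    by (intro nn_integral_noteq_infinite) measurable
  then show ?thesis
  proof eventually_elim
    case (elim z)
    then have "summable (\<lambda>n. d n z)"
      by (intro summable_suminf_not_top) (auto simp: d_def)
    then have "summable (\<lambda>n. f (Suc (n + N)) z - f (n + N) z)"
      unfolding d_def by (rule summable_norm_cancel)
    then have "convergent (\<lambda>n. \<Sum>i<n. f (Suc (i + N)) z - f (i + N) z)"
      by (simp add: summable_iff_convergent)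
    also have "(\<lambda>n. \<Sum>i<n. f (Suc (i + N)) z - f (i + N) z) = (\<lambda>n. f (n + N) z - f N z)"
      using sum_lessThan_telescope[of "\<lambda>i. f (i + N) z"] by auto
    finally have "convergent (\<lambda>n. (f (n + N) z - f N z) + f N z)"
      by (intro convergent_add convergent_const)
    then show ?case
      by (simp add: convergent_ignore_initial_segment[of "\<lambda>n. f n z"])
  qed
qed

text \<open>A diagonal choice: one index sequence serves countably many Cauchy sequences, the
  \<open>i\<close>-th of them from stage \<open>i\<close> on.\<close>

lemma rapid_subsequence:
  fixes X :: "nat \<Rightarrow> nat \<Rightarrow> 'b::metric_space"
  assumes "\<And>i. Cauchy (X i)"
  obtains r :: "nat \<Rightarrow> nat" where "strict_mono r"
    "\<And>i k m n. i \<le> k \<Longrightarrow> r k \<le> m \<Longrightarrow> r k \<le> n \<Longrightarrow> dist (X i m) (X i n) < (1 / 2) ^ k"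
proof -
  have "\<exists>N. \<forall>m\<ge>N. \<forall>n\<ge>N. dist (X i m) (X i n) < (1 / 2) ^ k" for i k
    using assms by (intro metric_CauchyD) auto
  then obtain N where N: "\<And>i k m n. N i k \<le> m \<Longrightarrow> N i k \<le> n \<Longrightarrow> dist (X i m) (X i n) < (1 / 2) ^ k"
    by metis
  \<comment> \<open>The inner sum dominates every \<open>N i l\<close> with
    \<open>i \<le> l\<close>; the outer sum with \<open>Suc\<close> makes \<open>r\<close> strictly
    increasing.\<close>
  define r where "r k = (\<Sum>l\<le>k. Suc (\<Sum>i\<le>l. N i l))" for k
  show ?thesis
  proof
    show "strict_mono r"
      unfolding strict_mono_Suc_iff by (simp add: r_def)
    fix i k m n :: nat assume "i \<le> k" "r k \<le> m" "r k \<le> n"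
    have "N i k \<le> (\<Sum>i\<le>k. N i k)"
      using \<open>i \<le> k\<close> by (intro member_le_sum) auto
    also have "\<dots> \<le> Suc (\<Sum>i\<le>k. N i k)" by simp
    also have "\<dots> \<le> r k"
      unfolding r_def by (rule member_le_sum[of k "{..k}" "\<lambda>l. Suc (\<Sum>i\<le>l. N i l)"]) auto
    finally show "dist (X i m) (X i n) < (1 / 2) ^ k"
      using \<open>r k \<le> m\<close> \<open>r k \<le> n\<close> by (intro N) auto
  qed
qed

text \<open>Riesz-Fischer: a rapidly convergent subsequence has a pointwise limit almost everywhere,
  and Fatou's lemma bounds its L2 distance to the members of the subsequence. A Cauchy sequence with
  a convergent subsequence converges.\<close>

instance L2 :: ("{chilbert_space, second_countable_topology}") chilbert_space
proof
  fix X :: "nat \<Rightarrow> 'a L2"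
  assume X: "Cauchy X"
  obtain r where r: "strict_mono r"
      "\<And>k m n. r k \<le> m \<Longrightarrow> r k \<le> n \<Longrightarrow> dist (X m) (X n) < (1 / 2) ^ k"
    using rapid_subsequence[of "\<lambda>_. X", OF X] by (metis order_refl)
  define f where "f n = rep_L2 (X (r n))" for n
  have f: "f n \<in> l2_fun" and abs_f: "abs_L2 (f n) = X (r n)" for n
    by (simp_all add: f_def rep_L2_in_l2_fun)
  have [measurable]: "f n \<in> borel_measurable circle" for n
    by (rule l2_fun_measurable[OF f])
  have mono: "r k \<le> r n" if "k \<le> n" for k n
    using r(1) that by (simp add: strict_mono_less_eq)
  have "AE z in circle. convergent (\<lambda>n. f n z)"
  proof (rule AE_convergent_L2[where N = 0, OF f])
    show "norm (abs_L2 (f (Suc n)) - abs_L2 (f n)) \<le> (1 / 2) ^ n" for n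
      using r(2)[of n "r (Suc n)" "r n"] mono[of n "Suc n"] by (simp add: abs_f dist_norm)
  qed
  then have lim: "AE z in circle. (\<lambda>n. f n z) \<longlonglongrightarrow> lim (\<lambda>n. f n z)"
    by (simp add: convergent_LIMSEQ_iff)
  define g where "g z = lim (\<lambda>n. f n z)" for z
  have [measurable]: "g \<in> borel_measurable circle"
    unfolding g_def by measurable
  have bound: "(\<integral>\<^sup>+z. ennreal ((norm (g z - f k z))\<^sup>2) \<partial>circle) \<le> ennreal (((1 / 2) ^ k)\<^sup>2)" for k
  proof -
    have "(\<integral>\<^sup>+z. ennreal ((norm (g z - f k z))\<^sup>2) \<partial>circle) \<le>
        (\<integral>\<^sup>+z. liminf (\<lambda>n. ennreal ((norm (f n z - f k z))\<^sup>2)) \<partial>circle)"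
    proof (rule nn_integral_mono_AE)
      show "AE z in circle. ennreal ((norm (g z - f k z))\<^sup>2) \<le> liminf (\<lambda>n. ennreal ((norm (f n z - f k z))\<^sup>2))"
        using lim
      proof eventually_elim
        case (elim z)
        have "(\<lambda>n. ennreal ((norm (f n z - f k z))\<^sup>2)) \<longlonglongrightarrow> ennreal ((norm (g z - f k z))\<^sup>2)"
          unfolding g_def by (intro tendsto_intros elim)
        then show ?case
          by (subst lim_imp_Liminf) auto
      qed
    qed
    also have "\<dots> \<le> liminf (\<lambda>n. \<integral>\<^sup>+z. ennreal ((norm (f n z - f k z))\<^sup>2) \<partial>circle)"
      by (rule nn_integral_liminf) measurable
    also have "\<dots> \<le> ennreal (((1 / 2) ^ k)\<^sup>2)"
    proof (rule Liminf_le)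
      show "\<forall>\<^sub>F n in sequentially. (\<integral>\<^sup>+z. ennreal ((norm (f n z - f k z))\<^sup>2) \<partial>circle) \<le> ennreal (((1 / 2) ^ k)\<^sup>2)"
        using eventually_ge_at_top[of k]
      proof eventually_elim
        case (elim n)
        then show ?case
          unfolding nn_integral_norm_L2[OF l2_fun_diff[OF f f]] abs_L2_diff[OF f f] abs_f
          using r(2)[of k "r n" "r k"] mono[of k n]
          by (intro ennreal_leI power_mono) (auto simp: dist_norm)
      qed
    qed simp
    finally show ?thesis .
  qed
  have diff: "(\<lambda>z. g z - f k z) \<in> l2_fun" for k
  proof -
    have "integrable circle (\<lambda>z. (norm (g z - f k z))\<^sup>2)"
      using bound[of k] by (intro integrableI_bounded) (auto simp: less_top[symmetric] top_unique)
    then show ?thesis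
      by (simp add: l2_fun_def)
  qed
  have g: "g \<in> l2_fun"
    using l2_fun_add[OF diff[of 0] f[of 0]] by simp
  have le: "norm (abs_L2 g - X (r k)) \<le> (1 / 2) ^ k" for k
  proof (rule power2_le_imp_le)
    show "(norm (abs_L2 g - X (r k)))\<^sup>2 \<le> ((1 / 2) ^ k)\<^sup>2"
      using bound[of k] unfolding nn_integral_norm_L2[OF diff] abs_L2_diff[OF g f] abs_f
      by (subst (asm) ennreal_le_iff) auto
  qed simp
  have "(\<lambda>k. norm (X (r k) - abs_L2 g)) \<longlonglongrightarrow> 0"
  proof (rule tendsto_sandwich[of "\<lambda>_. 0" _ _ "\<lambda>k. (1 / 2 :: real) ^ k"])
    show "\<forall>\<^sub>F k in sequentially. norm (X (r k) - abs_L2 g) \<le> (1 / 2) ^ k"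
      using le[unfolded norm_minus_commute[of "abs_L2 g"]] by (rule always_eventually[OF allI])
  qed (auto intro: LIMSEQ_realpow_zero)
  then have "(X \<circ> r) \<longlonglongrightarrow> abs_L2 g"
    unfolding comp_def tendsto_norm_zero_iff by (rule LIM_zero_cancel)
  then show "convergent X"
    using Cauchy_converges_subseq[OF X r(1)] unfolding convergent_def by blast
qed


section \<open>Trigonometric series and multiplication operators\<close>

lemma norm_powi_circle: "cmod z = 1 \<Longrightarrow> cmod (z powi k) = 1"
  by (simp add: norm_power_int)

lemma cnj_circle:
  assumes "cmod z = 1"
  shows "cnj z = inverse z"
proof -
  have "z * cnj z = 1"
    using assms by (simp add: complex_norm_square[symmetric])
  then show ?thesis
    by (rule inverse_unique[symmetric])
qed

lemma powi_mult_cnj_powi: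
  assumes "cmod z = 1"
  shows "z powi k * cnj (z powi l) = z powi (k - l)"
proof -
  have "z \<noteq> 0" using assms by auto
  have "cnj (z powi l) = z powi (- l)"
    using cnj_circle[of "z powi l"] norm_powi_circle[OF assms] by (simp add: power_int_minus)
  then show ?thesis
    using \<open>z \<noteq> 0\<close> by (simp flip: power_int_add)
qed

lemma trig_in_l2_fun: "(\<lambda>z. z powi k *\<^sub>C x) \<in> l2_fun"
  by (rule l2_funI_bounded[where B = "norm x"])
    (measurable, auto intro!: AE_I2 simp: norm_scaleC norm_powi_circle)

definition trig :: "int \<Rightarrow> 'e \<Rightarrow> 'e::{complex_inner, second_countable_topology} L2" where
  "trig k x = abs_L2 (\<lambda>z. z powi k *\<^sub>C x)"

lemma cinner_trig: "cinner (trig k x) (trig l y) = (if k = l then cinner x y else 0)"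
proof -
  have "cinner (trig k x) (trig l y) = (LINT z|circle. cinner (z powi k *\<^sub>C x) (z powi l *\<^sub>C y))"
    unfolding trig_def by (rule cinner_abs_L2[OF trig_in_l2_fun trig_in_l2_fun])
  also have "\<dots> = (LINT z|circle. z powi (k - l) * cinner x y)"
  proof (rule Bochner_Integration.integral_cong[OF refl])
    fix z assume "z \<in> space circle"
    then show "cinner (z powi k *\<^sub>C x) (z powi l *\<^sub>C y) = z powi (k - l) * cinner x y"
      by (simp only: cinner_scaleC_left cinner_scaleC_right mult.assoc[symmetric]
          mult.commute[of "cnj _"] powi_mult_cnj_powi space_circle mem_sphere dist_0_norm)
  qed
  also have "\<dots> = (if k = l then cinner x y else 0)"
    by (simp add: integral_circle_powi)
  finally show ?thesis .
qed

lemma norm_trig [simp]: "norm (trig k x) = norm x"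
proof -
  have "(norm (trig k x))\<^sup>2 = (norm x)\<^sup>2"
    using arg_cong[OF cinner_trig[of k x k x], of Re] by simp
  then show ?thesis by simp
qed

lemma clinear_trig: "bounded_clinear (trig k)"
proof (rule bounded_clinearI)
  show "trig k (x + y) = trig k x + trig k y" for x y :: 'a
    unfolding trig_def abs_L2_add[OF trig_in_l2_fun trig_in_l2_fun, symmetric]
    by (simp add: scaleC_add_right)
  show "trig k (a *\<^sub>C x) = a *\<^sub>C trig k x" for a and x :: 'a
    unfolding trig_def abs_L2_scaleC[OF trig_in_l2_fun, symmetric]
    by (simp add: scaleC_scaleC mult.commute)
  show "norm (trig k x) \<le> 1 * norm x" for x :: 'a
    by simp
qed

lemma norm_sum_trig:
  assumes "finite I"
  shows "(norm (\<Sum>k\<in>I. trig k (a k)))\<^sup>2 = (\<Sum>k\<in>I. (norm (a k))\<^sup>2)"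
proof -
  have "cinner (\<Sum>k\<in>I. trig k (a k)) (\<Sum>k\<in>I. trig k (a k)) = (\<Sum>k\<in>I. cinner (a k) (a k))"
    using assms by (simp add: cinner_sum_left cinner_sum_right cinner_trig)
  from arg_cong[OF this, of Re] show ?thesis
    by simp
qed

lemma sum_trig_int:
  fixes a :: "nat \<Rightarrow> 'e::{complex_inner, second_countable_topology}"
  shows "(norm (\<Sum>n\<in>I. trig (int n) (a n)))\<^sup>2 = (\<Sum>n\<in>I. (norm (a n))\<^sup>2)"
proof (cases "finite I")
  case True
  then show ?thesis
    using norm_sum_trig[of "int ` I" "\<lambda>k. a (nat k)"] by (simp add: sum.reindex)
qed simp

lemma sum_trig_abs_L2:
  assumes "finite I"
  shows "(\<lambda>z. \<Sum>k\<in>I. z powi k *\<^sub>C a k) \<in> l2_fun \<and>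
    (\<Sum>k\<in>I. trig k (a k)) = abs_L2 (\<lambda>z. \<Sum>k\<in>I. z powi k *\<^sub>C a k)"
  using assms
proof (induction I rule: finite_induct)
  case empty
  then show ?case by (simp add: zero_L2_def l2_fun_zero)
next
  case (insert k I)
  then show ?case
    by (simp add: trig_def l2_fun_add trig_in_l2_fun abs_L2_add)
qed

lemma trig_summable:
  fixes a :: "nat \<Rightarrow> 'e::{chilbert_space, second_countable_topology}"
  assumes "summable (\<lambda>n. (norm (a n))\<^sup>2)"
  shows "summable (\<lambda>n. trig (int n) (a n))"
  unfolding summable_Cauchy
proof (intro allI impI)
  fix e :: real assume "0 < e"
  then obtain N where N: "\<And>m n. N \<le> m \<Longrightarrow> norm (\<Sum>k\<in>{m..<n}. (norm (a k))\<^sup>2) < e\<^sup>2"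
    using assms unfolding summable_Cauchy by (metis zero_less_power)
  show "\<exists>N. \<forall>m\<ge>N. \<forall>n. norm (\<Sum>k\<in>{m..<n}. trig (int k) (a k)) < e"
  proof (intro exI allI impI)
    fix m n assume "N \<le> m"
    show "norm (\<Sum>k\<in>{m..<n}. trig (int k) (a k)) < e"
    proof (rule power2_less_imp_less)
      show "(norm (\<Sum>k\<in>{m..<n}. trig (int k) (a k)))\<^sup>2 < e\<^sup>2"
        unfolding sum_trig_int using N[OF \<open>N \<le> m\<close>, of n] by (simp add: sum_nonneg)
    qed (use \<open>0 < e\<close> in simp)
  qed
qed

lemma norm_trig_series:
  fixes a :: "nat \<Rightarrow> 'e::{chilbert_space, second_countable_topology}"
  assumes "summable (\<lambda>n. (norm (a n))\<^sup>2)"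
  shows "(norm (\<Sum>n. trig (int n) (a n)))\<^sup>2 = (\<Sum>n. (norm (a n))\<^sup>2)"
proof (rule LIMSEQ_unique)
  show "(\<lambda>N. (norm (\<Sum>n<N. trig (int n) (a n)))\<^sup>2) \<longlonglongrightarrow> (norm (\<Sum>n. trig (int n) (a n)))\<^sup>2"
    by (intro tendsto_intros summable_LIMSEQ trig_summable assms)
  show "(\<lambda>N. (norm (\<Sum>n<N. trig (int n) (a n)))\<^sup>2) \<longlonglongrightarrow> (\<Sum>n. (norm (a n))\<^sup>2)"
    unfolding sum_trig_int by (rule summable_LIMSEQ[OF assms])
qed

text \<open>\<open>cadjoint (trig k) F\<close> is the \<open>k\<close>-th Fourier coefficient of
  \<open>F\<close>. For the partial sum \<open>p\<close> one has
  \<open>cinner p F = cinner p p\<close>, so Cauchy-Schwarz gives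
  \<open>norm p \<le> norm F\<close>, which is Bessel's inequality.\<close>

lemma bessel_summable:
  fixes F :: "'e::{chilbert_space, second_countable_topology} L2"
  shows "summable (\<lambda>n. (norm (cadjoint (trig (int n)) F))\<^sup>2)"
proof (rule bounded_imp_summable)
  fix N
  define p where "p = (\<Sum>n\<le>N. trig (int n) (cadjoint (trig (int n)) F))"
  have "cinner p F = (\<Sum>n\<le>N. cinner (cadjoint (trig (int n)) F) (cadjoint (trig (int n)) F))"
    unfolding p_def by (simp add: cinner_sum_left cinner_cadjoint_right[OF clinear_trig])
  from arg_cong[OF this, of Re] have "Re (cinner p F) = (norm p)\<^sup>2"
    by (simp add: p_def sum_trig_int)
  moreover have "Re (cinner p F) \<le> norm p * norm F"
    using norm_cinner_le complex_Re_le_cmod order_trans by blast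
  ultimately have "norm p * norm p \<le> norm p * norm F"
    by (simp add: power2_eq_square)
  then have "norm p \<le> norm F"
    by (cases "norm p = 0") auto
  then have "(norm p)\<^sup>2 \<le> (norm F)\<^sup>2"
    by (intro power_mono) auto
  then show "(\<Sum>n\<le>N. (norm (cadjoint (trig (int n)) F))\<^sup>2) \<le> (norm F)\<^sup>2"
    by (simp add: p_def sum_trig_int)
qed simp

text \<open>Pettis' theorem in a separable space: a norm bound is equivalent to countably many
  inequalities for inner products with a dense set, so distances to fixed points are measurable;
  every open set is a countable union of balls with centres in that set.\<close>

lemma measurable_if_weakly_measurable:
  fixes h :: "'b \<Rightarrow> 'e::{complex_inner, second_countable_topology}"
  assumes weak: "\<And>y. (\<lambda>z. cinner (h z) y) \<in> borel_measurable M"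
  shows "h \<in> borel_measurable M"
proof -
  obtain D :: "'e set" where D: "countable D" "\<And>X. open X \<Longrightarrow> X \<noteq> {} \<Longrightarrow> \<exists>d\<in>D. d \<in> X"
    using countable_dense_setE by blast
  have norm_le: "norm v \<le> r \<longleftrightarrow> (\<forall>y\<in>D. Re (cinner v y) \<le> r * norm y)" if "0 \<le> r" for v :: 'e and r
  proof
    assume "norm v \<le> r"
    show "\<forall>y\<in>D. Re (cinner v y) \<le> r * norm y"
    proof
      fix y
      have "Re (cinner v y) \<le> norm v * norm y"
        using norm_cinner_le complex_Re_le_cmod order_trans by blast
      also have "\<dots> \<le> r * norm y"
        using \<open>norm v \<le> r\<close> by (rule mult_right_mono) simp
      finally show "Re (cinner v y) \<le> r * norm y" .
    qed
  next
    assume le: "\<forall>y\<in>D. Re (cinner v y) \<le> r * norm y"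
    have "Re (cinner v y) \<le> r * norm y" for y
    proof (rule ccontr)
      assume neg: "\<not> Re (cinner v y) \<le> r * norm y"
      define X where "X = {y. r * norm y < Re (cinner v y)}"
      have "continuous_on UNIV (\<lambda>y. Re (cinner v y))"
        by (intro continuous_intros bounded_linear.continuous_on[OF
            bounded_bilinear.bounded_linear_right[OF bounded_bilinear_cinner]])
      then have "open X"
        unfolding X_def by (intro open_Collect_less) (auto intro!: continuous_intros)
      moreover have "y \<in> X"
        using neg by (simp add: X_def)
      ultimately obtain d where "d \<in> D" "d \<in> X"
        using D(2) by blast
      then show False
        using le by (fastforce simp: X_def)
    qed
    from this[of v] have "norm v * norm v \<le> r * norm v"
      by (simp add: power2_eq_square)
    then show "norm v \<le> r"
      using that by (cases "norm v = 0") auto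
  qed
  have dist [measurable]: "(\<lambda>z. dist (h z) d) \<in> borel_measurable M" for d
  proof (rule borel_measurableI_le)
    fix r :: real
    show "{z \<in> space M. dist (h z) d \<le> r} \<in> sets M"
    proof (cases "0 \<le> r")
      case True
      have "{z \<in> space M. dist (h z) d \<le> r} =
          {z \<in> space M. \<forall>y\<in>D. Re (cinner (h z) y - cinner d y) \<le> r * norm y}"
        unfolding dist_norm norm_le[OF True] cinner_diff_left ..
      also have "\<dots> \<in> sets M"
        using D(1) weak by measurable
      finally show ?thesis .
    next
      case False
      then have "{z \<in> space M. dist (h z) d \<le> r} = {}"
        using zero_le_dist order_trans by blast
      then show ?thesis by (simp only: sets.empty_sets)
    qed
  qed
  show ?thesis
  proof (rule borel_measurableI)
    fix U :: "'e set" assume "open U"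
    define I where "I = {(d, q). d \<in> D \<and> q \<in> (\<rat>::real set) \<and> ball d q \<subseteq> U}"
    have "countable I"
      by (rule countable_subset[of _ "D \<times> \<rat>"]) (auto simp: I_def D countable_rat)
    have U: "U = (\<Union>p\<in>I. ball (fst p) (snd p))"
    proof
      show "U \<subseteq> (\<Union>p\<in>I. ball (fst p) (snd p))"
      proof
        fix u assume "u \<in> U"
        then obtain e where e: "0 < e" "ball u e \<subseteq> U"
          using \<open>open U\<close> open_contains_ball by blast
        obtain q where q: "q \<in> \<rat>" "0 < q" "q < e / 2"
          using Rats_dense_in_real[of 0 "e / 2"] e(1) by auto
        obtain d where d: "d \<in> D" "dist u d < q"
          using D(2)[of "ball u q"] q(2) by auto
        have "ball d q \<subseteq> ball u e"
        proof
          fix x assume "x \<in> ball d q"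
          then show "x \<in> ball u e"
            using dist_triangle[of u x d] d(2) q(3) by simp
        qed
        with d q e show "u \<in> (\<Union>p\<in>I. ball (fst p) (snd p))"
          by (auto simp: I_def dist_commute intro!: bexI[of _ "(d, q)"])
      qed
    qed (auto simp: I_def)
    have "h -` U \<inter> space M = (\<Union>p\<in>I. {z \<in> space M. dist (h z) (fst p) < snd p})"
      by (subst U) (fastforce simp: dist_commute)
    also have "\<dots> \<in> sets M"
    proof (rule sets.countable_UN''[OF \<open>countable I\<close>])
      show "{z \<in> space M. dist (h z) (fst p) < snd p} \<in> sets M" for p
        by measurable
    qed
    finally show "h -` U \<inter> space M \<in> sets M" .
  qed
qed

section \<open>Operator-valued symbols and multiplication operators\<close>

lemma Linf_bounded_clinear: "\<Phi> \<in> Linf \<Longrightarrow> cmod z = 1 \<Longrightarrow> bounded_clinear (\<Phi> z)"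
  by (simp add: Linf_def)

lemma Linf_bound:
  assumes "\<Phi> \<in> Linf"
  obtains C where "0 \<le> C" "AE z in circle. \<forall>x. norm (\<Phi> z x) \<le> C * norm x"
proof -
  obtain C where C: "AE z in circle. onorm (\<Phi> z) \<le> C"
    using assms by (auto simp: Linf_def)
  have "AE z in circle. \<forall>x. norm (\<Phi> z x) \<le> max 0 C * norm x"
    using C AE_space
  proof eventually_elim
    case (elim z)
    show ?case
    proof
      fix x
      have "norm (\<Phi> z x) \<le> onorm (\<Phi> z) * norm x"
        using bounded_clinear_norm_le[OF Linf_bounded_clinear[OF assms]] elim by simp
      also have "\<dots> \<le> max 0 C * norm x"
        using elim by (intro mult_right_mono) auto
      finally show "norm (\<Phi> z x) \<le> max 0 C * norm x" .
    qed
  qed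
  then show ?thesis
    by (intro that[of "max 0 C"]) auto
qed

lemma LinfI:
  assumes "\<And>z. cmod z = 1 \<Longrightarrow> bounded_clinear (\<Phi> z)"
    "\<And>x y. (\<lambda>z. cinner (\<Phi> z x) y) \<in> borel_measurable circle"
    "AE z in circle. \<forall>x. norm (\<Phi> z x) \<le> C * norm x"
  shows "\<Phi> \<in> Linf"
proof -
  have "AE z in circle. onorm (\<Phi> z) \<le> max 0 C"
    using assms(3)
  proof eventually_elim
    case (elim z)
    then have "norm (\<Phi> z x) \<le> max 0 C * norm x" for x
      by (meson max.cobounded2 mult_right_mono norm_ge_zero order_trans)
    then show ?case by (intro onorm_bound) auto
  qed
  with assms show ?thesis
    by (auto simp: Linf_def)
qed


lemma Linf_measurable_const:
  fixes \<Phi> :: "complex \<Rightarrow> 'e::{chilbert_space, second_countable_topology} \<Rightarrow> 'e"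
  assumes "\<Phi> \<in> Linf"
  shows "(\<lambda>z. \<Phi> z x) \<in> borel_measurable circle"
  using assms by (intro measurable_if_weakly_measurable) (simp add: Linf_def)

text \<open>Joint measurability is reduced to constant vectors: for a simple function only finitely
  many of them occur, and the limit is taken by continuity of each \<open>\<Phi> z\<close>.\<close>

lemma Linf_measurable_apply:
  fixes \<Phi> :: "complex \<Rightarrow> 'e::{chilbert_space, second_countable_topology} \<Rightarrow> 'e"
  assumes \<Phi>: "\<Phi> \<in> Linf" and f: "f \<in> borel_measurable circle"
  shows "(\<lambda>z. \<Phi> z (f z)) \<in> borel_measurable circle"
proof -
  obtain s where s: "\<And>i. simple_function circle (s i)"
      "\<And>z. z \<in> space circle \<Longrightarrow> (\<lambda>i. s i z) \<longlonglongrightarrow> f z"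
    using borel_measurable_implies_sequence_metric[OF f, of 0] by blast
  show ?thesis
  proof (rule borel_measurable_LIMSEQ_metric)
    show "(\<lambda>z. \<Phi> z (s i z)) \<in> borel_measurable circle" for i
    proof (rule measurable_compose_countable'[where f = "\<lambda>v z. \<Phi> z v" and g = "s i" and I = "s i ` space circle"])
      show "s i \<in> measurable circle (count_space (s i ` space circle))"
        using s(1)[of i] by (subst measurable_count_space_eq2) (auto simp: simple_function_def)
      show "countable (s i ` space circle)"
        using s(1)[of i] by (auto simp: simple_function_def intro: countable_finite)
    qed (rule Linf_measurable_const[OF \<Phi>])
    show "(\<lambda>i. \<Phi> z (s i z)) \<longlonglongrightarrow> \<Phi> z (f z)" if "z \<in> space circle" for z
      using that by (intro bounded_clinear_tendsto[OF Linf_bounded_clinear[OF \<Phi>]] s(2)) auto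
  qed
qed

lemma Linf_l2_fun:
  fixes \<Phi> :: "complex \<Rightarrow> 'e::{chilbert_space, second_countable_topology} \<Rightarrow> 'e"
  assumes \<Phi>: "\<Phi> \<in> Linf" and f: "f \<in> l2_fun"
  shows "(\<lambda>z. \<Phi> z (f z)) \<in> l2_fun"
proof -
  obtain C where C: "0 \<le> C" "AE z in circle. \<forall>x. norm (\<Phi> z x) \<le> C * norm x"
    using Linf_bound[OF \<Phi>] .
  have meas [measurable]: "(\<lambda>z. \<Phi> z (f z)) \<in> borel_measurable circle"
    by (rule Linf_measurable_apply[OF \<Phi> l2_fun_measurable[OF f]])
  have "integrable circle (\<lambda>z. C\<^sup>2 * (norm (f z))\<^sup>2)"
    using f by (auto simp: l2_fun_def)
  then have "integrable circle (\<lambda>z. (norm (\<Phi> z (f z)))\<^sup>2)"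
  proof (rule Bochner_Integration.integrable_bound)
    show "AE z in circle. norm ((norm (\<Phi> z (f z)))\<^sup>2) \<le> norm (C\<^sup>2 * (norm (f z))\<^sup>2)"
      using C(2)
    proof eventually_elim
      case (elim z)
      then have "(norm (\<Phi> z (f z)))\<^sup>2 \<le> (C * norm (f z))\<^sup>2"
        by (intro power_mono) auto
      then show ?case by (simp add: power_mult_distrib)
    qed
  qed measurable
  then show ?thesis
    using meas by (simp add: l2_fun_def)
qed

lemma mult_op_abs_L2:
  assumes \<Phi>: "\<Phi> \<in> Linf" and f: "f \<in> l2_fun"
  shows "mult_op \<Phi> (abs_L2 f) = abs_L2 (\<lambda>z. \<Phi> z (f z))"
  unfolding mult_op_def
proof (rule abs_L2_eqI)
  show "AE z in circle. \<Phi> z (rep_L2 (abs_L2 f) z) = \<Phi> z (f z)"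
    using rep_abs_L2[OF f] by eventually_elim simp
qed (rule Linf_l2_fun[OF \<Phi>], rule rep_L2_in_l2_fun, rule Linf_l2_fun[OF \<Phi> f])

lemma clinear_mult_op:
  assumes \<Phi>: "\<Phi> \<in> Linf"
  shows "bounded_clinear (mult_op \<Phi>)"
proof -
  obtain C where C: "0 \<le> C" "AE z in circle. \<forall>x. norm (\<Phi> z x) \<le> C * norm x"
    using Linf_bound[OF \<Phi>] .
  show ?thesis
  proof (rule bounded_clinearI)
    fix F G :: "'a L2" and a
    obtain f g where f: "f \<in> l2_fun" "F = abs_L2 f" and g: "g \<in> l2_fun" "G = abs_L2 g"
      by (metis L2_cases)
    have "mult_op \<Phi> (F + G) = abs_L2 (\<lambda>z. \<Phi> z (f z + g z))"
      unfolding f g abs_L2_add[OF f(1) g(1), symmetric]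
      by (rule mult_op_abs_L2[OF \<Phi> l2_fun_add[OF f(1) g(1)]])
    also have "\<dots> = abs_L2 (\<lambda>z. \<Phi> z (f z) + \<Phi> z (g z))"
      by (rule abs_L2_eqI[OF Linf_l2_fun[OF \<Phi> l2_fun_add[OF f(1) g(1)]]
            l2_fun_add[OF Linf_l2_fun[OF \<Phi> f(1)] Linf_l2_fun[OF \<Phi> g(1)]] AE_I2])
        (simp add: bounded_clinear_add[OF Linf_bounded_clinear[OF \<Phi>]])
    finally show "mult_op \<Phi> (F + G) = mult_op \<Phi> F + mult_op \<Phi> G"
      by (simp add: f g mult_op_abs_L2 \<Phi> abs_L2_add Linf_l2_fun)
    have "mult_op \<Phi> (a *\<^sub>C F) = abs_L2 (\<lambda>z. \<Phi> z (a *\<^sub>C f z))"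
      unfolding f abs_L2_scaleC[OF f(1), symmetric]
      by (rule mult_op_abs_L2[OF \<Phi> l2_fun_scaleC[OF f(1)]])
    also have "\<dots> = abs_L2 (\<lambda>z. a *\<^sub>C \<Phi> z (f z))"
      by (rule abs_L2_eqI[OF Linf_l2_fun[OF \<Phi> l2_fun_scaleC[OF f(1)]]
            l2_fun_scaleC[OF Linf_l2_fun[OF \<Phi> f(1)]] AE_I2])
        (simp add: bounded_clinear_scaleC[OF Linf_bounded_clinear[OF \<Phi>]])
    finally show "mult_op \<Phi> (a *\<^sub>C F) = a *\<^sub>C mult_op \<Phi> F"
      by (simp add: f mult_op_abs_L2 \<Phi> abs_L2_scaleC Linf_l2_fun)
    show "norm (mult_op \<Phi> F) \<le> C * norm F"
      unfolding f mult_op_abs_L2[OF \<Phi> f(1)]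
    proof (rule norm_abs_L2_le)
      show "AE z in circle. norm (\<Phi> z (f z)) \<le> C * norm (f z)"
        using C(2) by eventually_elim simp
    qed (rule Linf_l2_fun[OF \<Phi> f(1)] f(1) C(1))+
  qed
qed

lemma Linf_scaleC:
  assumes \<Phi>: "\<Phi> \<in> Linf" and h [measurable]: "h \<in> borel_measurable circle"
    and B: "\<And>z. cmod z = 1 \<Longrightarrow> cmod (h z) \<le> B"
  shows "(\<lambda>z x. h z *\<^sub>C \<Phi> z x) \<in> Linf"
proof -
  obtain C where C: "0 \<le> C" "AE z in circle. \<forall>x. norm (\<Phi> z x) \<le> C * norm x"
    using Linf_bound[OF \<Phi>] .
  show ?thesis
  proof (rule LinfI)
    show "bounded_clinear (\<lambda>x. h z *\<^sub>C \<Phi> z x)" if "cmod z = 1" for z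
      by (rule bounded_clinear_scaleC_left[OF Linf_bounded_clinear[OF \<Phi> that]])
    show "(\<lambda>z. cinner (h z *\<^sub>C \<Phi> z x) y) \<in> borel_measurable circle" for x y
      using \<Phi> h by (auto simp: cinner_scaleC_left Linf_def intro!: borel_measurable_times)
    show "AE z in circle. \<forall>x. norm (h z *\<^sub>C \<Phi> z x) \<le> (B * C) * norm x"
      using C(2) AE_space
    proof eventually_elim
      case (elim z)
      show ?case
      proof
        fix x
        have "cmod (h z) * norm (\<Phi> z x) \<le> B * (C * norm x)"
          using elim B[of z] by (intro mult_mono) (auto intro: order_trans[OF norm_ge_zero])
        then show "norm (h z *\<^sub>C \<Phi> z x) \<le> (B * C) * norm x"
          by (simp add: norm_scaleC mult.assoc)
      qed
    qed
  qed
qed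

lemma Linf_diff:
  assumes \<Phi>: "\<Phi> \<in> Linf" and \<Psi>: "\<Psi> \<in> Linf"
  shows "(\<lambda>z x. \<Phi> z x - \<Psi> z x) \<in> Linf"
proof -
  obtain C where C: "0 \<le> C" "AE z in circle. \<forall>x. norm (\<Phi> z x) \<le> C * norm x"
    using Linf_bound[OF \<Phi>] .
  obtain D where D: "0 \<le> D" "AE z in circle. \<forall>x. norm (\<Psi> z x) \<le> D * norm x"
    using Linf_bound[OF \<Psi>] .
  show ?thesis
  proof (rule LinfI)
    show "bounded_clinear (\<lambda>x. \<Phi> z x - \<Psi> z x)" if "cmod z = 1" for z
      by (intro bounded_clinear_sub Linf_bounded_clinear \<Phi> \<Psi> that)
    show "(\<lambda>z. cinner (\<Phi> z x - \<Psi> z x) y) \<in> borel_measurable circle" for x y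
      using \<Phi> \<Psi> by (auto simp: cinner_diff_left Linf_def intro!: borel_measurable_diff)
    show "AE z in circle. \<forall>x. norm (\<Phi> z x - \<Psi> z x) \<le> (C + D) * norm x"
      using C(2) D(2)
    proof eventually_elim
      case (elim z)
      show ?case
      proof
        fix x
        show "norm (\<Phi> z x - \<Psi> z x) \<le> (C + D) * norm x"
          using norm_triangle_ineq4[of "\<Phi> z x" "\<Psi> z x"] elim by (simp add: distrib_right) (metis add_mono order_trans)
      qed
    qed
  qed
qed

lemma Linf_id: "(\<lambda>z x. x) \<in> Linf"
  by (rule LinfI[where C = 1]) (auto intro: bounded_clinear_id)

lemma Linf_circle_id: "(\<lambda>z x. z *\<^sub>C x) \<in> Linf"
  by (rule Linf_scaleC[OF Linf_id, of "\<lambda>z. z" 1]) auto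

lemma measurable_circle_cnj' [measurable]: "cnj \<in> borel_measurable circle"
  by (rule measurable_circle_continuous) (intro continuous_intros)

lemma Linf_circle_cnj: "(\<lambda>z x. cnj z *\<^sub>C x) \<in> Linf"
  by (rule Linf_scaleC[OF Linf_id, of cnj 1]) auto

abbreviation mult_z :: "'e L2 \<Rightarrow> 'e::{chilbert_space, second_countable_topology} L2" where
  "mult_z \<equiv> mult_op (\<lambda>z x. z *\<^sub>C x)"

abbreviation mult_cnj_z :: "'e L2 \<Rightarrow> 'e::{chilbert_space, second_countable_topology} L2" where
  "mult_cnj_z \<equiv> mult_op (\<lambda>z x. cnj z *\<^sub>C x)"

lemma circle_mult_cnj: "cmod z = 1 \<Longrightarrow> z * cnj z = 1" "cmod z = 1 \<Longrightarrow> cnj z * z = 1"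
  using complex_norm_square[of z] by (simp_all add: mult.commute)

lemma mult_op_commute_AE:
  assumes \<Phi>: "\<Phi> \<in> Linf" and \<Psi>: "\<Psi> \<in> Linf"
    and "\<And>z x. cmod z = 1 \<Longrightarrow> \<Phi> z (\<Psi> z x) = \<Psi> z (\<Phi> z x)"
  shows "mult_op \<Phi> (mult_op \<Psi> F) = mult_op \<Psi> (mult_op \<Phi> F)"
proof -
  obtain f where f: "f \<in> l2_fun" "F = abs_L2 f" by (rule L2_cases)
  show ?thesis
    unfolding f mult_op_abs_L2[OF \<Phi> f(1)] mult_op_abs_L2[OF \<Psi> f(1)]
      mult_op_abs_L2[OF \<Phi> Linf_l2_fun[OF \<Psi> f(1)]] mult_op_abs_L2[OF \<Psi> Linf_l2_fun[OF \<Phi> f(1)]]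
    by (rule abs_L2_eqI[OF Linf_l2_fun[OF \<Phi> Linf_l2_fun[OF \<Psi> f(1)]]
          Linf_l2_fun[OF \<Psi> Linf_l2_fun[OF \<Phi> f(1)]] AE_I2]) (simp add: assms)
qed

lemma mult_z_commute:
  assumes "\<Phi> \<in> Linf"
  shows "mult_op \<Phi> (mult_z F) = mult_z (mult_op \<Phi> F)"
    and "mult_op \<Phi> (mult_cnj_z F) = mult_cnj_z (mult_op \<Phi> F)"
  by (rule mult_op_commute_AE; simp add: assms Linf_circle_id Linf_circle_cnj
      bounded_clinear_scaleC[OF Linf_bounded_clinear[OF assms]])+

lemma mult_z_inverse [simp]:
  "mult_z (mult_cnj_z F) = F" "mult_cnj_z (mult_z F) = F"
proof -
  obtain f where f: "f \<in> l2_fun" "F = abs_L2 f" by (rule L2_cases)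
  show "mult_z (mult_cnj_z F) = F"
    unfolding f mult_op_abs_L2[OF Linf_circle_cnj f(1)]
      mult_op_abs_L2[OF Linf_circle_id Linf_l2_fun[OF Linf_circle_cnj f(1)]]
    by (rule abs_L2_eqI[OF Linf_l2_fun[OF Linf_circle_id Linf_l2_fun[OF Linf_circle_cnj f(1)]] f(1) AE_I2])
      (simp add: scaleC_scaleC circle_mult_cnj)
  show "mult_cnj_z (mult_z F) = F"
    unfolding f mult_op_abs_L2[OF Linf_circle_id f(1)]
      mult_op_abs_L2[OF Linf_circle_cnj Linf_l2_fun[OF Linf_circle_id f(1)]]
    by (rule abs_L2_eqI[OF Linf_l2_fun[OF Linf_circle_cnj Linf_l2_fun[OF Linf_circle_id f(1)]] f(1) AE_I2])
      (simp add: scaleC_scaleC circle_mult_cnj)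
qed

lemma cinner_mult_z: "cinner (mult_z F) G = cinner F (mult_cnj_z G)"
proof -
  obtain f g where f: "f \<in> l2_fun" "F = abs_L2 f" and g: "g \<in> l2_fun" "G = abs_L2 g"
    by (metis L2_cases)
  show ?thesis
    unfolding f g mult_op_abs_L2[OF Linf_circle_id f(1)] mult_op_abs_L2[OF Linf_circle_cnj g(1)]
      cinner_abs_L2[OF Linf_l2_fun[OF Linf_circle_id f(1)] g(1)]
      cinner_abs_L2[OF f(1) Linf_l2_fun[OF Linf_circle_cnj g(1)]]
    by (simp add: cinner_scaleC_left cinner_scaleC_right)
qed

lemma cinner_mult_cnj_z: "cinner (mult_cnj_z F) G = cinner F (mult_z G)"
  by (metis cinner_mult_z mult_z_inverse)

lemma mult_z_trig: "mult_z (trig k x) = trig (k + 1) x"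
  unfolding trig_def mult_op_abs_L2[OF Linf_circle_id trig_in_l2_fun]
proof (rule abs_L2_eqI[OF Linf_l2_fun[OF Linf_circle_id trig_in_l2_fun] trig_in_l2_fun AE_I2])
  fix z :: complex assume "z \<in> space circle"
  then have "z \<noteq> 0" by auto
  then show "z *\<^sub>C z powi k *\<^sub>C x = z powi (k + 1) *\<^sub>C x"
    by (simp add: scaleC_scaleC power_int_add mult.commute)
qed

section \<open>The flip and Fourier coefficients\<close>

lemma flip_abs_L2:
  fixes f :: "complex \<Rightarrow> 'e::{chilbert_space, second_countable_topology}"
  assumes f: "f \<in> l2_fun"
  shows "(\<lambda>z. f (cnj z)) \<in> l2_fun" "flip (abs_L2 f) = abs_L2 (\<lambda>z. f (cnj z))"
proof -
  have l2: "(\<lambda>z. h (cnj z)) \<in> l2_fun" if "h \<in> l2_fun" for h :: "complex \<Rightarrow> 'e"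
    using that measurable_compose[OF measurable_circle_cnj, of h borel]
      integrable_circle_cnj[of "\<lambda>z. (norm (h z))\<^sup>2"]
    by (simp add: l2_fun_def)
  then show "(\<lambda>z. f (cnj z)) \<in> l2_fun"
    using f .
  show "flip (abs_L2 f) = abs_L2 (\<lambda>z. f (cnj z))"
    unfolding flip_def
    by (rule abs_L2_eqI[OF l2[OF rep_L2_in_l2_fun] l2[OF f] AE_circle_cnj[OF rep_abs_L2[OF f]]])
qed

lemma flip_flip [simp]: "flip (flip F) = F"
proof -
  obtain f where f: "f \<in> l2_fun" "F = abs_L2 f" by (rule L2_cases)
  show ?thesis
    by (simp add: f flip_abs_L2)
qed

lemma cinner_flip: "cinner (flip F) G = cinner F (flip G)"
proof -
  obtain f g where f: "f \<in> l2_fun" "F = abs_L2 f" and g: "g \<in> l2_fun" "G = abs_L2 g"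
    by (metis L2_cases)
  have [measurable]: "f \<in> borel_measurable circle" "(\<lambda>z. g (cnj z)) \<in> borel_measurable circle"
    by (rule l2_fun_measurable f flip_abs_L2(1)[OF g(1)])+
  show ?thesis
    unfolding f g flip_abs_L2(2)[OF f(1)] flip_abs_L2(2)[OF g(1)]
      cinner_abs_L2[OF flip_abs_L2(1)[OF f(1)] g(1)] cinner_abs_L2[OF f(1) flip_abs_L2(1)[OF g(1)]]
    using integral_circle_cnj[of "\<lambda>z. cinner (f z) (g (cnj z))"] by simp
qed

lemma clinear_flip: "bounded_clinear (flip :: 'e::{chilbert_space, second_countable_topology} L2 \<Rightarrow> 'e L2)"
proof (rule bounded_clinearI)
  fix F G :: "'e L2" and a
  show "flip (F + G) = flip F + flip G" "flip (a *\<^sub>C F) = a *\<^sub>C flip F"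
    by (rule cinner_eqI; simp add: cinner_flip cinner_add_left cinner_scaleC_left)+
  have "cinner (flip F) (flip F) = cinner F F"
    by (simp add: cinner_flip)
  from arg_cong[OF this, of Re] show "norm (flip F) \<le> 1 * norm F"
    by simp
qed

lemma flip_mult_z: "flip (mult_z F) = mult_cnj_z (flip F)" "flip (mult_cnj_z F) = mult_z (flip F)"
proof -
  obtain f where f: "f \<in> l2_fun" "F = abs_L2 f" by (rule L2_cases)
  show "flip (mult_z F) = mult_cnj_z (flip F)" "flip (mult_cnj_z F) = mult_z (flip F)"
    unfolding f by (simp_all add: f mult_op_abs_L2 Linf_circle_id Linf_circle_cnj flip_abs_L2
        Linf_l2_fun[OF Linf_circle_id] Linf_l2_fun[OF Linf_circle_cnj])
qed

lemma flip_trig: "flip (trig k x) = trig (- k) x"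
  unfolding trig_def flip_abs_L2(2)[OF trig_in_l2_fun]
proof (rule abs_L2_eqI[OF flip_abs_L2(1)[OF trig_in_l2_fun] trig_in_l2_fun AE_I2])
  fix z :: complex assume "z \<in> space circle"
  then show "cnj z powi k *\<^sub>C x = z powi (- k) *\<^sub>C x"
    using cnj_circle[of z] by (simp add: power_int_minus power_int_inverse)
qed

lemma l2_fun_integrable:
  fixes f :: "complex \<Rightarrow> 'e::{chilbert_space, second_countable_topology}"
  assumes f: "f \<in> l2_fun"
  shows "integrable circle f"
proof (rule Bochner_Integration.integrable_bound[where f = "\<lambda>z. 1 + (norm (f z))\<^sup>2"])
  show "integrable circle (\<lambda>z. 1 + (norm (f z))\<^sup>2)"
    using f by (simp add: l2_fun_def)
  have "norm (f z) \<le> 1 + (norm (f z))\<^sup>2" for z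
    using sum_squares_bound[of "norm (f z)" 1] norm_ge_zero[of "f z"]
    unfolding power_one mult_1_right by linarith
  then show "AE z in circle. norm (f z) \<le> norm (1 + (norm (f z))\<^sup>2)"
    by simp
qed (rule l2_fun_measurable[OF f])

lemma integrable_fourier:
  fixes \<Phi> :: "complex \<Rightarrow> 'e::{chilbert_space, second_countable_topology} \<Rightarrow> 'e"
  assumes \<Phi>: "\<Phi> \<in> Linf"
  shows "integrable circle (\<lambda>z. z powi n *\<^sub>C \<Phi> z x)"
proof -
  have "integrable circle (\<lambda>z. \<Phi> z (z powi n *\<^sub>C x))"
    by (rule l2_fun_integrable[OF Linf_l2_fun[OF \<Phi> trig_in_l2_fun]])
  also have "?this \<longleftrightarrow> ?thesis"
    by (rule Bochner_Integration.integrable_cong)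
      (simp_all add: bounded_clinear_scaleC[OF Linf_bounded_clinear[OF \<Phi>]])
  finally show ?thesis .
qed

text \<open>Multiplication operators have matrices that are constant along diagonals. This is the
  link through which symbols and operators are compared.\<close>

lemma cinner_mult_op_trig:
  assumes \<Phi>: "\<Phi> \<in> Linf"
  shows "cinner (mult_op \<Phi> (trig k x)) (trig l y) = cinner (fourier_coeff \<Phi> (l - k) x) y"
proof -
  have "cinner (mult_op \<Phi> (trig k x)) (trig l y) =
      (LINT z|circle. cinner (\<Phi> z (z powi k *\<^sub>C x)) (z powi l *\<^sub>C y))"
    unfolding trig_def mult_op_abs_L2[OF \<Phi> trig_in_l2_fun]
    by (rule cinner_abs_L2[OF Linf_l2_fun[OF \<Phi> trig_in_l2_fun] trig_in_l2_fun])
  also have "\<dots> = (LINT z|circle. cinner (z powi (- (l - k)) *\<^sub>C \<Phi> z x) y)"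
  proof (rule Bochner_Integration.integral_cong[OF refl])
    fix z assume "z \<in> space circle"
    then have z: "cmod z = 1" by simp
    have "cinner (\<Phi> z (z powi k *\<^sub>C x)) (z powi l *\<^sub>C y) =
        (z powi k * cnj (z powi l)) * cinner (\<Phi> z x) y"
      unfolding bounded_clinear_scaleC[OF Linf_bounded_clinear[OF \<Phi> z]] cinner_scaleC_left
        cinner_scaleC_right by (simp only: mult_ac)
    also have "z powi k * cnj (z powi l) = z powi (- (l - k))"
      unfolding powi_mult_cnj_powi[OF z] by simp
    finally show "cinner (\<Phi> z (z powi k *\<^sub>C x)) (z powi l *\<^sub>C y) =
        cinner (z powi (- (l - k)) *\<^sub>C \<Phi> z x) y"
      by (simp only: cinner_scaleC_left)
  qed
  also have "\<dots> = cinner (fourier_coeff \<Phi> (l - k) x) y"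
    unfolding fourier_coeff_def
    by (rule integral_bounded_linear[OF bounded_bilinear.bounded_linear_left[OF bounded_bilinear_cinner]
          integrable_fourier[OF \<Phi>]])
  finally show ?thesis .
qed


section \<open>The Hardy space and the shift\<close>

lemma bounded_clinear_sums: "bounded_clinear T \<Longrightarrow> f sums s \<Longrightarrow> (\<lambda>n. T (f n)) sums T s"
  by (rule bounded_linear.sums) (auto simp: bounded_clinear_def)

lemma hardy_coefficients_summable:
  fixes a :: "nat \<Rightarrow> 'e::chilbert_space"
  assumes a: "\<And>n. norm (a n) \<le> C" and w: "cmod w < 1"
  shows "summable (\<lambda>n. w ^ n *\<^sub>C a n)"
    and "norm ((\<Sum>n. w ^ n *\<^sub>C a n) - (\<Sum>n<N. w ^ n *\<^sub>C a n)) \<le> C / (1 - cmod w) * cmod w ^ N"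
proof -
  have le: "norm (w ^ n *\<^sub>C a n) \<le> C * cmod w ^ n" for n
    using mult_right_mono[OF a[of n], of "cmod w ^ n"] by (simp add: norm_scaleC norm_power mult.commute)
  have geom: "summable (\<lambda>n. C * cmod w ^ n)"
    using w by (intro summable_mult summable_geometric) simp
  show summ: "summable (\<lambda>n. w ^ n *\<^sub>C a n)"
    by (rule summable_comparison_test'[OF geom, of 0]) (use le in auto)
  have "(\<Sum>n. w ^ n *\<^sub>C a n) - (\<Sum>n<N. w ^ n *\<^sub>C a n) = (\<Sum>n. w ^ (n + N) *\<^sub>C a (n + N))"
    using suminf_split_initial_segment[OF summ, of N] by simp
  also have "norm \<dots> \<le> (\<Sum>n. C * cmod w ^ N * cmod w ^ n)"
  proof (rule norm_suminf_le)
    show "norm (w ^ (n + N) *\<^sub>C a (n + N)) \<le> C * cmod w ^ N * cmod w ^ n" for n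
      using le[of "n + N"] by (simp add: power_add mult_ac)
    show "summable (\<lambda>n. C * cmod w ^ N * cmod w ^ n)"
      using w by (intro summable_mult summable_geometric) simp
  qed
  also have "\<dots> = C / (1 - cmod w) * cmod w ^ N"
    using w by (simp add: suminf_mult suminf_geometric summable_geometric)
  finally show "norm ((\<Sum>n. w ^ n *\<^sub>C a n) - (\<Sum>n<N. w ^ n *\<^sub>C a n)) \<le> C / (1 - cmod w) * cmod w ^ N" .
qed

text \<open>For fixed \<open>r < 1\<close> the partial sums converge uniformly on the circle at a
  geometric rate, hence in L2.\<close>

lemma dilate_sums:
  fixes a :: "nat \<Rightarrow> 'e::{chilbert_space, second_countable_topology}"
  assumes F: "F \<in> hardy_disc" and a: "\<And>n. norm (a n) \<le> C"
    and sums: "\<And>w. cmod w < 1 \<Longrightarrow> (\<lambda>n. w ^ n *\<^sub>C a n) sums F w" and r: "0 \<le> r" "r < 1"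
  shows "(\<lambda>n. trig (int n) (r ^ n *\<^sub>R a n)) sums dilate F r"
proof -
  have "0 \<le> C"
    using a[of 0] norm_ge_zero order_trans by blast
  have F_l2: "(\<lambda>z. F (of_real r * z)) \<in> l2_fun"
    by (rule hardy_disc_dilate[OF F r])
  have le: "norm ((\<Sum>n<N. trig (int n) (r ^ n *\<^sub>R a n)) - dilate F r) \<le> C / (1 - r) * r ^ N" for N
  proof -
    define p where "p z = (\<Sum>n<N. z powi int n *\<^sub>C r ^ n *\<^sub>R a n)" for z
    have p: "p \<in> l2_fun" "(\<Sum>n<N. trig (int n) (r ^ n *\<^sub>R a n)) = abs_L2 p"
      using sum_trig_abs_L2[of "int ` {..<N}" "\<lambda>k. r ^ nat k *\<^sub>R a (nat k)"]
      by (simp_all add: p_def[abs_def] sum.reindex)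
    have "norm (abs_L2 (\<lambda>z. p z - F (of_real r * z))) \<le> C / (1 - r) * r ^ N"
    proof (rule norm_abs_L2_le_const[OF l2_fun_diff[OF p(1) F_l2] AE_I2])
      fix z assume "z \<in> space circle"
      then have w: "cmod (of_real r * z) = r" "cmod (of_real r * z) < 1"
        using r by (simp_all add: norm_mult)
      have "p z = (\<Sum>n<N. (of_real r * z) ^ n *\<^sub>C a n)"
        by (simp add: p_def power_mult_distrib scaleC_scaleC mult.commute flip: scaleC_of_real)
      then show "norm (p z - F (of_real r * z)) \<le> C / (1 - r) * r ^ N"
        using hardy_coefficients_summable(2)[OF a w(2), where N = N] sums_unique[OF sums[OF w(2)]] w(1)
        by (simp add: norm_minus_commute)
    qed (use \<open>0 \<le> C\<close> r in simp)
    then show ?thesis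
      unfolding p(2) dilate_def abs_L2_diff[OF p(1) F_l2] .
  qed
  have "(\<lambda>N. norm ((\<Sum>n<N. trig (int n) (r ^ n *\<^sub>R a n)) - dilate F r)) \<longlonglongrightarrow> 0"
  proof (rule tendsto_sandwich[of "\<lambda>_. 0"])
    show "(\<lambda>N. C / (1 - r) * r ^ N) \<longlonglongrightarrow> 0"
      using r by (intro tendsto_mult_right_zero LIMSEQ_realpow_zero)
  qed (use le in auto)
  then show ?thesis
    unfolding sums_def tendsto_norm_zero_iff by (rule LIM_zero_cancel)
qed

lemma square_summable_bounded:
  fixes a :: "nat \<Rightarrow> 'e::real_normed_vector"
  assumes "summable (\<lambda>n. (norm (a n))\<^sup>2)"
  obtains C where "\<And>n. norm (a n) \<le> C"
proof -
  have "(\<lambda>n. norm (a n)) \<longlonglongrightarrow> 0"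
    using tendsto_real_sqrt[OF summable_LIMSEQ_zero[OF assms]] by simp
  then have "Bseq (\<lambda>n. norm (a n))"
    by (intro convergent_imp_Bseq convergentI)
  then show ?thesis
    using that by (auto simp: Bseq_def)
qed

text \<open>By orthogonality the squared distance between the series and the dilate is the sum of
  \<open>(1 - r^n)^2 * norm (a n)^2\<close>. Each term tends to 0 and is dominated by
  \<open>norm (a n)^2\<close>, so Tannery's theorem applies.\<close>

lemma boundary_value_series:
  fixes a :: "nat \<Rightarrow> 'e::{chilbert_space, second_countable_topology}"
  assumes F: "F \<in> hardy_disc" and a: "summable (\<lambda>n. (norm (a n))\<^sup>2)"
    and sums: "\<And>w. cmod w < 1 \<Longrightarrow> (\<lambda>n. w ^ n *\<^sub>C a n) sums F w"
  shows "boundary_value F (\<Sum>n. trig (int n) (a n))"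
proof -
  obtain C where C: "\<And>n. norm (a n) \<le> C"
    by (rule square_summable_bounded[OF a]) blast
  define f where "f = (\<Sum>n. trig (int n) (a n))"
  have f: "(\<lambda>n. trig (int n) (a n)) sums f"
    unfolding f_def by (rule summable_sums[OF trig_summable[OF a]])
  have norm: "(norm (f - dilate F r))\<^sup>2 = (\<Sum>n. (1 - r ^ n)\<^sup>2 * (norm (a n))\<^sup>2)" if r: "0 \<le> r" "r < 1" for r
  proof -
    have eq: "trig (int n) (a n) - trig (int n) (r ^ n *\<^sub>R a n) = trig (int n) ((1 - r ^ n) *\<^sub>R a n)" for n
      by (simp add: scaleR_left_diff_distrib flip: bounded_clinear_diff[OF clinear_trig])
    have "(\<lambda>n. trig (int n) ((1 - r ^ n) *\<^sub>R a n)) sums (f - dilate F r)"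
      using sums_diff[OF f dilate_sums[OF F C sums r]] by (simp add: eq)
    then have "f - dilate F r = (\<Sum>n. trig (int n) ((1 - r ^ n) *\<^sub>R a n))"
      by (rule sums_unique)
    moreover have "summable (\<lambda>n. (norm ((1 - r ^ n) *\<^sub>R a n))\<^sup>2)"
    proof (rule summable_comparison_test'[OF a, of 0])
      show "norm ((norm ((1 - r ^ n) *\<^sub>R a n))\<^sup>2) \<le> (norm (a n))\<^sup>2" for n
        using r mult_right_mono[of "(1 - r ^ n)\<^sup>2" 1 "(norm (a n))\<^sup>2"] power_le_one[of "1 - r ^ n" 2]
          power_le_one[of r n]
        by (simp add: power_mult_distrib)
    qed
    ultimately show ?thesis
      by (simp add: norm_trig_series power_mult_distrib)
  qed
  have "((\<lambda>r. \<Sum>n. (1 - r ^ n)\<^sup>2 * (norm (a n))\<^sup>2) \<longlongrightarrow> (\<Sum>n. (1 - 1 ^ n)\<^sup>2 * (norm (a n))\<^sup>2)) (at_left 1)"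
  proof -
    have "((\<lambda>r. (1 - r ^ n)\<^sup>2 * (norm (a n))\<^sup>2) \<longlongrightarrow> (1 - 1 ^ n)\<^sup>2 * (norm (a n))\<^sup>2) (at_left 1)" for n :: nat
      by (intro tendsto_intros)
    moreover have "\<forall>\<^sub>F (n, r) in at_top \<times>\<^sub>F at_left 1. norm ((1 - r ^ n)\<^sup>2 * (norm (a n))\<^sup>2) \<le> (norm (a n))\<^sup>2"
    proof -
      have "\<forall>\<^sub>F (n::nat, r) in at_top \<times>\<^sub>F at_left (1::real). 0 \<le> r \<and> r < 1"
        using eventually_at_left_1 by (subst eventually_prod2) auto
      then show ?thesis
        unfolding case_prod_beta
      proof eventually_elim
        case (elim p)
        then have "(1 - snd p ^ fst p)\<^sup>2 \<le> 1"
          by (intro power_le_one) (auto simp: power_le_one)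
        then show ?case
          using mult_right_mono[of "(1 - snd p ^ fst p)\<^sup>2" 1 "(norm (a (fst p)))\<^sup>2"] by simp
      qed
    qed
    ultimately show ?thesis
      using a by (intro tannerys_theorem[THEN conjunct2, THEN conjunct2]) (auto simp: trivial_limit_at_left_real)
  qed
  then have "((\<lambda>r. \<Sum>n. (1 - r ^ n)\<^sup>2 * (norm (a n))\<^sup>2) \<longlongrightarrow> 0) (at_left 1)"
    by simp
  moreover have "\<forall>\<^sub>F r in at_left 1. (\<Sum>n. (1 - r ^ n)\<^sup>2 * (norm (a n))\<^sup>2) = (norm (f - dilate F r))\<^sup>2"
    using eventually_at_left_1 by eventually_elim (simp add: norm)
  ultimately have "((\<lambda>r. (norm (f - dilate F r))\<^sup>2) \<longlongrightarrow> 0) (at_left 1)"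
    by (rule Lim_transform_eventually)
  then have "((\<lambda>r. sqrt ((norm (f - dilate F r))\<^sup>2)) \<longlongrightarrow> sqrt 0) (at_left 1)"
    by (rule tendsto_real_sqrt)
  then have "((\<lambda>r. f - dilate F r) \<longlongrightarrow> 0) (at_left 1)"
    by (simp add: tendsto_norm_zero_iff)
  from tendsto_diff[OF tendsto_const[of f] this] show ?thesis
    by (simp add: boundary_value_def f_def)
qed

lemma hardy_space_series:
  fixes a :: "nat \<Rightarrow> 'e::{chilbert_space, second_countable_topology}"
  assumes a: "summable (\<lambda>n. (norm (a n))\<^sup>2)"
  shows "(\<Sum>n. trig (int n) (a n)) \<in> hardy_space"
proof -
  obtain C where C: "\<And>n. norm (a n) \<le> C"
    by (rule square_summable_bounded[OF a]) blast
  define F where "F w = (\<Sum>n. w ^ n *\<^sub>C a n)" for w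
  have sums: "(\<lambda>n. w ^ n *\<^sub>C a n) sums F w" if "cmod w < 1" for w
    unfolding F_def by (rule summable_sums[OF hardy_coefficients_summable(1)[OF C that]])
  then have F: "F \<in> hardy_disc"
    using a by (auto simp: hardy_disc_def)
  have "boundary_value F (\<Sum>n. trig (int n) (a n))"
    by (rule boundary_value_series[OF F a sums])
  with F show ?thesis
    by (auto simp: hardy_space_def)
qed

text \<open>Boundary values are unique as limits, so they must be the series just found. Functions
  on the disc are henceforth replaced by trigonometric series with nonnegative exponents.\<close>

lemma hardy_space_sums:
  fixes f :: "'e::{chilbert_space, second_countable_topology} L2"
  assumes "f \<in> hardy_space"
  obtains a where "summable (\<lambda>n. (norm (a n))\<^sup>2)" "(\<lambda>n. trig (int n) (a n)) sums f"
proof -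
  obtain F where F: "F \<in> hardy_disc" "boundary_value F f"
    using assms by (auto simp: hardy_space_def)
  then obtain a where a: "summable (\<lambda>n. (norm (a n))\<^sup>2)" "\<And>w. cmod w < 1 \<Longrightarrow> (\<lambda>n. w ^ n *\<^sub>C a n) sums F w"
    by (auto simp: hardy_disc_def)
  have "boundary_value F (\<Sum>n. trig (int n) (a n))"
    by (rule boundary_value_series[OF F(1) a])
  then have "f = (\<Sum>n. trig (int n) (a n))"
    using F(2) unfolding boundary_value_def by (intro tendsto_unique[of "at_left 1"]) auto
  then show ?thesis
    using that[OF a(1)] summable_sums[OF trig_summable[OF a(1)]] by simp
qed

section \<open>Projection onto the Hardy space\<close>

definition hardy_proj :: "'e L2 \<Rightarrow> 'e::{chilbert_space, second_countable_topology} L2" where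
  "hardy_proj F = (\<Sum>n. trig (int n) (cadjoint (trig (int n)) F))"

lemma hardy_proj_in_hardy_space: "hardy_proj F \<in> hardy_space"
  unfolding hardy_proj_def by (rule hardy_space_series[OF bessel_summable])

lemma hardy_proj_orthogonal:
  assumes "s \<in> hardy_space"
  shows "cinner (F - hardy_proj F) s = 0"
proof -
  have trig: "cinner (F - hardy_proj F) (trig (int m) x) = 0" for m x
  proof -
    let ?c = "\<lambda>n. cadjoint (trig (int n)) F"
    have "(\<lambda>n. cinner (trig (int n) (?c n)) (trig (int m) x)) sums cinner (hardy_proj F) (trig (int m) x)"
      unfolding hardy_proj_def
      by (rule bounded_linear.sums[OF bounded_bilinear.bounded_linear_left[OF bounded_bilinear_cinner]
            summable_sums[OF trig_summable[OF bessel_summable]]])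
    moreover have "(\<lambda>n. cinner (trig (int n) (?c n)) (trig (int m) x)) sums cinner (?c m) x"
      using sums_single[of m "\<lambda>n. cinner (?c n) x"] by (simp add: cinner_trig)
    ultimately have "cinner (hardy_proj F) (trig (int m) x) = cinner (?c m) x"
      by (rule sums_unique2)
    then show ?thesis
      by (simp add: cinner_diff_left cinner_cadjoint_left[OF clinear_trig])
  qed
  obtain a where "(\<lambda>n. trig (int n) (a n)) sums s"
    using hardy_space_sums[OF assms] by blast
  then have "(\<lambda>n. cinner (F - hardy_proj F) (trig (int n) (a n))) sums cinner (F - hardy_proj F) s"
    by (rule bounded_linear.sums[OF bounded_bilinear.bounded_linear_right[OF bounded_bilinear_cinner]])
  then show ?thesis
    by (simp add: trig sums_iff)
qed

lemma orth_proj_hardy_space: "orth_proj hardy_space F = hardy_proj F"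
  unfolding orth_proj_def
proof (rule the_equality)
  fix p assume p: "p \<in> hardy_space \<and> (\<forall>s\<in>hardy_space. cinner (F - p) s = 0)"
  have d: "p - hardy_proj F \<in> hardy_space"
    using p hardy_proj_in_hardy_space by (blast intro: hardy_space_diff)
  have "cinner (p - hardy_proj F) (p - hardy_proj F) =
      cinner (F - hardy_proj F) (p - hardy_proj F) - cinner (F - p) (p - hardy_proj F)"
    by (simp flip: cinner_diff_left)
  also have "\<dots> = 0"
    using p d hardy_proj_orthogonal[OF d] by simp
  finally show "p = hardy_proj F"
    by simp
qed (auto intro: hardy_proj_in_hardy_space hardy_proj_orthogonal)

lemma closed_hardy_space: "closed (hardy_space :: 'e::{chilbert_space, second_countable_topology} L2 set)"
  unfolding closed_sequential_limits
proof (intro allI impI)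
  fix X and l :: "'e L2" assume X: "(\<forall>n. X n \<in> hardy_space) \<and> X \<longlonglongrightarrow> l"
  define d where "d = l - hardy_proj l"
  have "cinner d (X n) = 0" for n
    using X by (simp add: d_def hardy_proj_orthogonal)
  moreover have "(\<lambda>n. cinner d (X n)) \<longlonglongrightarrow> cinner d l"
    using X by (intro tendsto_cinner tendsto_const) simp
  ultimately have "cinner d l = 0"
    by (simp add: LIMSEQ_const_iff)
  moreover have "cinner d (hardy_proj l) = 0"
    unfolding d_def by (rule hardy_proj_orthogonal[OF hardy_proj_in_hardy_space])
  ultimately have "cinner d d = 0"
    by (simp add: d_def cinner_diff_right)
  then have "l = hardy_proj l"
    by (simp add: d_def)
  then show "l \<in> hardy_space"
    by (metis hardy_proj_in_hardy_space)
qed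

instance H2 :: ("{chilbert_space, second_countable_topology}") chilbert_space
proof
  fix X :: "nat \<Rightarrow> 'a H2"
  assume X: "Cauchy X"
  have "Cauchy (\<lambda>n. Rep_H2 (X n))"
    using X by (simp add: Cauchy_def dist_H2.rep_eq)
  then obtain l where l: "(\<lambda>n. Rep_H2 (X n)) \<longlonglongrightarrow> l"
    using Cauchy_convergent convergent_def by blast
  have "l \<in> hardy_space"
    using closed_sequentially[OF closed_hardy_space _ l] Rep_H2 by blast
  then have "X \<longlonglongrightarrow> Abs_H2 l"
    using l by (simp add: lim_sequentially dist_H2.rep_eq Abs_H2_inverse)
  then show "convergent X"
    by (auto simp: convergent_def)
qed

text \<open>The projection with values in the type \<open>H2\<close>. It is the adjoint of the
  inclusion \<open>Rep_H2\<close>, which is how its linearity and boundedness are obtained.\<close>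

definition to_H2 :: "'e L2 \<Rightarrow> 'e::{chilbert_space, second_countable_topology} H2" where
  "to_H2 F = Abs_H2 (orth_proj hardy_space F)"

lemma Rep_to_H2: "Rep_H2 (to_H2 F) = hardy_proj F"
  by (simp add: to_H2_def orth_proj_hardy_space Abs_H2_inverse hardy_proj_in_hardy_space)

lemma cinner_to_H2: "cinner (to_H2 F) g = cinner F (Rep_H2 g)"
  using hardy_proj_orthogonal[OF Rep_H2[of g], of F]
  by (simp add: cinner_H2.rep_eq Rep_to_H2 cinner_diff_left)

lemma clinear_Rep_H2: "bounded_clinear (Rep_H2 :: 'e::{chilbert_space, second_countable_topology} H2 \<Rightarrow> _)"
  by (rule bounded_clinearI[where K = 1]) (simp_all add: plus_H2.rep_eq scaleC_H2.rep_eq norm_H2.rep_eq)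

lemma clinear_to_H2: "bounded_clinear (to_H2 :: 'e::{chilbert_space, second_countable_topology} L2 \<Rightarrow> _)"
proof (rule bounded_clinear_if_adjoint[OF clinear_Rep_H2])
  show "cinner (Rep_H2 x) F = cinner x (to_H2 F)" for x :: "'e H2" and F
    using arg_cong[OF cinner_to_H2[of F x], of cnj] by (simp flip: cinner_commute)
qed

section \<open>The shift and its adjoint\<close>

lemma mult_z_hardy_space:
  assumes "f \<in> hardy_space"
  shows "mult_z f \<in> hardy_space"
proof -
  obtain a where a: "summable (\<lambda>n. (norm (a n))\<^sup>2)" "(\<lambda>n. trig (int n) (a n)) sums f"
    using hardy_space_sums[OF assms] .
  define b where "b n = (case n of 0 \<Rightarrow> 0 | Suc m \<Rightarrow> a m)" for n
  have b: "summable (\<lambda>n. (norm (b n))\<^sup>2)"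
  proof (rule iffD1[OF summable_Suc_iff])
    show "summable (\<lambda>n. (norm (b (Suc n)))\<^sup>2)"
      using a(1) by (simp add: b_def)
  qed
  have "(\<lambda>n. mult_z (trig (int n) (a n))) sums mult_z f"
    by (rule bounded_clinear_sums[OF clinear_mult_op[OF Linf_circle_id] a(2)])
  then have "(\<lambda>n. trig (int (Suc n)) (b (Suc n))) sums mult_z f"
    by (simp add: mult_z_trig b_def add.commute)
  then have "(\<lambda>n. trig (int n) (b n)) sums (mult_z f + trig 0 (b 0))"
    using sums_Suc[of "\<lambda>n. trig (int n) (b n)"] by simp
  then have "mult_z f = (\<Sum>n. trig (int n) (b n))"
    by (simp add: b_def bounded_clinear_zero[OF clinear_trig] sums_iff)
  with hardy_space_series[OF b] show ?thesis by simp
qed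

lemma Rep_shift: "Rep_H2 (shift f) = mult_z (Rep_H2 f)"
  unfolding shift_def by (rule Abs_H2_inverse[OF mult_z_hardy_space[OF Rep_H2]])

lemma cinner_shift: "cinner (shift f) (shift g) = cinner f g"
  by (simp add: cinner_H2.rep_eq Rep_shift cinner_mult_z)

lemma clinear_shift: "bounded_clinear (shift :: 'e::{chilbert_space, second_countable_topology} H2 \<Rightarrow> _)"
proof (rule bounded_clinearI[where K = 1])
  fix f g :: "'e H2" and a
  show "shift (f + g) = shift f + shift g" "shift (a *\<^sub>C f) = a *\<^sub>C shift f"
    by (simp_all add: Rep_H2_inject[symmetric] Rep_shift plus_H2.rep_eq scaleC_H2.rep_eq
        bounded_clinear_add[OF clinear_mult_op[OF Linf_circle_id]]
        bounded_clinear_scaleC[OF clinear_mult_op[OF Linf_circle_id]])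
  show "norm (shift f) \<le> 1 * norm f"
    using arg_cong[OF cinner_shift[of f f], of Re] by simp
qed

lemma norm_shift: "norm (shift f) = norm f"
  using arg_cong[OF cinner_shift[of f f], of Re] by simp

definition const_H2 :: "'e \<Rightarrow> 'e::{chilbert_space, second_countable_topology} H2" where
  "const_H2 x = Abs_H2 (trig 0 x)"

lemma Rep_const_H2: "Rep_H2 (const_H2 x) = trig 0 x"
proof -
  have "(\<lambda>n. if n = 0 then trig (int n) x else 0) sums trig 0 x"
    using sums_single[of 0 "\<lambda>n. trig (int n) x"] by simp
  also have "(\<lambda>n. if n = 0 then trig (int n) x else 0) = (\<lambda>n. trig (int n) (if n = 0 then x else 0))"
    by (auto simp: bounded_clinear_zero[OF clinear_trig])
  finally have "trig 0 x = (\<Sum>n. trig (int n) (if n = 0 then x else 0))"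
    by (simp add: sums_iff)
  moreover have "summable (\<lambda>n. (norm (if n = 0 then x else 0))\<^sup>2)"
    by (rule summable_finite[of "{0}"]) auto
  ultimately have "trig 0 x \<in> hardy_space"
    using hardy_space_series by metis
  then show ?thesis
    by (simp add: const_H2_def Abs_H2_inverse)
qed

lemma clinear_const_H2: "bounded_clinear (const_H2 :: 'e::{chilbert_space, second_countable_topology} \<Rightarrow> _)"
  by (rule bounded_clinearI[where K = 1])
    (simp_all add: Rep_H2_inject[symmetric] Rep_const_H2 plus_H2.rep_eq scaleC_H2.rep_eq norm_H2.rep_eq
      bounded_clinear_add[OF clinear_trig] bounded_clinear_scaleC[OF clinear_trig])

lemma Rep_shift_funpow_const: "Rep_H2 ((shift ^^ n) (const_H2 x)) = trig (int n) x"
  by (induction n) (simp_all add: Rep_const_H2 Rep_shift mult_z_trig add.commute)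

text \<open>The Wold decomposition of the shift: the constants form its wandering subspace.\<close>

lemma H2_sums:
  fixes f :: "'e::{chilbert_space, second_countable_topology} H2"
  obtains a where "(\<lambda>n. (shift ^^ n) (const_H2 (a n))) sums f"
proof -
  obtain a where a: "(\<lambda>n. trig (int n) (a n)) sums Rep_H2 f"
    using hardy_space_sums[OF Rep_H2] by blast
  have "(\<lambda>n. (shift ^^ n) (const_H2 (a n))) sums f"
    using a unfolding sums_def lim_sequentially
    by (simp add: dist_H2.rep_eq bounded_clinear_sum[OF clinear_Rep_H2] Rep_shift_funpow_const)
  then show ?thesis by (rule that)
qed

lemma cadjoint_shift_const [simp]: "cadjoint shift (const_H2 x) = 0"
proof (rule cinner_eqI)
  fix g :: "'a H2"
  obtain a where a: "(\<lambda>n. (shift ^^ n) (const_H2 (a n))) sums g"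
    by (rule H2_sums)
  have "(\<lambda>n. cinner (cadjoint shift (const_H2 x)) ((shift ^^ n) (const_H2 (a n)))) sums
      cinner (cadjoint shift (const_H2 x)) g"
    by (rule bounded_linear.sums[OF bounded_bilinear.bounded_linear_right[OF bounded_bilinear_cinner] a])
  moreover have "cinner (cadjoint shift (const_H2 x)) ((shift ^^ n) (const_H2 y)) = 0" for n y
    unfolding cinner_cadjoint_left[OF clinear_shift] funpow.simps(2)[unfolded comp_def fun_eq_iff, rule_format, symmetric]
    by (simp only: cinner_H2.rep_eq Rep_const_H2 Rep_shift_funpow_const cinner_trig) simp
  ultimately show "cinner (cadjoint shift (const_H2 x)) g = cinner 0 g"
    by (simp add: sums_iff)
qed

lemma cadjoint_shift_shift: "cadjoint shift (shift f) = f"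
  by (rule cinner_eqI) (simp add: cinner_cadjoint_left[OF clinear_shift] cinner_shift)

lemma norm_cadjoint_shift_le: "norm (cadjoint shift f) \<le> norm f"
  using norm_adjoint_le[of shift "cadjoint shift" 1, OF cinner_cadjoint_right[OF clinear_shift]]
  by (simp add: norm_shift)

text \<open>The \<open>n\<close>-th power annihilates the first \<open>n\<close> terms of the Wold
  series and does not increase the norm of the tail.\<close>

lemma cadjoint_shift_tendsto:
  fixes f :: "'e::{chilbert_space, second_countable_topology} H2"
  shows "(\<lambda>n. (cadjoint shift ^^ n) f) \<longlonglongrightarrow> 0"
proof -
  let ?A = "cadjoint shift :: 'e H2 \<Rightarrow> 'e H2"
  have clinear: "bounded_clinear (?A ^^ n)" for n
    by (intro bounded_clinear_funpow bounded_clinear_cadjoint clinear_shift)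
  obtain a where a: "(\<lambda>n. (shift ^^ n) (const_H2 (a n))) sums f"
    by (rule H2_sums)
  define s where "s m = (\<Sum>k<m. (shift ^^ k) (const_H2 (a k)))" for m
  have cancel: "(?A ^^ k) ((shift ^^ k) g) = g" for k g
    by (induction k) (simp_all add: funpow_swap1[of ?A] cadjoint_shift_shift)
  have vanish: "(?A ^^ n) ((shift ^^ k) (const_H2 x)) = 0" if "k < n" for n k x
  proof -
    have "?A ^^ n = ?A ^^ (n - Suc k) \<circ> ?A \<circ> ?A ^^ k"
      using that funpow_add[of "n - Suc k" "Suc k" ?A] by (simp add: comp_assoc)
    then show ?thesis
      by (simp add: cancel bounded_clinear_zero[OF clinear])
  qed
  have le: "norm ((?A ^^ n) g) \<le> norm g" for n g
    by (induction n) (auto intro: order_trans[OF norm_cadjoint_shift_le])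
  have "norm ((?A ^^ n) f) \<le> norm (f - s n)" for n
  proof -
    have "(?A ^^ n) (s n) = 0"
      by (simp add: s_def bounded_clinear_sum[OF clinear] vanish)
    then have "(?A ^^ n) f = (?A ^^ n) (f - s n)"
      by (simp add: bounded_clinear_diff[OF clinear])
    then show ?thesis using le[of n "f - s n"] by simp
  qed
  then have "\<forall>\<^sub>F n in sequentially. norm ((?A ^^ n) f) \<le> norm (f - s n)"
    by (rule always_eventually[OF allI])
  moreover have "(\<lambda>n. norm (f - s n)) \<longlonglongrightarrow> norm (f - f)"
    using a unfolding s_def sums_def by (intro tendsto_norm tendsto_diff tendsto_const)
  then have "(\<lambda>n. norm (f - s n)) \<longlonglongrightarrow> 0"
    by simp
  ultimately have "(\<lambda>n. norm ((?A ^^ n) f)) \<longlonglongrightarrow> 0"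
    by (rule tendsto_sandwich[OF always_eventually[OF allI[OF norm_ge_zero]] _ tendsto_const])
  then show ?thesis
    unfolding tendsto_norm_zero_iff .
qed

interpretation shift: pure_isometry "shift :: 'e::{chilbert_space, second_countable_topology} H2 \<Rightarrow> 'e H2" "cadjoint shift"
  by unfold_locales (rule clinear_shift cinner_shift cinner_cadjoint_right[OF clinear_shift] cadjoint_shift_tendsto)+


lemma H2_eq_zeroI:
  fixes h :: "'e::{chilbert_space, second_countable_topology} H2"
  assumes "\<And>n x. cinner h ((shift ^^ n) (const_H2 x)) = 0"
  shows "h = 0"
proof -
  obtain a where a: "(\<lambda>n. (shift ^^ n) (const_H2 (a n))) sums h"
    by (rule H2_sums)
  have "(\<lambda>n. cinner h ((shift ^^ n) (const_H2 (a n)))) sums cinner h h"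
    by (rule bounded_linear.sums[OF bounded_bilinear.bounded_linear_right[OF bounded_bilinear_cinner] a])
  then show ?thesis
    by (simp add: assms sums_iff)
qed

text \<open>Subtracting the constant term leaves a vector orthogonal to every
  \<open>(shift ^^ n) (const_H2 x)\<close>: for \<open>n = 0\<close> by construction, for
  \<open>n > 0\<close> because the backward shift kills it.\<close>

lemma cadjoint_shift_eq_zeroD:
  fixes g :: "'e::{chilbert_space, second_countable_topology} H2"
  assumes "cadjoint shift g = 0"
  obtains x where "g = const_H2 x"
proof
  define d where "d = g - const_H2 (cadjoint const_H2 g)"
  have "cinner d ((shift ^^ n) (const_H2 x)) = 0" for n x
  proof (cases n)
    case 0
    have "cinner (const_H2 (cadjoint const_H2 g)) (const_H2 x) = cinner (cadjoint const_H2 g) x"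
      by (simp add: cinner_H2.rep_eq Rep_const_H2 cinner_trig)
    then show ?thesis
      using 0 by (simp add: d_def cinner_diff_left cinner_cadjoint_left[OF clinear_const_H2])
  next
    case (Suc m)
    have "cadjoint shift d = 0"
      by (simp add: d_def assms bounded_clinear_diff[OF shift.clinear_A])
    then show ?thesis
      using Suc by (simp flip: shift.adjoint')
  qed
  then have "d = 0"
    by (rule H2_eq_zeroI)
  then show "g = const_H2 (cadjoint const_H2 g)"
    by (simp add: d_def)
qed

text \<open>The flip fixes constants. This makes the boundary terms cancel in the commutator
  equations below.\<close>

lemma flip_Rep_wandering:
  assumes "cadjoint shift k = 0"
  shows "flip (Rep_H2 k) = Rep_H2 k"
proof -
  obtain x where "k = const_H2 x"
    using cadjoint_shift_eq_zeroD[OF assms] .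
  then show ?thesis
    by (simp add: Rep_const_H2 flip_trig)
qed

lemma cadjoint_shift_to_H2: "cadjoint shift (to_H2 F) = to_H2 (mult_cnj_z F)"
  by (rule cinner_eqI) (simp add: shift.adjoint' cinner_to_H2 Rep_shift cinner_mult_cnj_z)

lemma Rep_cadjoint_shift:
  "Rep_H2 (cadjoint shift f) = mult_cnj_z (Rep_H2 f - Rep_H2 (f - shift (cadjoint shift f)))"
  by (simp add: bounded_clinear_diff[OF clinear_Rep_H2] Rep_shift)

section \<open>Hankel operators with a symbol\<close>

lemma hankel_eq: "hankel \<Phi> f = to_H2 (mult_op \<Phi> (flip (Rep_H2 f)))"
  by (simp add: hankel_def to_H2_def)

lemma clinear_hankel: "\<Phi> \<in> Linf \<Longrightarrow> bounded_clinear (hankel \<Phi>)"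
  unfolding hankel_eq[abs_def]
  by (intro bounded_clinear_compose[OF clinear_to_H2] bounded_clinear_compose[OF clinear_mult_op]
      bounded_clinear_compose[OF clinear_flip] clinear_Rep_H2)

lemma hankel_shift:
  assumes "\<Phi> \<in> Linf"
  shows "cadjoint shift (hankel \<Phi> f) = hankel \<Phi> (shift f)"
  by (simp add: hankel_eq cadjoint_shift_to_H2 Rep_shift flip_mult_z mult_z_commute[OF assms])

lemma hankel_operator_hankel:
  "\<Phi> \<in> Linf \<Longrightarrow> hankel_operator shift (cadjoint shift) (hankel \<Phi>)"
  by unfold_locales (auto intro: clinear_hankel hankel_shift)

text \<open>The flip turns the exponent \<open>n\<close> into \<open>- n\<close>, so the difference
  of exponents becomes \<open>m + n\<close>.\<close>

lemma cinner_hankel_powers: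
  assumes "\<Phi> \<in> Linf"
  shows "cinner (hankel \<Phi> ((shift ^^ n) (const_H2 x))) ((shift ^^ m) (const_H2 y)) =
    cinner (fourier_coeff \<Phi> (int m + int n) x) y"
  by (simp add: hankel_eq cinner_to_H2 Rep_shift_funpow_const flip_trig cinner_mult_op_trig[OF assms])

text \<open>All matrix entries are Fourier coefficients of nonnegative index, so a Hankel operator
  does not see the coanalytic part of its symbol.\<close>

lemma hankel_zHinf_conj:
  assumes "\<Omega> \<in> zHinf_conj"
  shows "hankel \<Omega> f = 0"
proof -
  have \<Omega>: "\<Omega> \<in> Linf" "\<And>n x. 0 \<le> n \<Longrightarrow> fourier_coeff \<Omega> n x = 0"
    using assms by (auto simp: zHinf_conj_def)
  have "hankel \<Omega> ((shift ^^ n) (const_H2 x)) = 0" for n x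
    by (rule H2_eq_zeroI) (simp add: cinner_hankel_powers \<Omega>)
  moreover obtain a where "(\<lambda>n. (shift ^^ n) (const_H2 (a n))) sums f"
    by (rule H2_sums)
  then have "(\<lambda>n. hankel \<Omega> ((shift ^^ n) (const_H2 (a n)))) sums hankel \<Omega> f"
    by (rule bounded_clinear_sums[OF clinear_hankel[OF \<Omega>(1)]])
  ultimately show ?thesis
    by (simp add: sums_iff)
qed

lemma symbol_sumE:
  assumes "\<Phi> \<in> symbol_sum zdiff_Linf zHinf_conj"
  obtains \<Theta> \<Omega> where "\<Theta> \<in> Linf" "\<Omega> \<in> zHinf_conj"
    "AE z in circle. \<forall>x. \<Phi> z x = (z - cnj z) *\<^sub>C \<Theta> z x + \<Omega> z x"
proof -
  obtain \<Psi> \<Omega> where \<Psi>: "\<Psi> \<in> zdiff_Linf" and \<Omega>: "\<Omega> \<in> zHinf_conj"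
    and eq: "AE z in circle. \<forall>x. \<Phi> z x = \<Psi> z x + \<Omega> z x"
    using assms by (auto simp: symbol_sum_def)
  obtain \<Theta> where \<Theta>: "\<Theta> \<in> Linf" "AE z in circle. \<forall>x. \<Psi> z x = (z - cnj z) *\<^sub>C \<Theta> z x"
    using \<Psi> by (auto simp: zdiff_Linf_def)
  have "AE z in circle. \<forall>x. \<Phi> z x = (z - cnj z) *\<^sub>C \<Theta> z x + \<Omega> z x"
    using eq \<Theta>(2) by eventually_elim simp
  with \<Theta>(1) \<Omega> show ?thesis by (rule that)
qed

lemma Linf_zdiff: "\<Theta> \<in> Linf \<Longrightarrow> (\<lambda>z x. (z - cnj z) *\<^sub>C \<Theta> z x) \<in> Linf"
  by (rule Linf_scaleC[where B = 2]) (measurable, metis complex_mod_cnj norm_triangle_ineq4 one_add_one)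

lemma mult_op_zdiff:
  fixes F :: "'e::{chilbert_space, second_countable_topology} L2"
  assumes \<Phi>: "\<Phi> \<in> Linf" and \<Theta>: "\<Theta> \<in> Linf" and \<Omega>: "\<Omega> \<in> Linf"
    and eq: "AE z in circle. \<forall>x. \<Phi> z x = (z - cnj z) *\<^sub>C \<Theta> z x + \<Omega> z x"
  shows "mult_op \<Phi> F = mult_z (mult_op \<Theta> F) - mult_cnj_z (mult_op \<Theta> F) + mult_op \<Omega> F"
proof -
  obtain f where f: "f \<in> l2_fun" "F = abs_L2 f" by (rule L2_cases)
  note l2 = Linf_l2_fun[OF \<Theta> f(1)] Linf_l2_fun[OF Linf_circle_id Linf_l2_fun[OF \<Theta> f(1)]]
    Linf_l2_fun[OF Linf_circle_cnj Linf_l2_fun[OF \<Theta> f(1)]] Linf_l2_fun[OF \<Omega> f(1)]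
  have "mult_z (mult_op \<Theta> F) - mult_cnj_z (mult_op \<Theta> F) + mult_op \<Omega> F =
      abs_L2 (\<lambda>z. z *\<^sub>C \<Theta> z (f z) - cnj z *\<^sub>C \<Theta> z (f z) + \<Omega> z (f z))"
    unfolding f(2) mult_op_abs_L2[OF \<Theta> f(1)] mult_op_abs_L2[OF \<Omega> f(1)]
      mult_op_abs_L2[OF Linf_circle_id l2(1)] mult_op_abs_L2[OF Linf_circle_cnj l2(1)]
      abs_L2_diff[OF l2(2,3), symmetric] abs_L2_add[OF l2_fun_diff[OF l2(2,3)] l2(4), symmetric] ..
  also have "\<dots> = mult_op \<Phi> F"
    unfolding f(2) mult_op_abs_L2[OF \<Phi> f(1)]
  proof (rule abs_L2_eqI[OF l2_fun_add[OF l2_fun_diff[OF l2(2,3)] l2(4)] Linf_l2_fun[OF \<Phi> f(1)]])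
    show "AE z in circle. z *\<^sub>C \<Theta> z (f z) - cnj z *\<^sub>C \<Theta> z (f z) + \<Omega> z (f z) = \<Phi> z (f z)"
      using eq by eventually_elim (simp add: scaleC_diff_left)
  qed
  finally show ?thesis ..
qed

text \<open>Conjugation by the unipotent matrix with off-diagonal entry \<open>Z\<close> produces
  the off-diagonal entry \<open>P Z + X - Z P\<close>, which vanishes. What remains is two diagonal
  copies of the contraction \<open>P\<close>.\<close>

lemma similar_to_contraction_if_commutator:
  fixes P :: "'h::complex_inner \<Rightarrow> 'h"
  assumes P: "bounded_clinear P" "\<And>x. norm (P x) \<le> norm x" and Z: "bounded_clinear Z"
    and eq: "\<And>y. P (Z y) + X y = Z (P y)"
  shows "similar_to_contraction (upper_block P X P)"
proof -
  define W V :: "'h \<times> 'h \<Rightarrow> 'h \<times> 'h" where "W u = (fst u + Z (snd u), snd u)"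
    and "V u = (fst u - Z (snd u), snd u)" for u
  have clinear: "bounded_clinear W" "bounded_clinear V"
    unfolding W_def V_def
    by (intro bounded_clinear_Pair bounded_clinear_plus bounded_clinear_sub bounded_clinear_fst
        bounded_clinear_snd bounded_clinear_compose[OF Z])+
  have "V (upper_block P X P (W u)) = (P (fst u), P (snd u))" for u
    using eq[of "snd u"] by (simp add: W_def V_def upper_block_def bounded_clinear_add[OF P(1)] flip: eq)
  then have diag: "V \<circ> upper_block P X P \<circ> W = (\<lambda>u. (P (fst u), P (snd u)))"
    by (simp add: fun_eq_iff)
  have "norm (P (fst u), P (snd u)) \<le> 1 * norm u" for u
    by (cases u) (auto simp: norm_Pair intro!: add_mono power_mono P)
  moreover have "bounded_clinear (\<lambda>u. (P (fst u), P (snd u)))"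
    by (intro bounded_clinear_Pair bounded_clinear_compose[OF P(1)] bounded_clinear_fst bounded_clinear_snd)
  ultimately have "contraction (V \<circ> upper_block P X P \<circ> W)"
    unfolding diag contraction_def by (auto intro: onorm_bound)
  moreover have "W \<circ> V = id" "V \<circ> W = id"
    by (auto simp: W_def V_def fun_eq_iff)
  ultimately show ?thesis
    unfolding similar_to_contraction_def using clinear by blast
qed

text \<open>With the Fourier coefficients \<open>\<Theta>\<^sub>n\<close>, the operators \<open>Z\<close> for \<open>S\<^sup>*\<close> and for \<open>S\<close> have the matrices
  \<open>\<Theta>\<^sub>j\<^sub>+\<^sub>k - \<Theta>\<^sub>j\<^sub>-\<^sub>k\<^sub>-\<^sub>2\<close> and \<open>\<Theta>\<^sub>k\<^sub>-\<^sub>j\<^sub>-\<^sub>2 - \<Theta>\<^sub>j\<^sub>+\<^sub>k\<close>: the Toeplitz part cancels the boundary term that the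
  Hankel part leaves in the first column or row.\<close>

lemma
  fixes \<Phi> :: "complex \<Rightarrow> 'e::{chilbert_space, second_countable_topology} \<Rightarrow> 'e"
  assumes \<Phi>: "\<Phi> \<in> Linf" and sum: "\<Phi> \<in> symbol_sum zdiff_Linf zHinf_conj"
  shows symbol_sum_imp_similar_shift: "similar_to_contraction (upper_block shift (hankel \<Phi>) shift)"
    and symbol_sum_imp_similar_backward_shift:
      "similar_to_contraction (upper_block (cadjoint shift) (hankel \<Phi>) (cadjoint shift))"
proof -
  obtain \<Theta> \<Omega> where \<Theta>: "\<Theta> \<in> Linf" and \<Omega>: "\<Omega> \<in> zHinf_conj"
    and eq: "AE z in circle. \<forall>x. \<Phi> z x = (z - cnj z) *\<^sub>C \<Theta> z x + \<Omega> z x"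
    using symbol_sumE[OF sum] .
  have \<Omega>': "\<Omega> \<in> Linf"
    using \<Omega> by (simp add: zHinf_conj_def)
  define M where "M = mult_op \<Theta>"
  note clinear_z = clinear_mult_op[OF Linf_circle_id] and clinear_cnj_z = clinear_mult_op[OF Linf_circle_cnj]
  have M: "bounded_clinear M"
    unfolding M_def by (rule clinear_mult_op[OF \<Theta>])
  have M_z: "M (mult_z F) = mult_z (M F)" "M (mult_cnj_z F) = mult_cnj_z (M F)" for F
    unfolding M_def by (rule mult_z_commute[OF \<Theta>])+
  have hankel: "hankel \<Phi> f = to_H2 (mult_z (M (flip (Rep_H2 f))) - mult_cnj_z (M (flip (Rep_H2 f))))" for f
  proof -
    have "hankel \<Phi> f = to_H2 (mult_z (M (flip (Rep_H2 f))) - mult_cnj_z (M (flip (Rep_H2 f)))) + hankel \<Omega> f"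
      unfolding hankel_eq mult_op_zdiff[OF \<Phi> \<Theta> \<Omega>' eq] M_def
      by (rule bounded_clinear_add[OF clinear_to_H2])
    then show ?thesis
      by (simp add: hankel_zHinf_conj[OF \<Omega>])
  qed
  define k where "k f = f - shift (cadjoint shift f)" for f :: "'e H2"
  have flip_k: "flip (Rep_H2 (k f)) = Rep_H2 (k f)" for f
    by (rule flip_Rep_wandering) (simp add: k_def)
  have Rep_A: "Rep_H2 (cadjoint shift f) = mult_cnj_z (Rep_H2 f - Rep_H2 (k f))" for f
    unfolding k_def by (rule Rep_cadjoint_shift)

  show "similar_to_contraction (upper_block (cadjoint shift) (hankel \<Phi>) (cadjoint shift))"
  proof (rule similar_to_contraction_if_commutator[OF shift.clinear_A shift.norm_A_le])
    define Z where "Z f = to_H2 (M (flip (Rep_H2 f)) - mult_z (mult_z (M (Rep_H2 f))))" for f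
    show "bounded_clinear Z"
      unfolding Z_def
      by (intro bounded_clinear_compose[OF clinear_to_H2] bounded_clinear_sub bounded_clinear_compose[OF M]
          bounded_clinear_compose[OF clinear_flip] clinear_Rep_H2 bounded_clinear_compose[OF clinear_z])
    \<comment> \<open>On the right, removing the constant term \<open>k f\<close> contributes
      \<open>- z M (k f)\<close> through the Hankel part, because the flip fixes it, and
      \<open>+ z M (k f)\<close> through the Toeplitz part; the two cancel.\<close>
    show "cadjoint shift (Z f) + hankel \<Phi> f = Z (cadjoint shift f)" for f
      by (simp add: Z_def hankel cadjoint_shift_to_H2 Rep_A flip_mult_z M_z flip_k
          bounded_clinear_diff[OF clinear_cnj_z] bounded_clinear_diff[OF clinear_z]
          bounded_clinear_diff[OF M] bounded_clinear_diff[OF clinear_flip]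
          bounded_clinear_diff[OF clinear_to_H2] bounded_clinear_diff[OF shift.clinear_A])
  qed

  show "similar_to_contraction (upper_block shift (hankel \<Phi>) shift)"
  proof (rule similar_to_contraction_if_commutator[OF clinear_shift])
    show "norm (shift f) \<le> norm f" for f :: "'e H2"
      by (simp add: norm_shift)
    define B where "B F = flip (mult_z (mult_z (M (flip F)))) - M (flip F)" for F
    have B: "bounded_clinear B"
      unfolding B_def
      by (intro bounded_clinear_sub bounded_clinear_compose[OF M] bounded_clinear_compose[OF clinear_flip]
          bounded_clinear_compose[OF clinear_z] bounded_clinear_id)
    define Z where "Z f = to_H2 (B (Rep_H2 f))" for f
    show "bounded_clinear Z"
      unfolding Z_def
      by (intro bounded_clinear_compose[OF clinear_to_H2] bounded_clinear_compose[OF B] clinear_Rep_H2)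
    show "shift (Z f) + hankel \<Phi> f = Z (shift f)" for f
    proof (rule cinner_eqI)
      fix g
      define h where "h = mult_z (M (flip (Rep_H2 f)))"
      \<comment> \<open>This difference is antisymmetric under the flip, hence orthogonal to the
        flip-invariant constant \<open>k g\<close>. The term \<open>k g\<close> produced by the
        backward shift on the test vector therefore drops out.\<close>
      have zB: "mult_z (B (Rep_H2 f)) = flip h - h"
        by (simp add: B_def h_def bounded_clinear_diff[OF clinear_z] flip_mult_z)
      have "cinner (shift (Z f)) g = cinner (mult_z (B (Rep_H2 f))) (Rep_H2 g - Rep_H2 (k g))"
        by (simp add: shift.adjoint Z_def cinner_to_H2 Rep_A cinner_mult_z)
      also have "\<dots> = cinner (flip h - h) (Rep_H2 g)"
        by (simp add: zB cinner_diff_right cinner_diff_left cinner_flip flip_k)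
      finally have "cinner (shift (Z f) + hankel \<Phi> f) g = cinner (flip h - mult_cnj_z (M (flip (Rep_H2 f)))) (Rep_H2 g)"
        by (simp add: cinner_add_left hankel cinner_to_H2 h_def cinner_diff_left)
      also have "\<dots> = cinner (B (Rep_H2 (shift f))) (Rep_H2 g)"
        by (simp add: B_def h_def Rep_shift flip_mult_z M_z)
      finally show "cinner (shift (Z f) + hankel \<Phi> f) g = cinner (Z (shift f)) g"
        by (simp add: Z_def cinner_to_H2)
    qed
  qed
qed


section \<open>Symbols with prescribed Fourier coefficients\<close>

text \<open>The denominator \<open>Suc N\<close> avoids a division by zero at \<open>N = 0\<close>.
  Truncation at 0 defines the weight for all \<open>k\<close>, so means of different orders can be
  compared over a common range; at absolute value \<open>Suc N\<close> it is already 0.\<close>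

definition fejer_weight :: "nat \<Rightarrow> int \<Rightarrow> real" where
  "fejer_weight N k = max 0 (1 - \<bar>of_int k\<bar> / real (Suc N))"

lemma fejer_weight_nonneg: "0 \<le> fejer_weight N k"
  by (simp add: fejer_weight_def)

lemma fejer_weight_mono: "M \<le> N \<Longrightarrow> fejer_weight M k \<le> fejer_weight N k"
  unfolding fejer_weight_def by (intro max.mono diff_mono divide_left_mono) auto

lemma fejer_weight_eq_zero: "k \<notin> {- int (Suc N)..int (Suc N)} \<Longrightarrow> fejer_weight N k = 0"
  by (auto simp: fejer_weight_def max_def field_simps)

lemma fejer_weight_tendsto:
  assumes "strict_mono r"
  shows "(\<lambda>n. fejer_weight (r n) k) \<longlonglongrightarrow> 1"
proof -
  have "(\<lambda>n. max 0 (1 - \<bar>of_int k\<bar> * inverse (real (Suc n)))) \<longlonglongrightarrow> max 0 (1 - \<bar>of_int k\<bar> * 0)"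
    by (intro tendsto_intros LIMSEQ_inverse_real_of_nat)
  then have "(\<lambda>n. fejer_weight n k) \<longlonglongrightarrow> 1"
    by (simp add: fejer_weight_def divide_inverse)
  from LIMSEQ_subseq_LIMSEQ[OF this assms] show ?thesis
    by (simp add: comp_def)
qed

definition fejer_mean ::
    "(int \<Rightarrow> 'e \<Rightarrow> 'e) \<Rightarrow> nat \<Rightarrow> complex \<Rightarrow> 'e \<Rightarrow> 'e::{chilbert_space, second_countable_topology}" where
  "fejer_mean \<gamma> N z x =
    (\<Sum>k\<in>{- int (Suc N)..int (Suc N)}. z powi k *\<^sub>C fejer_weight N k *\<^sub>R \<gamma> k x)"

lemma
  shows fejer_mean_in_l2_fun: "(\<lambda>z. fejer_mean \<gamma> N z x) \<in> l2_fun"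
    and abs_L2_fejer_mean: "abs_L2 (\<lambda>z. fejer_mean \<gamma> N z x) =
      (\<Sum>k\<in>{- int (Suc N)..int (Suc N)}. trig k (fejer_weight N k *\<^sub>R \<gamma> k x))"
  using sum_trig_abs_L2[of "{- int (Suc N)..int (Suc N)}" "\<lambda>k. fejer_weight N k *\<^sub>R \<gamma> k x"]
  by (simp_all add: fejer_mean_def[abs_def])

lemma abs_L2_fejer_mean_superset:
  assumes "M \<le> N"
  shows "abs_L2 (\<lambda>z. fejer_mean \<gamma> M z x) =
    (\<Sum>k\<in>{- int (Suc N)..int (Suc N)}. trig k (fejer_weight M k *\<^sub>R \<gamma> k x))"
  unfolding abs_L2_fejer_mean using assms
  by (intro sum.mono_neutral_left) (auto simp: fejer_weight_eq_zero bounded_clinear_zero[OF clinear_trig])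

text \<open>The weights increase with the order, and \<open>(a - b)^2 \<le> a^2 - b^2\<close>
  whenever \<open>0 \<le> b \<le> a\<close>. Distances are thus controlled by the growth of the
  norms.\<close>

lemma norm_fejer_mean_diff:
  assumes "M \<le> N"
  shows "(norm (abs_L2 (\<lambda>z. fejer_mean \<gamma> N z x) - abs_L2 (\<lambda>z. fejer_mean \<gamma> M z x)))\<^sup>2 \<le>
    (norm (abs_L2 (\<lambda>z. fejer_mean \<gamma> N z x)))\<^sup>2 - (norm (abs_L2 (\<lambda>z. fejer_mean \<gamma> M z x)))\<^sup>2"
proof -
  let ?I = "{- int (Suc N)..int (Suc N)}"
  have "abs_L2 (\<lambda>z. fejer_mean \<gamma> N z x) - abs_L2 (\<lambda>z. fejer_mean \<gamma> M z x) =
      (\<Sum>k\<in>?I. trig k ((fejer_weight N k - fejer_weight M k) *\<^sub>R \<gamma> k x))"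
    unfolding abs_L2_fejer_mean[of _ N] abs_L2_fejer_mean_superset[OF assms] sum_subtractf[symmetric]
      bounded_clinear_diff[OF clinear_trig, symmetric] scaleR_left_diff_distrib ..
  then have "(norm (abs_L2 (\<lambda>z. fejer_mean \<gamma> N z x) - abs_L2 (\<lambda>z. fejer_mean \<gamma> M z x)))\<^sup>2 =
      (\<Sum>k\<in>?I. (fejer_weight N k - fejer_weight M k)\<^sup>2 * (norm (\<gamma> k x))\<^sup>2)"
    by (simp add: norm_sum_trig power_mult_distrib)
  also have "\<dots> \<le> (\<Sum>k\<in>?I. ((fejer_weight N k)\<^sup>2 - (fejer_weight M k)\<^sup>2) * (norm (\<gamma> k x))\<^sup>2)"
  proof (intro sum_mono mult_right_mono)
    fix k
    have "0 \<le> 2 * (fejer_weight M k * (fejer_weight N k - fejer_weight M k))"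
      using fejer_weight_nonneg[of M k] fejer_weight_mono[OF assms, of k] by simp
    then show "(fejer_weight N k - fejer_weight M k)\<^sup>2 \<le> (fejer_weight N k)\<^sup>2 - (fejer_weight M k)\<^sup>2"
      by (simp add: power2_eq_square algebra_simps)
  qed simp
  also have "\<dots> = (norm (abs_L2 (\<lambda>z. fejer_mean \<gamma> N z x)))\<^sup>2 - (norm (abs_L2 (\<lambda>z. fejer_mean \<gamma> M z x)))\<^sup>2"
    unfolding abs_L2_fejer_mean[of _ N] abs_L2_fejer_mean_superset[OF assms]
    by (simp add: norm_sum_trig power_mult_distrib sum_subtractf left_diff_distrib)
  finally show ?thesis .
qed

lemma cinner_fejer_mean_trig:
  "cinner (abs_L2 (\<lambda>z. fejer_mean \<gamma> N z x)) (trig k y) = fejer_weight N k * cinner (\<gamma> k x) y"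
proof -
  have "cinner (abs_L2 (\<lambda>z. fejer_mean \<gamma> N z x)) (trig k y) =
      (if k \<in> {- int (Suc N)..int (Suc N)} then cinner (fejer_weight N k *\<^sub>R \<gamma> k x) y else 0)"
    unfolding abs_L2_fejer_mean by (simp add: cinner_sum_left cinner_trig sum.delta)
  then show ?thesis
    using fejer_weight_eq_zero[of k N]
    by (auto simp: cinner_scaleC_left simp flip: scaleC_of_real)
qed

lemma convergent_if_dense:
  fixes T :: "nat \<Rightarrow> 'e::real_normed_vector \<Rightarrow> 'f::banach"
  assumes lin: "\<And>n. bounded_linear (T n)" and le: "\<And>n x. norm (T n x) \<le> norm x"
    and dense: "\<And>X. open X \<Longrightarrow> X \<noteq> {} \<Longrightarrow> \<exists>d\<in>D. d \<in> X"
    and conv: "\<And>d. d \<in> D \<Longrightarrow> convergent (\<lambda>n. T n d)"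
  shows "convergent (\<lambda>n. T n x)"
proof (rule Cauchy_convergent, rule metric_CauchyI)
  fix e :: real assume "0 < e"
  then obtain d where d: "d \<in> D" "dist x d < e / 3"
    using dense[of "ball x (e / 3)"] by auto
  have close: "dist (T n x) (T n d) < e / 3" for n
    using le[of n "x - d"] d(2) by (simp add: dist_norm linear_simps[OF lin])
  obtain N where N: "\<And>i j. N \<le> i \<Longrightarrow> N \<le> j \<Longrightarrow> dist (T i d) (T j d) < e / 3"
    using metric_CauchyD[OF convergent_Cauchy[OF conv[OF d(1)]], of "e / 3"] \<open>0 < e\<close> by auto
  show "\<exists>N. \<forall>i\<ge>N. \<forall>j\<ge>N. dist (T i x) (T j x) < e"
  proof (intro exI allI impI)
    fix i j assume "N \<le> i" "N \<le> j"
    then show "dist (T i x) (T j x) < e"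
      using N[of i j] close[of i] close[of j] dist_triangle[of "T i x" "T j x" "T i d"]
        dist_triangle[of "T i d" "T j x" "T j d"]
      by (simp add: dist_commute)
  qed
qed

text \<open>Fejer means are bounded and converge in \<open>L\<^sup>2\<close>; along a common subsequence they converge almost
  everywhere on a countable dense set of vectors, hence, by boundedness, on all vectors.\<close>

lemma symbol_with_fourier_coefficients:
  fixes \<gamma> :: "int \<Rightarrow> 'e \<Rightarrow> 'e::{chilbert_space, second_countable_topology}"
  assumes clinear: "\<And>k. bounded_clinear (\<gamma> k)"
    and bound: "\<And>N w x y. cmod w = 1 \<Longrightarrow>
      cmod (\<Sum>k\<in>{- int N..int N}. of_int (int N - \<bar>k\<bar>) * (w powi k * cinner (\<gamma> k x) y)) \<le>
        real N * norm x * norm y"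
  obtains \<Theta> where "\<Theta> \<in> Linf" "\<And>k x. fourier_coeff \<Theta> k x = \<gamma> k x"
proof -
  define \<sigma> where "\<sigma> = fejer_mean \<gamma>"
  define s where "s N x = abs_L2 (\<lambda>z. \<sigma> N z x)" for N x
  have \<sigma>_l2: "(\<lambda>z. \<sigma> N z x) \<in> l2_fun" for N x
    unfolding \<sigma>_def by (rule fejer_mean_in_l2_fun)
  have [measurable]: "(\<lambda>z. \<sigma> N z x) \<in> borel_measurable circle" for N x
    by (rule l2_fun_measurable[OF \<sigma>_l2])
  have \<sigma>_clinear: "bounded_clinear (\<sigma> N z)" for N z
    unfolding \<sigma>_def fejer_mean_def scaleC_of_real[symmetric]
    by (intro bounded_clinear_setsum bounded_clinear_scaleC_left clinear)
  \<comment> \<open>Multiplication by \<open>Suc N\<close> turns the weights into the integers in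
    \<open>bound\<close>, taken at \<open>Suc N\<close>.\<close>
  have \<sigma>_le: "norm (\<sigma> N z x) \<le> norm x" if z: "cmod z = 1" for N z x
  proof (rule norm_le_if_cinner_le)
    fix y
    have "real (Suc N) * cinner (\<sigma> N z x) y =
        (\<Sum>k\<in>{- int (Suc N)..int (Suc N)}. of_int (int (Suc N) - \<bar>k\<bar>) * (z powi k * cinner (\<gamma> k x) y))"
      unfolding \<sigma>_def fejer_mean_def cinner_sum_left sum_distrib_left
    proof (intro sum.cong refl)
      fix k assume "k \<in> {- int (Suc N)..int (Suc N)}"
      then have "real_of_int \<bar>k\<bar> \<le> real_of_int (int (Suc N))"
        unfolding of_int_le_iff by auto
      then have "real (Suc N) * fejer_weight N k = of_int (int (Suc N) - \<bar>k\<bar>)"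
        by (simp add: fejer_weight_def max_def field_simps)
      then have "complex_of_real (real (Suc N)) * complex_of_real (fejer_weight N k) = of_int (int (Suc N) - \<bar>k\<bar>)"
        by (metis of_real_mult of_real_of_int_eq)
      then show "complex_of_real (real (Suc N)) * cinner (z powi k *\<^sub>C fejer_weight N k *\<^sub>R \<gamma> k x) y =
          of_int (int (Suc N) - \<bar>k\<bar>) * (z powi k * cinner (\<gamma> k x) y)"
        unfolding scaleC_of_real[symmetric] cinner_scaleC_left by (metis mult.assoc mult.left_commute)
    qed
    then have "cmod (real (Suc N) * cinner (\<sigma> N z x) y) \<le> real (Suc N) * norm x * norm y"
      using bound[OF z, of "Suc N" x y] by simp
    then have "real (Suc N) * cmod (cinner (\<sigma> N z x) y) \<le> real (Suc N) * (norm x * norm y)"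
      by (simp add: norm_mult mult.assoc del: of_nat_Suc)
    then show "cmod (cinner (\<sigma> N z x) y) \<le> norm x * norm y"
      by (rule mult_left_le_imp_le) simp
  qed simp
  have s_le: "norm (s N x) \<le> norm x" for N x
    unfolding s_def by (rule norm_abs_L2_le_const[OF \<sigma>_l2]) (auto intro!: AE_I2 \<sigma>_le)
  \<comment> \<open>The squared norms are increasing and bounded, hence Cauchy, and they dominate
    the squared distances.\<close>
  have s_Cauchy: "Cauchy (\<lambda>N. s N x)" for x
  proof -
    define a where "a N = (norm (s N x))\<^sup>2" for N
    have diff: "(norm (s N x - s M x))\<^sup>2 \<le> a N - a M" if "M \<le> N" for M N
      unfolding a_def s_def \<sigma>_def by (rule norm_fejer_mean_diff[OF that])
    have "incseq a"
      by (rule incseq_SucI) (use diff[OF le_SucI[OF order_refl]] in \<open>metis diff_ge_0_iff_ge order_trans zero_le_power2\<close>)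
    moreover have "a N \<le> (norm x)\<^sup>2" for N
      unfolding a_def by (intro power_mono s_le) simp
    ultimately have "convergent a"
      using incseq_convergent by (metis convergentI)
    then have "Cauchy a"
      by (rule convergent_Cauchy)
    show ?thesis
    proof (rule metric_CauchyI)
      fix e :: real assume "0 < e"
      then obtain K where K: "\<And>M N. K \<le> M \<Longrightarrow> K \<le> N \<Longrightarrow> dist (a N) (a M) < e\<^sup>2"
        using metric_CauchyD[OF \<open>Cauchy a\<close>, of "e\<^sup>2"] by auto
      have "norm (s N x - s M x) < e" if "K \<le> M" "M \<le> N" for M N
      proof (rule power2_less_imp_less)
        show "(norm (s N x - s M x))\<^sup>2 < e\<^sup>2"
          using diff[OF that(2)] K[of M N] that by (simp add: dist_real_def)
      qed (use \<open>0 < e\<close> in simp)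
      then show "\<exists>K. \<forall>m\<ge>K. \<forall>n\<ge>K. dist (s m x) (s n x) < e"
        unfolding dist_norm by (metis nle_le norm_minus_commute)
    qed
  qed
  obtain D :: "'e set" where D: "countable D" "\<And>X. open X \<Longrightarrow> X \<noteq> {} \<Longrightarrow> \<exists>d\<in>D. d \<in> X"
    using countable_dense_setE by blast
  define d where "d = from_nat_into D"
  have D_eq: "D = range d"
    unfolding d_def using D by (metis UNIV_not_empty empty_iff open_UNIV range_from_nat_into)
  \<comment> \<open>The same subsequence must serve all of the dense set, so that a single null set
    remains.\<close>
  obtain r where r: "strict_mono r" "\<And>i k m n. i \<le> k \<Longrightarrow> r k \<le> m \<Longrightarrow> r k \<le> n \<Longrightarrow>
      dist (s m (d i)) (s n (d i)) < (1 / 2) ^ k"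
    using rapid_subsequence[of "\<lambda>i N. s N (d i)"] s_Cauchy by blast
  have "AE z in circle. convergent (\<lambda>n. \<sigma> (r n) z (d i))" for i
  proof (rule AE_convergent_L2[where N = i, OF \<sigma>_l2])
    fix n assume "i \<le> n"
    moreover have "r n \<le> r (Suc n)"
      using r(1) by (simp add: strict_mono_less_eq)
    ultimately show "norm (abs_L2 (\<lambda>z. \<sigma> (r (Suc n)) z (d i)) - abs_L2 (\<lambda>z. \<sigma> (r n) z (d i))) \<le> (1 / 2) ^ n"
      using r(2)[of i n "r (Suc n)" "r n"] by (simp add: s_def dist_norm)
  qed
  then have "AE z in circle. \<forall>i. convergent (\<lambda>n. \<sigma> (r n) z (d i))"
    by (simp add: AE_all_countable)
  then obtain E where E: "{z \<in> space circle. \<not> (\<forall>i. convergent (\<lambda>n. \<sigma> (r n) z (d i)))} \<subseteq> E"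
      "emeasure circle E = 0" "E \<in> sets circle"
    by (rule AE_E)
  \<comment> \<open>Membership in \<open>Linf\<close> demands a bounded linear operator at every
    point of the circle; the value 0 on the null set \<open>E\<close> ensures this.\<close>
  define \<Theta> where "\<Theta> z x = (if z \<in> E then 0 else lim (\<lambda>n. \<sigma> (r n) z x))" for z x
  have lim: "(\<lambda>n. \<sigma> (r n) z x) \<longlonglongrightarrow> \<Theta> z x" if z: "cmod z = 1" "z \<notin> E" for z x
  proof -
    have "convergent (\<lambda>n. \<sigma> (r n) z x)"
    proof (rule convergent_if_dense[OF _ \<sigma>_le[OF z(1)] D(2)])
      show "bounded_linear (\<sigma> (r n) z)" for n
        using \<sigma>_clinear by (simp add: bounded_clinear_def)
      show "convergent (\<lambda>n. \<sigma> (r n) z d)" if "d \<in> D" for d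
        using E(1) z that unfolding D_eq by auto
    qed
    then show ?thesis
      using z by (simp add: \<Theta>_def convergent_LIMSEQ_iff)
  qed
  have \<Theta>_le: "norm (\<Theta> z x) \<le> norm x" if "cmod z = 1" for z x
  proof (cases "z \<in> E")
    case True
    then show ?thesis by (simp add: \<Theta>_def)
  next
    case False
    show ?thesis
      by (rule Lim_bounded[OF tendsto_norm[OF lim[OF that False]]]) (use \<sigma>_le[OF that] in blast)
  qed
  have [measurable]: "(\<lambda>z. \<Theta> z x) \<in> borel_measurable circle" for x
  proof (rule borel_measurable_LIMSEQ_metric)
    show "(\<lambda>z. if z \<in> E then 0 else \<sigma> (r n) z x) \<in> borel_measurable circle" for n
      using E(3) by measurable
    show "(\<lambda>n. if z \<in> E then 0 else \<sigma> (r n) z x) \<longlonglongrightarrow> \<Theta> z x" if "z \<in> space circle" for z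
      using lim[of z x] that by (auto simp: \<Theta>_def)
  qed
  have \<Theta>: "\<Theta> \<in> Linf"
  proof (rule LinfI)
    show "bounded_clinear (\<Theta> z)" if z: "cmod z = 1" for z
    proof (cases "z \<in> E")
      case True
      then show ?thesis by (simp add: \<Theta>_def[abs_def] bounded_clinear_const_zero)
    next
      case False
      note lim = lim[OF z False]
      show ?thesis
      proof (rule bounded_clinearI[where K = 1])
        show "\<Theta> z (x + y) = \<Theta> z x + \<Theta> z y" for x y
          using LIMSEQ_unique[OF lim[of "x + y"]] tendsto_add[OF lim[of x] lim[of y]]
          by (simp add: bounded_clinear_add[OF \<sigma>_clinear])
        show "\<Theta> z (a *\<^sub>C x) = a *\<^sub>C \<Theta> z x" for a x
          using LIMSEQ_unique[OF lim[of "a *\<^sub>C x"]] tendsto_scaleC[OF tendsto_const lim[of x], of a]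
          by (simp add: bounded_clinear_scaleC[OF \<sigma>_clinear])
      qed (use \<Theta>_le[OF z] in simp)
    qed
    show "(\<lambda>z. cinner (\<Theta> z x) y) \<in> borel_measurable circle" for x y
      by measurable
    show "AE z in circle. \<forall>x. norm (\<Theta> z x) \<le> 1 * norm x"
      by (intro AE_I2 allI) (simp add: \<Theta>_le)
  qed
  have "fourier_coeff \<Theta> k x = \<gamma> k x" for k x
  proof (rule cinner_eqI)
    fix y
    have "cinner (fourier_coeff \<Theta> k x) y = cinner (mult_op \<Theta> (trig 0 x)) (trig k y)"
      by (simp add: cinner_mult_op_trig[OF \<Theta>])
    also have "mult_op \<Theta> (trig 0 x) = abs_L2 (\<lambda>z. \<Theta> z (z powi 0 *\<^sub>C x))"
      unfolding trig_def by (rule mult_op_abs_L2[OF \<Theta> trig_in_l2_fun])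
    also have "cinner \<dots> (trig k y) = (LINT z|circle. cinner (\<Theta> z x) (z powi k *\<^sub>C y))"
      unfolding trig_def cinner_abs_L2[OF Linf_l2_fun[OF \<Theta> trig_in_l2_fun] trig_in_l2_fun] by simp
    finally have coeff: "cinner (fourier_coeff \<Theta> k x) y = (LINT z|circle. cinner (\<Theta> z x) (z powi k *\<^sub>C y))" .
    have "(\<lambda>n. LINT z|circle. cinner (\<sigma> (r n) z x) (z powi k *\<^sub>C y)) \<longlonglongrightarrow>
        (LINT z|circle. cinner (\<Theta> z x) (z powi k *\<^sub>C y))"
    proof (rule integral_dominated_convergence[where w = "\<lambda>_. norm x * norm y"])
      show "AE z in circle. (\<lambda>n. cinner (\<sigma> (r n) z x) (z powi k *\<^sub>C y)) \<longlonglongrightarrow> cinner (\<Theta> z x) (z powi k *\<^sub>C y)"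
      proof -
        have "AE z in circle. z \<notin> E"
          using E by (intro AE_not_in) auto
        then show ?thesis
          using AE_space
        proof eventually_elim
          case (elim z)
          then show ?case by (intro tendsto_cinner lim tendsto_const) auto
        qed
      qed
      show "AE z in circle. norm (cinner (\<sigma> (r n) z x) (z powi k *\<^sub>C y)) \<le> norm x * norm y" for n
      proof (rule AE_I2)
        fix z assume "z \<in> space circle"
        then have z: "cmod z = 1" by simp
        have "norm (cinner (\<sigma> (r n) z x) (z powi k *\<^sub>C y)) \<le> norm (\<sigma> (r n) z x) * norm (z powi k *\<^sub>C y)"
          by (rule norm_cinner_le)
        also have "\<dots> \<le> norm x * norm y"
          using \<sigma>_le[OF z] by (simp add: norm_scaleC norm_powi_circle[OF z] mult_right_mono)
        finally show "norm (cinner (\<sigma> (r n) z x) (z powi k *\<^sub>C y)) \<le> norm x * norm y" .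
      qed
    qed simp_all
    moreover have "(LINT z|circle. cinner (\<sigma> (r n) z x) (z powi k *\<^sub>C y)) = fejer_weight (r n) k * cinner (\<gamma> k x) y" for n
      using cinner_fejer_mean_trig[of \<gamma> "r n" x k y]
      unfolding \<sigma>_def[symmetric] trig_def cinner_abs_L2[OF \<sigma>_l2 trig_in_l2_fun] .
    moreover have "(\<lambda>n. fejer_weight (r n) k * cinner (\<gamma> k x) y) \<longlonglongrightarrow> of_real 1 * cinner (\<gamma> k x) y"
      by (intro tendsto_mult tendsto_of_real fejer_weight_tendsto r tendsto_const)
    ultimately show "cinner (fourier_coeff \<Theta> k x) y = cinner (\<gamma> k x) y"
      unfolding coeff by (simp add: LIMSEQ_unique)
  qed
  with \<Theta> show ?thesis by (rule that)
qed


section \<open>The similarity theorem\<close>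

lemma Linf_symbol_tilde_adj:
  fixes \<Phi> :: "complex \<Rightarrow> 'e::{chilbert_space, second_countable_topology} \<Rightarrow> 'e"
  assumes \<Phi>: "\<Phi> \<in> Linf"
  shows "symbol_tilde_adj \<Phi> \<in> Linf"
proof -
  have clinear: "bounded_clinear (\<Phi> (cnj z))" if "cmod z = 1" for z
    using that by (intro Linf_bounded_clinear \<Phi>) simp
  obtain C where C: "0 \<le> C" "AE z in circle. \<forall>x. norm (\<Phi> z x) \<le> C * norm x"
    using Linf_bound[OF \<Phi>] .
  show ?thesis
  proof (rule LinfI)
    show "bounded_clinear (symbol_tilde_adj \<Phi> z)" if "cmod z = 1" for z
      unfolding symbol_tilde_adj_def by (rule bounded_clinear_cadjoint[OF clinear[OF that]])
    show "(\<lambda>z. cinner (symbol_tilde_adj \<Phi> z x) y) \<in> borel_measurable circle" for x y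
    proof -
      have "(\<lambda>z. \<Phi> (cnj z) y) \<in> borel_measurable circle"
        by (rule measurable_compose[OF measurable_circle_cnj Linf_measurable_const[OF \<Phi>]])
      then have "(\<lambda>z. cinner x (\<Phi> (cnj z) y)) \<in> borel_measurable circle"
        by measurable
      also have "?this \<longleftrightarrow> ?thesis"
        by (rule measurable_cong) (simp add: symbol_tilde_adj_def cinner_cadjoint_left[OF clinear])
      finally show ?thesis .
    qed
    show "AE z in circle. \<forall>x. norm (symbol_tilde_adj \<Phi> z x) \<le> C * norm x"
      using AE_circle_cnj[OF C(2)] AE_space
    proof eventually_elim
      case (elim z)
      then have "cinner (\<Phi> (cnj z) x) y = cinner x (symbol_tilde_adj \<Phi> z y)" for x y
        unfolding symbol_tilde_adj_def by (intro cinner_cadjoint_right clinear) simp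
      then show ?case
        using elim C(1) by (blast intro: norm_adjoint_le)
    qed
  qed
qed

lemma cinner_fourier_coeff:
  assumes "\<Phi> \<in> Linf"
  shows "cinner (fourier_coeff \<Phi> n x) y = (LINT z|circle. z powi (- n) * cinner (\<Phi> z x) y)"
proof -
  have "(LINT z|circle. cinner (z powi (- n) *\<^sub>C \<Phi> z x) y) = cinner (fourier_coeff \<Phi> n x) y"
    unfolding fourier_coeff_def
    by (rule integral_bounded_linear[OF bounded_bilinear.bounded_linear_left[OF bounded_bilinear_cinner]
          integrable_fourier[OF assms]])
  then show ?thesis
    by (simp only: cinner_scaleC_left)
qed

text \<open>The adjoint conjugates the exponential and the substitution of \<open>cnj z\<close>
  conjugates it back, so the index \<open>n\<close> is preserved and coanalytic symbols remain
  coanalytic.\<close>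

lemma fourier_coeff_symbol_tilde_adj:
  fixes \<Phi> :: "complex \<Rightarrow> 'e::{chilbert_space, second_countable_topology} \<Rightarrow> 'e"
  assumes \<Phi>: "\<Phi> \<in> Linf"
  shows "cinner (fourier_coeff (symbol_tilde_adj \<Phi>) n x) y = cinner x (fourier_coeff \<Phi> n y)"
proof -
  define h where "h z = z powi (- n) * cinner (\<Phi> z y) x" for z
  have [measurable]: "(\<lambda>z. cinner (\<Phi> z y) x) \<in> borel_measurable circle"
    using \<Phi> by (simp add: Linf_def)
  have h [measurable]: "h \<in> borel_measurable circle"
    unfolding h_def by measurable
  have "cinner (fourier_coeff (symbol_tilde_adj \<Phi>) n x) y =
      (LINT z|circle. z powi (- n) * cinner (symbol_tilde_adj \<Phi> z x) y)"
    by (rule cinner_fourier_coeff[OF Linf_symbol_tilde_adj[OF \<Phi>]])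
  also have "\<dots> = (LINT z|circle. cnj (h (cnj z)))"
  proof (rule Bochner_Integration.integral_cong[OF refl])
    fix z assume "z \<in> space circle"
    then have "bounded_clinear (\<Phi> (cnj z))"
      by (intro Linf_bounded_clinear \<Phi>) simp
    then have "cinner (symbol_tilde_adj \<Phi> z x) y = cinner x (\<Phi> (cnj z) y)"
      unfolding symbol_tilde_adj_def by (rule cinner_cadjoint_left)
    then show "z powi (- n) * cinner (symbol_tilde_adj \<Phi> z x) y = cnj (h (cnj z))"
      by (simp add: h_def flip: cinner_commute)
  qed
  also have "\<dots> = cnj (LINT z|circle. h z)"
    using integral_circle_cnj[of h] by simp
  also have "(LINT z|circle. h z) = cinner (fourier_coeff \<Phi> n y) x"
    unfolding h_def by (rule cinner_fourier_coeff[OF \<Phi>, symmetric])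
  finally show ?thesis
    by (simp flip: cinner_commute)
qed

lemma symbol_tilde_adj_zHinf_conj:
  assumes "\<Omega> \<in> zHinf_conj"
  shows "symbol_tilde_adj \<Omega> \<in> zHinf_conj"
proof -
  have \<Omega>: "\<Omega> \<in> Linf" "\<And>n x. 0 \<le> n \<Longrightarrow> fourier_coeff \<Omega> n x = 0"
    using assms by (auto simp: zHinf_conj_def)
  have "fourier_coeff (symbol_tilde_adj \<Omega>) n x = 0" if "0 \<le> n" for n x
    by (rule cinner_eqI) (simp add: fourier_coeff_symbol_tilde_adj[OF \<Omega>(1)] \<Omega>(2)[OF that])
  then show ?thesis
    by (simp add: zHinf_conj_def Linf_symbol_tilde_adj[OF \<Omega>(1)])
qed

lemma symbol_sumI:
  assumes "\<Phi> \<in> Linf" "\<Theta> \<in> Linf" "\<Omega> \<in> zHinf_conj"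
    "AE z in circle. \<forall>x. \<Phi> z x = (z - cnj z) *\<^sub>C \<Theta> z x + \<Omega> z x"
  shows "\<Phi> \<in> symbol_sum zdiff_Linf zHinf_conj"
proof -
  have "(\<lambda>z x. (z - cnj z) *\<^sub>C \<Theta> z x) \<in> zdiff_Linf"
    using assms(2) Linf_zdiff[OF assms(2)] by (auto simp: zdiff_Linf_def)
  then show ?thesis
    unfolding symbol_sum_def using assms(1,3,4) by (intro CollectI conjI bexI) auto
qed

text \<open>The factor \<open>z - cnj z\<close> changes sign under the substitution of
  \<open>cnj z\<close> and again under the adjoint, so each summand keeps its shape.\<close>

lemma symbol_tilde_adj_symbol_sum:
  fixes \<Phi> :: "complex \<Rightarrow> 'e::{chilbert_space, second_countable_topology} \<Rightarrow> 'e"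
  assumes \<Phi>: "\<Phi> \<in> Linf" and sum: "\<Phi> \<in> symbol_sum zdiff_Linf zHinf_conj"
  shows "symbol_tilde_adj \<Phi> \<in> symbol_sum zdiff_Linf zHinf_conj"
proof -
  obtain \<Theta> \<Omega> where \<Theta>: "\<Theta> \<in> Linf" and \<Omega>: "\<Omega> \<in> zHinf_conj"
    and eq: "AE z in circle. \<forall>x. \<Phi> z x = (z - cnj z) *\<^sub>C \<Theta> z x + \<Omega> z x"
    using symbol_sumE[OF sum] .
  have \<Omega>': "\<Omega> \<in> Linf"
    using \<Omega> by (simp add: zHinf_conj_def)
  have "AE z in circle. \<forall>x. symbol_tilde_adj \<Phi> z x =
      (z - cnj z) *\<^sub>C symbol_tilde_adj \<Theta> z x + symbol_tilde_adj \<Omega> z x"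
    using AE_circle_cnj[OF eq] AE_space
  proof eventually_elim
    case (elim z)
    then have z: "cmod (cnj z) = 1" by simp
    show ?case
    proof
      fix x
      show "symbol_tilde_adj \<Phi> z x = (z - cnj z) *\<^sub>C symbol_tilde_adj \<Theta> z x + symbol_tilde_adj \<Omega> z x"
        unfolding symbol_tilde_adj_def
        by (rule cinner_eqI) (simp add: elim(1) cinner_add_left cinner_add_right cinner_scaleC_left
            cinner_scaleC_right cinner_cadjoint_left[OF Linf_bounded_clinear[OF \<Phi> z]]
            cinner_cadjoint_left[OF Linf_bounded_clinear[OF \<Theta> z]]
            cinner_cadjoint_left[OF Linf_bounded_clinear[OF \<Omega>' z]])
    qed
  qed
  then show ?thesis
    by (rule symbol_sumI[OF Linf_symbol_tilde_adj[OF \<Phi>] Linf_symbol_tilde_adj[OF \<Theta>]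
          symbol_tilde_adj_zHinf_conj[OF \<Omega>]])
qed

lemma symbol_tilde_adj_involution:
  assumes "\<Phi> \<in> Linf" "cmod z = 1"
  shows "symbol_tilde_adj (symbol_tilde_adj \<Phi>) z = \<Phi> z"
proof -
  have "bounded_clinear (\<Phi> z)"
    using assms by (rule Linf_bounded_clinear)
  then have "cadjoint (cadjoint (\<Phi> z)) = \<Phi> z"
    by (intro cadjointI cinner_cadjoint_left)
  then show ?thesis
    by (simp add: symbol_tilde_adj_def)
qed

lemma symbol_tilde_adj_symbol_sum_iff:
  fixes \<Phi> :: "complex \<Rightarrow> 'e::{chilbert_space, second_countable_topology} \<Rightarrow> 'e"
  assumes \<Phi>: "\<Phi> \<in> Linf"
  shows "symbol_tilde_adj \<Phi> \<in> symbol_sum zdiff_Linf zHinf_conj \<longleftrightarrow> \<Phi> \<in> symbol_sum zdiff_Linf zHinf_conj"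
proof
  assume "symbol_tilde_adj \<Phi> \<in> symbol_sum zdiff_Linf zHinf_conj"
  then have "symbol_tilde_adj (symbol_tilde_adj \<Phi>) \<in> symbol_sum zdiff_Linf zHinf_conj"
    by (rule symbol_tilde_adj_symbol_sum[OF Linf_symbol_tilde_adj[OF \<Phi>]])
  then obtain \<Theta> \<Omega> where \<Theta>: "\<Theta> \<in> Linf" and \<Omega>: "\<Omega> \<in> zHinf_conj"
    and eq: "AE z in circle. \<forall>x. symbol_tilde_adj (symbol_tilde_adj \<Phi>) z x = (z - cnj z) *\<^sub>C \<Theta> z x + \<Omega> z x"
    by (rule symbol_sumE)
  \<comment> \<open>Applying the operation twice restores the symbol only on the circle, so
    membership is transferred by equality almost everywhere.\<close>
  have "AE z in circle. \<forall>x. \<Phi> z x = (z - cnj z) *\<^sub>C \<Theta> z x + \<Omega> z x"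
    using eq AE_space by eventually_elim (simp add: symbol_tilde_adj_involution[OF \<Phi>])
  then show "\<Phi> \<in> symbol_sum zdiff_Linf zHinf_conj"
    by (rule symbol_sumI[OF \<Phi> \<Theta> \<Omega>])
qed (rule symbol_tilde_adj_symbol_sum[OF \<Phi>])

text \<open>On the circle \<open>(z - cnj z) * cnj z = 1 - (cnj z)^2\<close>, and the second factor
  shifts indices by two. At the level of coefficients this is the equation
  \<open>G - A (A G) = H\<close>; \<open>a\<close> is there to undo a later scaling.\<close>

lemma fourier_coeff_zdiff:
  fixes \<Theta> :: "complex \<Rightarrow> 'e::{chilbert_space, second_countable_topology} \<Rightarrow> 'e"
  assumes \<Theta>: "\<Theta> \<in> Linf"
  shows "fourier_coeff (\<lambda>z x. (z - cnj z) *\<^sub>C (a * cnj z) *\<^sub>C \<Theta> z x) n x =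
    a *\<^sub>C (fourier_coeff \<Theta> n x - fourier_coeff \<Theta> (n + 2) x)"
proof -
  have "fourier_coeff (\<lambda>z x. (z - cnj z) *\<^sub>C (a * cnj z) *\<^sub>C \<Theta> z x) n x =
      (LINT z|circle. a *\<^sub>C (z powi (- n) *\<^sub>C \<Theta> z x - z powi (- (n + 2)) *\<^sub>C \<Theta> z x))"
    unfolding fourier_coeff_def
  proof (rule Bochner_Integration.integral_cong[OF refl])
    fix z assume "z \<in> space circle"
    then have z: "cmod z = 1" and "z \<noteq> 0" by auto
    have "z powi (- n) * ((z - cnj z) * (a * cnj z)) = a * (z powi (- n) * (z * cnj z) - z powi (- n) * (cnj z * cnj z))"
      by (simp add: algebra_simps)
    also have "z powi (- n) * (cnj z * cnj z) = z powi (- (n + 2))"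
      using powi_mult_cnj_powi[OF z, of "- n" 2] by (simp add: power2_eq_square)
    finally have "z powi (- n) * ((z - cnj z) * (a * cnj z)) = a * (z powi (- n) - z powi (- (n + 2)))"
      by (simp add: circle_mult_cnj(1)[OF z])
    then show "z powi (- n) *\<^sub>C (z - cnj z) *\<^sub>C (a * cnj z) *\<^sub>C \<Theta> z x =
        a *\<^sub>C (z powi (- n) *\<^sub>C \<Theta> z x - z powi (- (n + 2)) *\<^sub>C \<Theta> z x)"
      by (simp only: scaleC_scaleC flip: scaleC_diff_left)
  qed
  also have "\<dots> = a *\<^sub>C (LINT z|circle. z powi (- n) *\<^sub>C \<Theta> z x - z powi (- (n + 2)) *\<^sub>C \<Theta> z x)"
    by (rule integral_bounded_linear[OF bounded_bilinear.bounded_linear_right[OF bounded_bilinear_scaleC]])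
      (intro Bochner_Integration.integrable_diff integrable_fourier \<Theta>)
  also have "(LINT z|circle. z powi (- n) *\<^sub>C \<Theta> z x - z powi (- (n + 2)) *\<^sub>C \<Theta> z x) =
      fourier_coeff \<Theta> n x - fourier_coeff \<Theta> (n + 2) x"
    unfolding fourier_coeff_def by (intro Bochner_Integration.integral_diff integrable_fourier \<Theta>)
  finally show ?thesis .
qed

lemma fourier_coeff_diff:
  fixes \<Phi> \<Psi> :: "complex \<Rightarrow> 'e::{chilbert_space, second_countable_topology} \<Rightarrow> 'e"
  assumes "\<Phi> \<in> Linf" "\<Psi> \<in> Linf"
  shows "fourier_coeff (\<lambda>z x. \<Phi> z x - \<Psi> z x) n x = fourier_coeff \<Phi> n x - fourier_coeff \<Psi> n x"
  unfolding fourier_coeff_def scaleC_diff_right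
  by (intro Bochner_Integration.integral_diff integrable_fourier assms)

lemma symbol_sum_if_bounded:
  fixes \<Phi> :: "complex \<Rightarrow> 'e::{chilbert_space, second_countable_topology} \<Rightarrow> 'e"
  assumes \<Phi>: "\<Phi> \<in> Linf"
    and bound: "\<And>n y. norm (\<Sum>i<n. (cadjoint shift ^^ (2 * i + 1)) (hankel \<Phi> y)) \<le> M * norm y"
  shows "\<Phi> \<in> symbol_sum zdiff_Linf zHinf_conj"
proof -
  interpret H: hankel_operator shift "cadjoint shift" "hankel \<Phi>"
    by (rule hankel_operator_hankel[OF \<Phi>])
  obtain G where G: "bounded_clinear G" "\<And>f. cadjoint shift (G f) = G (shift f)"
    "\<And>f. G f - cadjoint shift (cadjoint shift (G f)) = hankel \<Phi> f"
    using H.hankel_equation_solvable[OF bound] by blast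
  have G_pos: "0 \<le> onorm G"
    using G(1) by (simp add: bounded_clinear_def onorm_pos_le)
  \<comment> \<open>The scaling brings \<open>G\<close> to norm at most 1/2, as
    \<open>nehari\<close> requires; the summand 1 covers \<open>G = 0\<close>.\<close>
  define c where "c = 1 / (2 * (onorm G + 1))"
  have c: "0 < c" "c * onorm G \<le> 1 / 2"
    using G_pos by (simp_all add: c_def field_simps)
  define \<Gamma> where "\<Gamma> f = complex_of_real c *\<^sub>C G f" for f
  interpret \<Gamma>: hankel_operator shift "cadjoint shift" \<Gamma>
    unfolding \<Gamma>_def
    by unfold_locales
      (simp_all add: bounded_clinear_scaleC_left G bounded_clinear_scaleC[OF shift.clinear_A])
  have "norm (\<Gamma> f) \<le> norm f / 2" for f
  proof -
    have "norm (\<Gamma> f) \<le> c * (onorm G * norm f)"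
      using bounded_clinear_norm_le[OF G(1), of f] c(1) by (simp add: \<Gamma>_def norm_scaleC)
    also have "\<dots> \<le> 1 / 2 * norm f"
      using mult_right_mono[OF c(2), of "norm f"] by (simp add: mult.assoc)
    finally show ?thesis by simp
  qed
  then obtain C :: "int \<Rightarrow> 'e H2 \<Rightarrow> 'e H2" where C: "\<And>k. bounded_clinear (C k)"
    "\<And>n f. C (int n) f = \<Gamma> ((shift ^^ n) f)"
    "\<And>N w f g. cmod w = 1 \<Longrightarrow> cadjoint shift f = 0 \<Longrightarrow> cadjoint shift g = 0 \<Longrightarrow>
      cmod (\<Sum>k\<in>{- int N..int N}. of_int (int N - \<bar>k\<bar>) * (w powi k * cinner (C k f) g)) \<le>
        real N * norm f * norm g"
    using \<Gamma>.nehari by blast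
  \<comment> \<open>The coefficients from \<open>nehari\<close> act on the Hardy space; compressing
    them to the constants gives operators on the coefficient space.\<close>
  define \<gamma> where "\<gamma> k x = cadjoint const_H2 (C k (const_H2 x))" for k and x :: 'e
  have cinner_\<gamma>: "cinner (\<gamma> k x) y = cinner (C k (const_H2 x)) (const_H2 y)" for k x y
    unfolding \<gamma>_def by (rule cinner_cadjoint_left[OF clinear_const_H2])
  have norm_const: "norm (const_H2 x) = norm x" for x :: 'e
    by (simp add: norm_H2.rep_eq Rep_const_H2)
  obtain \<Theta> where \<Theta>: "\<Theta> \<in> Linf" and coeff: "\<And>k x. fourier_coeff \<Theta> k x = \<gamma> k x"
  proof (rule symbol_with_fourier_coefficients[of \<gamma>])
    show "bounded_clinear (\<gamma> k)" for k
      unfolding \<gamma>_def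
      by (intro bounded_clinear_compose[OF bounded_clinear_cadjoint] bounded_clinear_compose[OF C(1)]
          clinear_const_H2)
    show "cmod (\<Sum>k\<in>{- int N..int N}. of_int (int N - \<bar>k\<bar>) * (w powi k * cinner (\<gamma> k x) y)) \<le>
        real N * norm x * norm y" if "cmod w = 1" for N w x y
      using C(3)[OF that, of "const_H2 x" "const_H2 y" N] by (simp add: cinner_\<gamma> norm_const)
  qed blast
  \<comment> \<open>This removes the factor \<open>c\<close> again. The remaining
    \<open>cnj z\<close> in the symbol pairs with \<open>z - cnj z\<close> to form
    \<open>1 - (cnj z)^2\<close>.\<close>
  define a where "a = complex_of_real (1 / c)"
  define \<Psi> where "\<Psi> z x = (z - cnj z) *\<^sub>C (a * cnj z) *\<^sub>C \<Theta> z x" for z x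
  have \<Theta>': "(\<lambda>z x. (a * cnj z) *\<^sub>C \<Theta> z x) \<in> Linf"
    by (rule Linf_scaleC[OF \<Theta>, where B = "cmod a"]) (auto simp: norm_mult)
  have \<Psi>: "\<Psi> \<in> Linf"
    unfolding \<Psi>_def by (rule Linf_zdiff[OF \<Theta>'])
  have "fourier_coeff (\<lambda>z x. \<Phi> z x - \<Psi> z x) n x = 0" if n: "0 \<le> n" for n x
  proof (rule cinner_eqI)
    fix y
    obtain m where m: "n = int m"
      using zero_le_imp_eq_int[OF n] by blast
    have shift2: "G ((shift ^^ nat (int m + 2)) f) = cadjoint shift (cadjoint shift (G ((shift ^^ m) f)))" for f
      by (simp add: nat_add_distrib G(2) numeral_2_eq_2)
    have "cinner (fourier_coeff \<Theta> (int k) x) y = c * cinner (G ((shift ^^ k) (const_H2 x))) (const_H2 y)" for k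
      by (simp add: coeff cinner_\<gamma> C(2) \<Gamma>_def cinner_scaleC_left)
    from this[of m] this[of "nat (int m + 2)"]
    have "cinner (fourier_coeff \<Psi> n x) y = cinner (hankel \<Phi> ((shift ^^ m) (const_H2 x))) (const_H2 y)"
      unfolding \<Psi>_def fourier_coeff_zdiff[OF \<Theta>] G(3)[symmetric] shift2 m using c(1)
      by (simp add: cinner_scaleC_left cinner_diff_left a_def field_simps)
    \<comment> \<open>Entries against constants suffice: with row index 0, the column index
      \<open>m\<close> runs through all coefficients of nonnegative index.\<close>
    also have "\<dots> = cinner (fourier_coeff \<Phi> n x) y"
      using cinner_hankel_powers[OF \<Phi>, of m x 0 y] by (simp add: m)
    finally show "cinner (fourier_coeff (\<lambda>z x. \<Phi> z x - \<Psi> z x) n x) y = cinner 0 y"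
      by (simp add: fourier_coeff_diff[OF \<Phi> \<Psi>] cinner_diff_left)
  qed
  then have "(\<lambda>z x. \<Phi> z x - \<Psi> z x) \<in> zHinf_conj"
    by (simp add: zHinf_conj_def Linf_diff[OF \<Phi> \<Psi>])
  then show ?thesis
    by (rule symbol_sumI[OF \<Phi> \<Theta>']) (simp add: \<Psi>_def)
qed

theorem mainTheorem4:
  fixes \<Phi> :: "complex \<Rightarrow> 'e::{chilbert_space, second_countable_topology} \<Rightarrow> 'e"
  assumes "\<Phi> \<in> Linf"
  shows "(similar_to_contraction (upper_block (cadjoint shift) (hankel \<Phi>) (cadjoint shift)) \<longleftrightarrow>
           symbol_tilde_adj \<Phi> \<in> symbol_sum zdiff_Linf zHinf_conj) \<and>
         (similar_to_contraction (upper_block (cadjoint shift) (hankel \<Phi>) (cadjoint shift)) \<longleftrightarrow>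
           \<Phi> \<in> symbol_sum zdiff_Linf zHinf_conj) \<and>
         (similar_to_contraction (upper_block shift (hankel \<Phi>) shift) \<longleftrightarrow>
           similar_to_contraction (upper_block (cadjoint shift) (hankel \<Phi>) (cadjoint shift)))"
proof -
  interpret H: hankel_operator shift "cadjoint shift" "hankel \<Phi>"
    by (rule hankel_operator_hankel[OF assms])
  have "similar_to_contraction (upper_block shift (hankel \<Phi>) shift) \<longleftrightarrow>
      \<Phi> \<in> symbol_sum zdiff_Linf zHinf_conj"
    using H.similar_to_contraction_S_imp_bounded symbol_sum_if_bounded[OF assms]
      symbol_sum_imp_similar_shift[OF assms] by blast
  moreover have "similar_to_contraction (upper_block (cadjoint shift) (hankel \<Phi>) (cadjoint shift)) \<longleftrightarrow>
      \<Phi> \<in> symbol_sum zdiff_Linf zHinf_conj"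
    using H.similar_to_contraction_A_imp_bounded symbol_sum_if_bounded[OF assms]
      symbol_sum_imp_similar_backward_shift[OF assms] by blast
  ultimately show ?thesis
    using symbol_tilde_adj_symbol_sum_iff[OF assms] by blast
qed

end
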